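(* Let $Z=\mathbb{R}^d$ and let $Z_n$ be a sequence of stochastic (Markov) processes in $\mathbb{R}^d$ with generators $A_n$. Assume that $A_n$ has a decomposition $A_n=A_{1,n}+A_{2,n}$ on a common core, and that $A_{1,n}$ and $A_{2,n}$ independently generate stochastic processes $X_n$ and $Y_n$. Assume moreover: (a) $A_n$, $A_{1,n}$ and $A_{2,n}$ share a common unique invariant measure $\pi_n$, and $\pi_n$ satisfies a large deviation principle on $\mathbb{R}^d$ with speed $n$ and rate function $S\in C^1(\mathbb{R}^d)$; (b) $\pi_n$ is reversible for $A_{2,n}$; (c) each of the processes $Z_n$, $X_n$, $Y_n$ satisfies a large deviation principle on $D_{\mathbb{R}^d}([0,\infty))$ with speed $n$ and with rate function of Lagrangian form, with Lagrangians $\mathcal{L}$, $\mathcal{L}_1$, $\mathcal{L}_2$ respectively; these Lagrangians correspond to Hamiltonians $H$, $H_1$, $H_2$ satisfying $H=H_1+H_2$ and $Hf(z)=\mathcal{H}(z,\mathrm{d}f(z))$, $H_1f(z)=\mathcal{H}_1(z,\mathrm{d}f(z))$, $H_2f(z)=\mathcal{H}_2(z,\mathrm{d}f(z))$; (d) $\mathcal{H}_1(z,\xi)=\langle W(z),\xi\rangle$ for some vector field $W\in C(\mathbb{R}^d;\mathbb{R}^d)$, and $\mathcal{H}_2$ is continuous and convex in the second coordinate. Consider on $\mathbb{R}^d\times\mathbb{R}$ (with points $(z,a)$) the dynamics $(Z_n(t),0)$ and the energy $\widehat{E}(z,a)=a$, and let $\mathbf{F}$ denote the limiting dynamics of $Z_n$.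 Then the processes $(Z_n(t),0)$ preserve $\widehat{E}$, and the limiting dynamics $(\mathbf{F},0)$ are GENERIC with energy $\widehat{E}$, entropy $\widehat{S}(z,a)=S(z)$, operators $$\widehat{L}(z,a)\begin{pmatrix}\xi \\ r\end{pmatrix}=\begin{pmatrix}r\,W(z) \\ -\langle W(z),\xi\rangle\end{pmatrix},$$ and dissipation potentials $(\widehat{\Psi},\widehat{\Psi}^* )$, where $$\widehat{\Psi}^*\bigl((z,a),(\xi,r)\bigr)=\mathcal{H}_2\bigl(z,\xi+\tfrac12\mathrm{d}S(z)\bigr)-\mathcal{H}_2\bigl(z,\tfrac12\mathrm{d}S(z)\bigr)$$ and $\widehat{\Psi}$ is the Legendre transform of $\widehat{\Psi}^*$.
   Context: $D_{\mathbb{R}^d}([0,\infty))$ is the Skorokhod space of càdlàg paths. A rate function is of Lagrangian form with Lagrangian $\mathcal{L}$ if it equals $I(\gamma)=I_0(\gamma(0))+\int_0^\infty\mathcal{L}(\gamma(s),\dot\gamma(s))\,\mathrm{d}s$ for absolutely continuous $\gamma$ and $+\infty$ otherwise, where $I_0$ is the large deviation rate function (speed $n$) of the laws of the processes at time zero. The Lagrangians $\mathcal{L},\mathcal{L}_1,\mathcal{L}_2:\mathbb{R}^d\times\mathbb{R}^d\to[0,\infty]$ and Hamiltonian functions $\mathcal{H},\mathcal{H}_1,\mathcal{H}_2:\mathbb{R}^d\times\mathbb{R}^d\to\mathbb{R}$ are convex in the second variable and Legendre duals of each other in that variable, e.g. $\mathcal{L}(z,v)=\sup_\xi\{\langle v,\xi\rangle-\mathcal{H}(z,\xi)\}$,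 with $\mathcal{H}(z,0)=\mathcal{H}_1(z,0)=\mathcal{H}_2(z,0)=0$. The limiting dynamics of $Z_n$ is $\dot z=\mathbf{F}(z)$, where $\mathbf{F}$ is the zero-cost flow of $\mathcal{L}$: $\mathcal{L}(z,v)=0$ if and only if $v=\mathbf{F}(z)$. Dissipation potentials: a pair $\Psi,\Psi^*$ with values in $[0,\infty]$, Legendre duals of each other in the second argument, such that $\Psi,\Psi^*$ are strictly convex (in the second argument) and continuously differentiable, and vanish when the second argument is $0$. Symmetric: even in the second argument. GENERIC (on a state space with points $y$, here $y=(z,a)\in\mathbb{R}^{d}\times\mathbb{R}$): a vector field $\mathbf{G}$ is GENERIC with entropy $S$, energy $E$, operators $L$ and dissipation potentials $(\Psi,\Psi^* )$ if: $(\Psi,\Psi^* )$ are symmetric dissipation potentials; $L(y)$ maps cotangent to tangent vectors with $\langle L(y)\xi,\eta\rangle=-\langle L(y)\eta,\xi\rangle$, and the bracket $\{F,G\}:=\langle\mathrm{d}F,L\,\mathrm{d}G\rangle$ satisfies the Jacobi identity $\{\{F_1,F_2\},F_3\}+\{\{F_3,F_1\},F_2\}+\{\{F_2,F_3\},F_1\}=0$ for smooth $F_i$; $L(y)\,\mathrm{d}S(y)=0$ and $\Psi^*(y,\xi+\alpha\,\mathrm{d}E(y))=\Psi^*(y,\xi)$ for all $y,\xi$ and $\alpha\in\mathbb{R}$; and for all $y$ $$\Psi(y,\mathbf{G}(y)-L(y)\,\mathrm{d}E(y))+\Psi^*\bigl(y,-\tfrac12\mathrm{d}S(y)\bigr)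+\tfrac12\langle\mathbf{G}(y),\mathrm{d}S(y)\rangle=0.$$
   Formalization: Ψ̂* is constant along dÊ, so strict convexity and C¹ (impossible as stated) are dropped from GENERIC and shown modulo dÊ if L₂, H₂ have them; as W is only continuous, Jacobi is claimed where the inner brackets are differentiable; the LDPs in (c) are taken to cover the start in πₙ. *)

theory Defs
  imports "HOL-Probability.Probability"
begin

section \<open>Gradients, smooth functions, convex duality\<close>

definition grad :: "('a::euclidean_space \<Rightarrow> real) \<Rightarrow> 'a \<Rightarrow> 'a" where
  "grad f x = (THE g. GDERIV f x :> g)"

fun Ck :: "nat \<Rightarrow> ('a::euclidean_space \<Rightarrow> real) \<Rightarrow> bool" where
  "Ck 0 f \<longleftrightarrow> continuous_on UNIV f"
| "Ck (Suc k) f \<longleftrightarrow> (\<forall>x. f differentiable (at x)) \<and> (\<forall>v. Ck k (\<lambda>x. grad f x \<bullet> v))"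

definition smooth :: "('a::euclidean_space \<Rightarrow> real) \<Rightarrow> bool" where
  "smooth f \<longleftrightarrow> (\<forall>k. Ck k f)"

definition legendre :: "('a::euclidean_space \<Rightarrow> ereal) \<Rightarrow> 'a \<Rightarrow> ereal" where
  "legendre f v = (SUP \<xi>. ereal (v \<bullet> \<xi>) - f \<xi>)"

definition convex_ereal :: "('a::euclidean_space \<Rightarrow> ereal) \<Rightarrow> bool" where
  "convex_ereal f \<longleftrightarrow> (\<forall>u v t. 0 < t \<and> t < 1 \<longrightarrow>
     f ((1 - t) *\<^sub>R u + t *\<^sub>R v) \<le> ereal (1 - t) * f u + ereal t * f v)"

text \<open>Strict convexity on the effective domain, up to translations in the linear subspace \<open>N\<close>;
  for \<open>N = {0}\<close> this is the usual notion for extended-valued functions.\<close>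

definition strictly_convex_mod :: "'a set \<Rightarrow> ('a::euclidean_space \<Rightarrow> ereal) \<Rightarrow> bool" where
  "strictly_convex_mod N f \<longleftrightarrow>
     (\<forall>u v t. 0 < t \<and> t < 1 \<and> f u < \<infinity> \<and> f v < \<infinity> \<and> u - v \<notin> N \<longrightarrow>
        f ((1 - t) *\<^sub>R u + t *\<^sub>R v) < ereal (1 - t) * f u + ereal t * f v)"

text \<open>Continuous differentiability, along the linear subspace \<open>V\<close>, in the interior (relative to
  \<open>V\<close>) of the effective domain.\<close>

definition C1_along :: "'a set \<Rightarrow> ('a::euclidean_space \<Rightarrow> ereal) \<Rightarrow> bool" where
  "C1_along V f \<longleftrightarrow>
     (let U = {v \<in> V. \<exists>e>0. \<forall>w\<in>V. dist w v < e \<longrightarrow> f w < \<infinity>}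
      in \<exists>g. continuous_on U g \<and>
           (\<forall>v\<in>U. ((\<lambda>w. real_of_ereal (f w)) has_derivative (\<lambda>h. g v \<bullet> h)) (at v within V)))"

definition hamiltonian_lagrangian ::
    "('a::euclidean_space \<Rightarrow> 'a \<Rightarrow> real) \<Rightarrow> ('a \<Rightarrow> 'a \<Rightarrow> ereal) \<Rightarrow> bool" where
  "hamiltonian_lagrangian h l \<longleftrightarrow>
     (\<forall>z. convex_on UNIV (h z) \<and> convex_ereal (l z) \<and> (\<forall>v. 0 \<le> l z v) \<and> h z 0 = 0 \<and>
          (\<forall>v. l z v = legendre (\<lambda>\<xi>. ereal (h z \<xi>)) v) \<and>
          (\<forall>\<xi>. ereal (h z \<xi>) = legendre (l z) \<xi>))"

section \<open>Large deviation principles\<close>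

text \<open>Rate functions are lower semicontinuous; compactness of the sublevel sets (goodness) is not
  required. All large deviation principles have speed \<open>n\<close>.\<close>

definition rate_function :: "'x topology \<Rightarrow> ('x \<Rightarrow> ereal) \<Rightarrow> bool" where
  "rate_function T I \<longleftrightarrow>
     (\<forall>x\<in>topspace T. 0 \<le> I x) \<and> (\<forall>c::real. closedin T {x \<in> topspace T. I x \<le> ereal c})"

definition log_prob :: "'x measure \<Rightarrow> 'x set \<Rightarrow> ereal" where
  "log_prob M A = (if measure M A = 0 then - \<infinity> else ereal (ln (measure M A)))"

definition LDP :: "'x topology \<Rightarrow> (nat \<Rightarrow> 'x measure) \<Rightarrow> ('x \<Rightarrow> ereal) \<Rightarrow> bool" where
  "LDP T Q I \<longleftrightarrow> rate_function T I \<and>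
     (\<forall>C. closedin T C \<longrightarrow>
        limsup (\<lambda>n. ereal (1 / real n) * log_prob (Q n) C) \<le> - (INF x\<in>C. I x)) \<and>
     (\<forall>G. openin T G \<longrightarrow>
        - (INF x\<in>G. I x) \<le> liminf (\<lambda>n. ereal (1 / real n) * log_prob (Q n) G))"

section \<open>Skorokhod space\<close>

text \<open>Paths \<open>[0,\<infinity>) \<rightarrow> E\<close> are represented by functions on \<open>real\<close> that are \<open>undefined\<close> at negative
  times.\<close>

definition cadlag :: "(real \<Rightarrow> 'a::metric_space) set" where
  "cadlag = {\<gamma> \<in> extensional {0..}.
     (\<forall>t\<ge>0. continuous (at_right t) \<gamma>) \<and> (\<forall>t>0. \<exists>l. (\<gamma> \<longlongrightarrow> l) (at_left t))}"

text \<open>The \<open>J\<^sub>1\<close> topology. By Ethier and Kurtz, Markov Processes, Proposition 3.5.3,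
  \<open>x\<^sub>n \<rightarrow> x\<close> for the Skorokhod metric iff \<open>x\<^sub>n\<close> is eventually in \<open>skorokhod_nbhd x T e\<close> for all
  \<open>T\<close> and \<open>e > 0\<close>; as the topology is metrizable, it is the one with these neighbourhoods.\<close>

definition time_changes :: "(real \<Rightarrow> real) set" where
  "time_changes = {\<tau>. strict_mono_on {0..} \<tau> \<and> \<tau> ` {0..} = {0..}}"

definition skorokhod_nbhd ::
    "(real \<Rightarrow> 'a::metric_space) \<Rightarrow> real \<Rightarrow> real \<Rightarrow> (real \<Rightarrow> 'a) set" where
  "skorokhod_nbhd x T e = {y \<in> cadlag. \<exists>\<tau>\<in>time_changes.
     \<forall>t\<in>{0..T}. \<bar>\<tau> t - t\<bar> < e \<and> dist (y t) (x (\<tau> t)) < e}"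

definition skorokhod_open :: "(real \<Rightarrow> 'a::metric_space) set \<Rightarrow> bool" where
  "skorokhod_open U \<longleftrightarrow> U \<subseteq> cadlag \<and> (\<forall>x\<in>U. \<exists>T e. 0 < e \<and> skorokhod_nbhd x T e \<subseteq> U)"

definition skorokhod :: "(real \<Rightarrow> 'a::metric_space) topology" where
  "skorokhod = topology skorokhod_open"

lemma skorokhod_nbhd_mono:
  "S \<le> T \<Longrightarrow> d \<le> e \<Longrightarrow> skorokhod_nbhd x T d \<subseteq> skorokhod_nbhd x S e"
  unfolding skorokhod_nbhd_def
  by (rule Collect_mono) (meson atLeastAtMost_iff order_less_le_trans order_trans)

lemma istopology_skorokhod: "istopology skorokhod_open"
  unfolding istopology_def
proof (intro conjI allI impI)
  fix U V :: "(real \<Rightarrow> 'a) set"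
  assume U: "skorokhod_open U" and V: "skorokhod_open V"
  show "skorokhod_open (U \<inter> V)"
    unfolding skorokhod_open_def
  proof (intro conjI ballI)
    show "U \<inter> V \<subseteq> cadlag" using U unfolding skorokhod_open_def by blast
    fix x assume x: "x \<in> U \<inter> V"
    obtain T d where 1: "0 < d" "skorokhod_nbhd x T d \<subseteq> U"
      using U x unfolding skorokhod_open_def by blast
    obtain S e where 2: "0 < e" "skorokhod_nbhd x S e \<subseteq> V"
      using V x unfolding skorokhod_open_def by blast
    have "skorokhod_nbhd x (max S T) (min d e) \<subseteq> U \<inter> V"
      using skorokhod_nbhd_mono[of T "max S T" "min d e" d x]
        skorokhod_nbhd_mono[of S "max S T" "min d e" e x] 1 2 by auto
    moreover have "0 < min d e" using 1 2 by simp
    ultimately show "\<exists>T e. 0 < e \<and> skorokhod_nbhd x T e \<subseteq> U \<inter> V" by blast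
  qed
next
  fix K :: "(real \<Rightarrow> 'a) set set"
  assume "\<forall>U\<in>K. skorokhod_open U"
  then show "skorokhod_open (\<Union>K)"
    unfolding skorokhod_open_def by (meson Union_iff Sup_least Union_upper order_trans)
qed

lemma openin_skorokhod: "openin skorokhod = skorokhod_open"
  unfolding skorokhod_def using istopology_skorokhod by (rule topology_inverse')

lemma topspace_skorokhod: "topspace skorokhod = cadlag"
proof -
  have "skorokhod_nbhd x 0 1 \<subseteq> cadlag" for x :: "real \<Rightarrow> 'a"
    unfolding skorokhod_nbhd_def by blast
  then have "skorokhod_open (cadlag :: (real \<Rightarrow> 'a) set)"
    unfolding skorokhod_open_def using zero_less_one by blast
  then show ?thesis
    unfolding topspace_def openin_skorokhod by (auto simp: skorokhod_open_def)
qed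

definition skorokhod_borel :: "(real \<Rightarrow> 'a::metric_space) measure" where
  "skorokhod_borel = sigma cadlag {U. openin skorokhod U}"

section \<open>Rate functions of Lagrangian form\<close>

text \<open>Absolutely continuous paths are the indefinite Lebesgue integrals of locally integrable
  functions; the density is determined almost everywhere.\<close>

definition has_density :: "(real \<Rightarrow> 'a::euclidean_space) \<Rightarrow> (real \<Rightarrow> 'a) \<Rightarrow> bool" where
  "has_density \<gamma> g \<longleftrightarrow>
     (\<forall>t\<ge>0. set_integrable lborel {0..t} g \<and> \<gamma> t = \<gamma> 0 + (LINT s:{0..t}|lborel. g s))"

definition lagrangian_rate ::
    "('a::euclidean_space \<Rightarrow> ereal) \<Rightarrow> ('a \<Rightarrow> 'a \<Rightarrow> ereal) \<Rightarrow> (real \<Rightarrow> 'a) \<Rightarrow> ereal" where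
  "lagrangian_rate I0 l \<gamma> =
     (if \<exists>g. has_density \<gamma> g
      then I0 (\<gamma> 0) +
        enn2ereal (\<integral>\<^sup>+s\<in>{0..}. e2ennreal (l (\<gamma> s) ((SOME g. has_density \<gamma> g) s)) \<partial>lborel)
      else \<infinity>)"

section \<open>Markov processes and their generators\<close>

definition transition_semigroup :: "(real \<Rightarrow> 'a::euclidean_space \<Rightarrow> 'a measure) \<Rightarrow> bool" where
  "transition_semigroup P \<longleftrightarrow>
     (\<forall>t\<ge>0. P t \<in> borel \<rightarrow>\<^sub>M prob_algebra borel) \<and>
     (\<forall>x. P 0 x = return borel x) \<and>
     (\<forall>s\<ge>0. \<forall>t\<ge>0. \<forall>x. P (s + t) x = P s x \<bind> P t)"

definition past :: "real \<Rightarrow> (real \<Rightarrow> 'a::euclidean_space) set set" where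
  "past s = sigma_sets cadlag {{\<gamma> \<in> cadlag. \<gamma> u \<in> B} | u B. 0 \<le> u \<and> u \<le> s \<and> B \<in> sets borel}"

text \<open>\<open>Q\<close> is the law on path space of a Markov process with transition function \<open>P\<close> and initial
  law \<open>\<mu>\<close>. Coordinates are automatically measurable for the Borel sets of the Skorokhod topology;
  the corresponding conjunct only records this.\<close>

definition markov_law ::
    "(real \<Rightarrow> 'a::euclidean_space \<Rightarrow> 'a measure) \<Rightarrow> 'a measure \<Rightarrow> (real \<Rightarrow> 'a) measure \<Rightarrow> bool" where
  "markov_law P \<mu> Q \<longleftrightarrow>
     prob_space Q \<and> space Q = cadlag \<and> sets Q = sets skorokhod_borel \<and>
     (\<forall>t\<ge>0. (\<lambda>\<gamma>. \<gamma> t) \<in> borel_measurable Q) \<and>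
     distr Q borel (\<lambda>\<gamma>. \<gamma> 0) = \<mu> \<and>
     (\<forall>s\<ge>0. \<forall>t\<ge>0. \<forall>A\<in>past s. \<forall>B\<in>sets borel.
        measure Q (A \<inter> {\<gamma> \<in> cadlag. \<gamma> (s + t) \<in> B}) =
          (LINT \<gamma>:A|Q. measure (P t (\<gamma> s)) B))"

definition markov_process ::
    "(real \<Rightarrow> 'a::euclidean_space \<Rightarrow> 'a measure) \<Rightarrow> ('a measure \<Rightarrow> (real \<Rightarrow> 'a) measure) \<Rightarrow> bool" where
  "markov_process P Z \<longleftrightarrow> transition_semigroup P \<and>
     (\<forall>\<mu>\<in>space (prob_algebra borel). markov_law P \<mu> (Z \<mu>))"

definition linear_class :: "('a \<Rightarrow> real) set \<Rightarrow> bool" where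
  "linear_class D \<longleftrightarrow> (\<lambda>_. 0) \<in> D \<and>
     (\<forall>f\<in>D. \<forall>g\<in>D. (\<lambda>x. f x + g x) \<in> D) \<and> (\<forall>c. \<forall>f\<in>D. (\<lambda>x. c * f x) \<in> D)"

text \<open>Spaces on which generators act, such as \<open>C\<^sub>0\<close>: sup-norm closed linear spaces of bounded Borel
  functions that separate probability measures.\<close>

definition function_space :: "('a::euclidean_space \<Rightarrow> real) set \<Rightarrow> bool" where
  "function_space B \<longleftrightarrow> linear_class B \<and>
     (\<forall>f\<in>B. f \<in> borel_measurable borel \<and> bounded (range f)) \<and>
     (\<forall>fs f. (\<forall>k::nat. fs k \<in> B) \<and> uniform_limit UNIV fs f sequentially \<longrightarrow> f \<in> B) \<and>
     (\<forall>\<mu>\<in>space (prob_algebra borel). \<forall>\<nu>\<in>space (prob_algebra borel).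
        (\<forall>f\<in>B. (LINT x|\<mu>. f x) = (LINT x|\<nu>. f x)) \<longrightarrow> \<mu> = \<nu>)"

text \<open>Operators are identified with their graphs.\<close>

definition generator ::
    "('a::euclidean_space \<Rightarrow> real) set \<Rightarrow> (real \<Rightarrow> 'a \<Rightarrow> 'a measure) \<Rightarrow>
     (('a \<Rightarrow> real) \<times> ('a \<Rightarrow> real)) set" where
  "generator B P = {(f, g). f \<in> B \<and> g \<in> B \<and>
     uniform_limit UNIV (\<lambda>t x. ((LINT y|P t x. f y) - f x) / t) g (at_right 0)}"

definition generates ::
    "('a::euclidean_space \<Rightarrow> real) set \<Rightarrow> (('a \<Rightarrow> real) \<times> ('a \<Rightarrow> real)) set \<Rightarrow>
     (real \<Rightarrow> 'a \<Rightarrow> 'a measure) \<Rightarrow> bool" where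
  "generates B A P \<longleftrightarrow> function_space B \<and> transition_semigroup P \<and>
     (\<forall>t\<ge>0. \<forall>f\<in>B. (\<lambda>x. LINT y|P t x. f y) \<in> B) \<and>
     (\<forall>f\<in>B. uniform_limit UNIV (\<lambda>t x. LINT y|P t x. f y) f (at_right 0)) \<and>
     A = generator B P"

definition is_core :: "('a \<Rightarrow> real) set \<Rightarrow> (('a \<Rightarrow> real) \<times> ('a \<Rightarrow> real)) set \<Rightarrow> bool" where
  "is_core D A \<longleftrightarrow> linear_class D \<and> D \<subseteq> Domain A \<and>
     (\<forall>(f, g)\<in>A. \<exists>fs gs. (\<forall>k::nat. fs k \<in> D \<and> (fs k, gs k) \<in> A) \<and>
        uniform_limit UNIV fs f sequentially \<and> uniform_limit UNIV gs g sequentially)"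

definition sum_on_common_core ::
    "(('a \<Rightarrow> real) \<times> ('a \<Rightarrow> real)) set \<Rightarrow> (('a \<Rightarrow> real) \<times> ('a \<Rightarrow> real)) set \<Rightarrow>
     (('a \<Rightarrow> real) \<times> ('a \<Rightarrow> real)) set \<Rightarrow> bool" where
  "sum_on_common_core A A1 A2 \<longleftrightarrow>
     (\<exists>D. is_core D A \<and> is_core D A1 \<and> is_core D A2 \<and>
        (\<forall>f\<in>D. \<forall>g1 g2. (f, g1) \<in> A1 \<and> (f, g2) \<in> A2 \<longrightarrow> (f, \<lambda>x. g1 x + g2 x) \<in> A))"

definition invariant_measure ::
    "(real \<Rightarrow> 'a::euclidean_space \<Rightarrow> 'a measure) \<Rightarrow> 'a measure \<Rightarrow> bool" where
  "invariant_measure P \<mu> \<longleftrightarrow> \<mu> \<in> space (prob_algebra borel) \<and> (\<forall>t\<ge>0. \<mu> \<bind> P t = \<mu>)"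

definition unique_invariant_measure ::
    "(real \<Rightarrow> 'a::euclidean_space \<Rightarrow> 'a measure) \<Rightarrow> 'a measure \<Rightarrow> bool" where
  "unique_invariant_measure P \<mu> \<longleftrightarrow> (\<forall>\<nu>. invariant_measure P \<nu> \<longleftrightarrow> \<nu> = \<mu>)"

definition reversible_measure ::
    "(real \<Rightarrow> 'a::euclidean_space \<Rightarrow> 'a measure) \<Rightarrow> 'a measure \<Rightarrow> bool" where
  "reversible_measure P \<mu> \<longleftrightarrow> \<mu> \<in> space (prob_algebra borel) \<and>
     (\<forall>t\<ge>0. \<forall>B\<in>sets borel. \<forall>C\<in>sets borel.
        (LINT x:B|\<mu>. measure (P t x) C) = (LINT x:C|\<mu>. measure (P t x) B))"

text \<open>\<open>V\<close> is the class of sequences of initial laws for which the processes \<open>Z n\<close> satisfy the path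
  space principle; \<open>I0\<close> is the rate function of the laws at time zero. (Allowing all initial laws
  with some rate function, good or not, would exclude even diffusions with small noise, because
  heavy-tailed initial laws destroy the upper bound.)\<close>

definition lagrangian_LDP ::
    "(nat \<Rightarrow> 'a::euclidean_space measure) set \<Rightarrow> (nat \<Rightarrow> 'a measure \<Rightarrow> (real \<Rightarrow> 'a) measure) \<Rightarrow>
     ('a \<Rightarrow> 'a \<Rightarrow> ereal) \<Rightarrow> bool" where
  "lagrangian_LDP V Z l \<longleftrightarrow>
     (\<forall>\<nu>\<in>V. \<forall>I0. LDP euclidean \<nu> I0 \<longrightarrow>
        LDP skorokhod (\<lambda>n. Z n (\<nu> n)) (lagrangian_rate I0 l))"

section \<open>GENERIC\<close>

definition symmetric_dissipation_potentials ::
    "('a::euclidean_space \<Rightarrow> 'a \<Rightarrow> ereal) \<Rightarrow> ('a \<Rightarrow> 'a \<Rightarrow> ereal) \<Rightarrow> bool" where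
  "symmetric_dissipation_potentials \<Psi> \<Psi>s \<longleftrightarrow>
     (\<forall>y. (\<forall>v. 0 \<le> \<Psi> y v) \<and> (\<forall>\<xi>. 0 \<le> \<Psi>s y \<xi>) \<and>
          \<Psi> y = legendre (\<Psi>s y) \<and> \<Psi>s y = legendre (\<Psi> y) \<and>
          convex_ereal (\<Psi> y) \<and> convex_ereal (\<Psi>s y) \<and>
          \<Psi> y 0 = 0 \<and> \<Psi>s y 0 = 0 \<and>
          (\<forall>v. \<Psi> y (- v) = \<Psi> y v) \<and> (\<forall>\<xi>. \<Psi>s y (- \<xi>) = \<Psi>s y \<xi>))"

text \<open>Strict convexity and continuous differentiability of dissipation potentials that are degenerate
  in the direction \<open>e y\<close>. For \<open>e y = 0\<close> both potentials are strictly convex and continuously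
  differentiable in the usual sense. In GENERIC, \<open>e\<close> is the differential of the energy: the
  degeneracy condition makes \<open>\<Psi>s y\<close> constant along \<open>e y\<close>, and \<open>\<Psi> y = \<infinity>\<close> off the annihilator of
  \<open>e y\<close>, so that the usual sense is impossible wherever \<open>e y \<noteq> 0\<close>.\<close>

definition regular_potentials ::
    "('a::euclidean_space \<Rightarrow> 'a) \<Rightarrow> ('a \<Rightarrow> 'a \<Rightarrow> ereal) \<Rightarrow> ('a \<Rightarrow> 'a \<Rightarrow> ereal) \<Rightarrow> bool" where
  "regular_potentials e \<Psi> \<Psi>s \<longleftrightarrow>
     (\<forall>y. strictly_convex_mod (span {e y}) (\<Psi>s y) \<and> C1_along UNIV (\<Psi>s y) \<and>
          strictly_convex_mod {0} (\<Psi> y) \<and> C1_along {v. v \<bullet> e y = 0} (\<Psi> y))"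

definition bracket ::
    "('a::euclidean_space \<Rightarrow> 'a \<Rightarrow> 'a) \<Rightarrow> ('a \<Rightarrow> real) \<Rightarrow> ('a \<Rightarrow> real) \<Rightarrow> 'a \<Rightarrow> real" where
  "bracket L F G y = grad F y \<bullet> L y (grad G y)"

text \<open>The iterated brackets involve derivatives of \<open>L\<close>. Where \<open>L\<close> is differentiable, the
  differentiability premise holds for all smooth \<open>F1\<close>, \<open>F2\<close>, \<open>F3\<close>; it matters only for the merely
  continuous \<open>L\<close>.\<close>

definition jacobi_identity :: "('a::euclidean_space \<Rightarrow> 'a \<Rightarrow> 'a) \<Rightarrow> bool" where
  "jacobi_identity L \<longleftrightarrow>
     (\<forall>F1 F2 F3 y. smooth F1 \<and> smooth F2 \<and> smooth F3 \<and>
        bracket L F1 F2 differentiable (at y) \<and> bracket L F3 F1 differentiable (at y) \<and>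
        bracket L F2 F3 differentiable (at y) \<longrightarrow>
        bracket L (bracket L F1 F2) F3 y + bracket L (bracket L F3 F1) F2 y
          + bracket L (bracket L F2 F3) F1 y = 0)"

definition GENERIC ::
    "('a::euclidean_space \<Rightarrow> 'a) \<Rightarrow> ('a \<Rightarrow> real) \<Rightarrow> ('a \<Rightarrow> real) \<Rightarrow> ('a \<Rightarrow> 'a \<Rightarrow> 'a) \<Rightarrow>
     ('a \<Rightarrow> 'a \<Rightarrow> ereal) \<Rightarrow> ('a \<Rightarrow> 'a \<Rightarrow> ereal) \<Rightarrow> bool" where
  "GENERIC G S E L \<Psi> \<Psi>s \<longleftrightarrow>
     Ck 1 S \<and> Ck 1 E \<and>
     symmetric_dissipation_potentials \<Psi> \<Psi>s \<and>
     (\<forall>y. linear (L y)) \<and> (\<forall>y \<xi> \<eta>. L y \<xi> \<bullet> \<eta> = - (L y \<eta> \<bullet> \<xi>)) \<and> jacobi_identity L \<and>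
     (\<forall>y. L y (grad S y) = 0) \<and>
     (\<forall>y \<xi> \<alpha>. \<Psi>s y (\<xi> + \<alpha> *\<^sub>R grad E y) = \<Psi>s y \<xi>) \<and>
     (\<forall>y. \<Psi> y (G y - L y (grad E y)) + \<Psi>s y (- (1/2) *\<^sub>R grad S y)
            + ereal (1/2 * (G y \<bullet> grad S y)) = 0)"

definition Psi_hat_star ::
    "('a::euclidean_space \<Rightarrow> 'a \<Rightarrow> real) \<Rightarrow> ('a \<Rightarrow> real) \<Rightarrow> 'a \<times> real \<Rightarrow> 'a \<times> real \<Rightarrow> ereal" where
  "Psi_hat_star h S = (\<lambda>(z, a) (\<xi>, r).
     ereal (h z (\<xi> + (1/2) *\<^sub>R grad S z) - h z ((1/2) *\<^sub>R grad S z)))"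

definition L_hat :: "('a::euclidean_space \<Rightarrow> 'a) \<Rightarrow> 'a \<times> real \<Rightarrow> 'a \<times> real \<Rightarrow> 'a \<times> real" where
  "L_hat W = (\<lambda>(z, a) (\<xi>, r). (r *\<^sub>R W z, - (W z \<bullet> \<xi>)))"

end

theory Submission
  imports Defs "HOL-Complex_Analysis.Great_Picard"
begin

text \<open>Stationarity of \<open>\<pi>\<^sub>n\<close> for the process with generator \<open>A\<^sub>1\<^sub>,\<^sub>n\<close>, whose large deviation paths
  follow \<open>W\<close>, forces \<open>W \<bullet> grad S = 0\<close>. Reversibility of \<open>\<pi>\<^sub>n\<close> for \<open>A\<^sub>2\<^sub>,\<^sub>n\<close> makes the probabilities
  of \<open>\<gamma> 0 \<in> C, \<gamma> t \<in> D\<close> and of \<open>\<gamma> 0 \<in> D, \<gamma> t \<in> C\<close> equal. Comparing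
  the rates of these events for small balls and \<open>t \<rightarrow> 0\<close> gives
  \<open>l2 x (- p) \<le> l2 x p - grad S x \<bullet> p\<close> for all subgradients \<open>p\<close> of \<open>h2 x\<close>, hence the symmetry
  \<open>h2 x (grad S x - \<xi>) = h2 x \<xi>\<close>. The paths needed for the lower bounds are
  integral curves of a continuous selection of subgradients; they exist by Peano's theorem, and
  they are continued beyond time \<open>t\<close> by paths of almost zero cost, which exist because \<open>\<pi>\<^sub>n\<close> is
  invariant. With \<open>l z v = l2 z (v - W z)\<close>, everything else is convex duality, except for the
  Jacobi identity of a bivector field with a merely continuous coefficient.\<close>

section \<open>Gradients\<close>

text \<open>Two obstacles shape the argument. The Lagrangians may be infinite or discontinuous, so
  of a path produced by an upper bound only the end points and the total cost are known; such paths
  are exploited through the Young inequality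
  \<open>v \<bullet> \<xi> - h z \<xi> \<le> l z v\<close>, integrated in time with a constant
  covector. And straight lines may have infinite cost, because the effective domain of
  \<open>l z\<close> can vary with \<open>z\<close>. Hence velocities are taken to be subgradients,
  where \<open>l\<close> is explicit and finite; since \<open>h2\<close> need not be differentiable,
  a proximal map selects them continuously.

  Stationarity is used in two directions: a path of cost \<kappa> from a to b forces
  \<open>S b \<le> S a + \<kappa>\<close>, and every point is almost reached at time t by some path
  whose rate is about the value of \<open>S\<close> there. The first gives
  \<open>W \<bullet> grad S \<le> 0\<close>, the second the opposite inequality. All tolerances are
  o(t), as each estimate is finally divided by t.

  In the GENERIC equation the terms with half the gradient of \<open>S\<close> cancel by this
  orthogonality, and what remains is \<open>l2 z (F z - W z) = 0\<close>.\<close>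

lemma GDERIV_unique: "GDERIV f x :> g \<Longrightarrow> GDERIV f x :> g' \<Longrightarrow> g = g'"
  unfolding gderiv_def by (metis has_derivative_unique inner_commute vector_eq_rdot)

lemma grad_eqI: "GDERIV f x :> g \<Longrightarrow> grad f x = g"
  unfolding grad_def by (blast intro: the_equality GDERIV_unique)

lemma GDERIV_iff: "GDERIV f x :> g \<longleftrightarrow> (f has_derivative (\<lambda>h. g \<bullet> h)) (at x)"
  by (simp add: gderiv_def inner_commute)

lemma GDERIV_grad:
  fixes f :: "'a::euclidean_space \<Rightarrow> real"
  assumes "f differentiable at x"
  shows "GDERIV f x :> grad f x"
proof -
  from assms obtain f' where f': "(f has_derivative f') (at x)"
    by (auto simp: differentiable_def)
  then have lin: "linear f'" by (rule has_derivative_linear)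
  have "f' = (\<lambda>h. (\<Sum>b\<in>Basis. f' b *\<^sub>R b) \<bullet> h)"
  proof
    fix h
    have "f' h = f' (\<Sum>b\<in>Basis. (h \<bullet> b) *\<^sub>R b)" by (simp add: euclidean_representation)
    also have "\<dots> = (\<Sum>b\<in>Basis. (h \<bullet> b) * f' b)"
      using lin by (simp add: linear_sum linear_scale)
    also have "\<dots> = (\<Sum>b\<in>Basis. f' b *\<^sub>R b) \<bullet> h"
      by (auto simp: inner_sum_left inner_commute[of h] intro!: sum.cong)
    finally show "f' h = (\<Sum>b\<in>Basis. f' b *\<^sub>R b) \<bullet> h" .
  qed
  with f' have "GDERIV f x :> (\<Sum>b\<in>Basis. f' b *\<^sub>R b)" unfolding GDERIV_iff by metis
  then show ?thesis using grad_eqI by metis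
qed

lemma has_derivative_grad:
  "f differentiable at x \<Longrightarrow> (f has_derivative (\<lambda>h. grad f x \<bullet> h)) (at x)"
  using GDERIV_grad GDERIV_iff by blast

lemma DERIV_grad_line:
  assumes "f differentiable at (x + t *\<^sub>R v)"
  shows "((\<lambda>t. f (x + t *\<^sub>R v)) has_real_derivative (grad f (x + t *\<^sub>R v) \<bullet> v)) (at t within S)"
proof -
  have "((\<lambda>t. x + t *\<^sub>R v) has_derivative (\<lambda>t. t *\<^sub>R v)) (at t within S)"
    by (auto intro!: derivative_eq_intros)
  from has_derivative_compose[OF this has_derivative_grad[OF assms]]
  show ?thesis by (simp add: has_field_derivative_def o_def mult_commute_abs)
qed

text \<open>Linear functions realize every covector as the gradient of a smooth function; through
  them identities between the operators \<open>H\<close>, \<open>H1\<close>, \<open>H2\<close>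
  become identities between \<open>h\<close>, \<open>h1\<close>, \<open>h2\<close>.\<close>

lemma grad_inner_left: "grad (\<lambda>x. x \<bullet> \<xi>) z = \<xi>"
  by (rule grad_eqI) (auto simp: gderiv_def intro!: derivative_eq_intros)

lemma Ck_const: "Ck k (\<lambda>_. c)"
proof (induction k arbitrary: c)
  case (Suc k)
  have "grad (\<lambda>_::'a. c) x = 0" for x by (rule grad_eqI) (simp add: gderiv_def)
  with Suc show ?case by simp
qed simp

lemma smooth_inner_left: "smooth (\<lambda>x. x \<bullet> \<xi>)"
  unfolding smooth_def
proof
  fix k show "Ck k (\<lambda>x. x \<bullet> \<xi>)"
  proof (cases k)
    case (Suc m)
    have "(\<lambda>x. x \<bullet> \<xi>) differentiable at x" for x
      unfolding differentiable_def by (rule exI) (auto intro!: derivative_eq_intros)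
    then show ?thesis by (simp add: Suc grad_inner_left Ck_const)
  qed (auto intro!: continuous_intros)
qed

text \<open>\<open>Ck\<close> speaks only of the components of the gradient, so the gradient is
  reassembled in the orthonormal basis.\<close>

lemma Ck_continuous_grad:
  assumes "Ck (Suc 0) f" shows "continuous_on UNIV (grad f)"
proof -
  have "continuous_on UNIV (\<lambda>x. \<Sum>b\<in>Basis. (grad f x \<bullet> b) *\<^sub>R b)"
    using assms by (intro continuous_on_sum continuous_on_scaleR continuous_on_const) simp
  then show ?thesis unfolding euclidean_representation .
qed

lemma smooth_grad_inner: "smooth f \<Longrightarrow> smooth (\<lambda>x. grad f x \<bullet> v)"
  unfolding smooth_def by (metis Ck.simps(2))

lemma smooth_differentiable: "smooth f \<Longrightarrow> f differentiable at x"
  unfolding smooth_def by (metis Ck.simps(2))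

lemma smooth_continuous: "smooth f \<Longrightarrow> continuous_on UNIV f"
  unfolding smooth_def by (metis Ck.simps(1))

lemma GDERIV_fst_comp:
  fixes S :: "'a::euclidean_space \<Rightarrow> real"
  assumes "GDERIV S z :> g"
  shows "GDERIV (\<lambda>(z, a :: real). S z) (z, a) :> (g, 0)"
proof -
  have "(S has_derivative (\<lambda>h. g \<bullet> h)) (at (fst (z, a)))" using assms by (simp add: GDERIV_iff)
  from has_derivative_compose[OF has_derivative_fst[OF has_derivative_ident] this]
  have "((\<lambda>x. S (fst x)) has_derivative (\<lambda>x. g \<bullet> fst x)) (at (z, a))" .
  moreover have "(\<lambda>x::'a \<times> real. g \<bullet> fst x) = (\<bullet>) (g, 0)" by (auto simp: inner_prod_def)
  ultimately show ?thesis by (simp add: GDERIV_iff case_prod_unfold)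
qed

lemma GDERIV_snd: "GDERIV (\<lambda>(z :: 'a::euclidean_space, a :: real). a) y :> (0, 1)"
  unfolding GDERIV_iff case_prod_unfold by (auto intro!: derivative_eq_intros)

lemma grad_snd: "grad (\<lambda>(z :: 'a::euclidean_space, a :: real). a) y = (0, 1)"
  by (rule grad_eqI) (rule GDERIV_snd)

lemma Ck1_snd: "Ck 1 (\<lambda>(z :: 'a::euclidean_space, a :: real). a)"
  using GDERIV_snd by (auto simp: grad_snd differentiable_def gderiv_def)

lemma Ck1_fst_comp:
  fixes S :: "'a::euclidean_space \<Rightarrow> real"
  assumes "Ck 1 S" 
  shows "Ck 1 (\<lambda>(z, a :: real). S z)" "grad (\<lambda>(z, a :: real). S z) (z, a) = (grad S z, 0)"
proof -
  have "GDERIV S z :> grad S z" for z using assms by (auto intro: GDERIV_grad)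
  then have G: "GDERIV (\<lambda>(z, a :: real). S z) (z, a) :> (grad S z, 0)" for z a
    by (rule GDERIV_fst_comp)
  then show eq: "grad (\<lambda>(z, a :: real). S z) (z, a) = (grad S z, 0)" for z a by (rule grad_eqI)
  have "(\<lambda>(z, a :: real). S z) differentiable at y" for y
    using G[of "fst y" "snd y"] by (auto simp: differentiable_def gderiv_def)
  moreover have "continuous_on UNIV (\<lambda>y. grad (\<lambda>(z, a :: real). S z) y \<bullet> v)" for v
  proof -
    have "continuous_on UNIV (grad S)" using assms by (auto intro: Ck_continuous_grad)
    then have "continuous_on UNIV (\<lambda>y::'a \<times> real. (grad S (fst y), 0::real) \<bullet> v)"
      by (intro continuous_intros continuous_on_compose2[of UNIV "grad S" _ fst]) auto
    moreover have "grad (\<lambda>(z, a :: real). S z) y = (grad S (fst y), 0)" for y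
      by (metis eq prod.collapse)
    ultimately show ?thesis by simp
  qed
  ultimately show "Ck 1 (\<lambda>(z, a :: real). S z)" by simp
qed

section \<open>Symmetry of second derivatives\<close>

text \<open>The second difference of \<open>f\<close> equals \<open>t\<^sup>2\<close> times a mixed derivative at an intermediate point,
  whichever of the two directions is used first.\<close>

lemma second_difference:
  fixes f :: "'a::euclidean_space \<Rightarrow> real"
  assumes f: "smooth f" and t: "0 < t"
  obtains y where "norm (y - x) \<le> t * (norm u + norm v)"
    "f (x + t *\<^sub>R u + t *\<^sub>R v) - f (x + t *\<^sub>R u) - f (x + t *\<^sub>R v) + f x =
      t * (t * (grad (\<lambda>y. grad f y \<bullet> u) y \<bullet> v))"
proof -
  let ?\<phi> = "\<lambda>r. f ((x + t *\<^sub>R v) + r *\<^sub>R u) - f (x + r *\<^sub>R u)"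
  have "\<exists>r>0. r < t \<and> ?\<phi> t - ?\<phi> 0 =
      (t - 0) * (grad f ((x + t *\<^sub>R v) + r *\<^sub>R u) \<bullet> u - grad f (x + r *\<^sub>R u) \<bullet> u)"
    by (rule MVT2[OF t])
      (intro DERIV_diff DERIV_grad_line smooth_differentiable f)
  then obtain r where r: "0 < r" "r < t" "?\<phi> t - ?\<phi> 0 =
      t * (grad f ((x + t *\<^sub>R v) + r *\<^sub>R u) \<bullet> u - grad f (x + r *\<^sub>R u) \<bullet> u)"
    by auto
  let ?\<psi> = "\<lambda>s. (\<lambda>y. grad f y \<bullet> u) ((x + r *\<^sub>R u) + s *\<^sub>R v)"
  have "\<exists>s>0. s < t \<and> ?\<psi> t - ?\<psi> 0 =
      (t - 0) * (grad (\<lambda>y. grad f y \<bullet> u) ((x + r *\<^sub>R u) + s *\<^sub>R v) \<bullet> v)"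
    by (rule MVT2[OF t]) (intro DERIV_grad_line smooth_differentiable smooth_grad_inner f)
  then obtain s where s: "0 < s" "s < t" "?\<psi> t - ?\<psi> 0 =
      t * (grad (\<lambda>y. grad f y \<bullet> u) ((x + r *\<^sub>R u) + s *\<^sub>R v) \<bullet> v)"
    by auto
  have comm: "x + t *\<^sub>R v + r *\<^sub>R u = x + r *\<^sub>R u + t *\<^sub>R v" for r by (simp add: add_ac)
  show thesis
  proof (rule that)
    have "norm (r *\<^sub>R u + s *\<^sub>R v) \<le> r * norm u + s * norm v"
      using r s by (intro order_trans[OF norm_triangle_ineq]) simp
    also have "\<dots> \<le> t * norm u + t * norm v"
      using r s by (intro add_mono mult_right_mono) auto
    finally show "norm ((x + r *\<^sub>R u + s *\<^sub>R v) - x) \<le> t * (norm u + norm v)"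
      by (simp add: distrib_left add.assoc)
    show "f (x + t *\<^sub>R u + t *\<^sub>R v) - f (x + t *\<^sub>R u) - f (x + t *\<^sub>R v) + f x =
      t * (t * (grad (\<lambda>y. grad f y \<bullet> u) (x + r *\<^sub>R u + s *\<^sub>R v) \<bullet> v))"
      using r(3) s(3) unfolding comm by simp
  qed
qed

text \<open>Both orders of differentiation express the same second difference, at intermediate
  points within \<open>t n * c\<close> of \<open>x\<close>. Dividing by the square of
  \<open>t n\<close> and letting it tend to 0, continuity identifies the two mixed derivatives at
  \<open>x\<close>.\<close>

lemma mixed_second_derivatives:
  fixes f :: "'a::euclidean_space \<Rightarrow> real"
  assumes f: "smooth f"
  shows "grad (\<lambda>y. grad f y \<bullet> u) x \<bullet> v = grad (\<lambda>y. grad f y \<bullet> v) x \<bullet> u"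
proof -
  define G where "G u v y = grad (\<lambda>y. grad f y \<bullet> u) y \<bullet> v" for u v y
  have cont: "continuous_on UNIV (G u v)" for u v
    unfolding G_def by (intro smooth_continuous smooth_grad_inner f)
  define t where "t n = 1 / real (Suc n)" for n
  have t: "0 < t n" for n by (simp add: t_def)
  have t0: "t \<longlonglongrightarrow> 0" unfolding t_def by (rule LIMSEQ_Suc[OF lim_1_over_n])
  define c where "c = norm u + norm v"
  have "\<exists>y y'. norm (y - x) \<le> t n * c \<and> norm (y' - x) \<le> t n * c \<and> G u v y = G v u y'" for n
  proof -
    obtain y where y: "norm (y - x) \<le> t n * (norm u + norm v)"
      "f (x + t n *\<^sub>R u + t n *\<^sub>R v) - f (x + t n *\<^sub>R u) - f (x + t n *\<^sub>R v) + f x =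
        t n * (t n * (grad (\<lambda>y. grad f y \<bullet> u) y \<bullet> v))"
      by (rule second_difference[OF f t])
    obtain y' where y': "norm (y' - x) \<le> t n * (norm v + norm u)"
      "f (x + t n *\<^sub>R v + t n *\<^sub>R u) - f (x + t n *\<^sub>R v) - f (x + t n *\<^sub>R u) + f x =
        t n * (t n * (grad (\<lambda>y. grad f y \<bullet> v) y' \<bullet> u))"
      by (rule second_difference[OF f t])
    have "x + t n *\<^sub>R v + t n *\<^sub>R u = x + t n *\<^sub>R u + t n *\<^sub>R v" by (simp add: add_ac)
    with y(2) y'(2) have "t n * (t n * G u v y) = t n * (t n * G v u y')"
      unfolding G_def by (simp only:)
    with t[of n] have "G u v y = G v u y'" by simp
    with y(1) y'(1) show ?thesis unfolding c_def by (metis add.commute)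
  qed
  then obtain y y' where y: "\<And>n. norm (y n - x) \<le> t n * c" and
    y': "\<And>n. norm (y' n - x) \<le> t n * c" and eq: "\<And>n. G u v (y n) = G v u (y' n)" by metis
  have lim: "(\<lambda>n. G a b (p n)) \<longlonglongrightarrow> G a b x" if "\<And>n. norm (p n - x) \<le> t n * c" for p a b
  proof -
    have "(\<lambda>n. t n * c) \<longlonglongrightarrow> 0" using tendsto_mult_left_zero[OF t0] .
    then have "(\<lambda>n. p n - x) \<longlonglongrightarrow> 0"
      by (rule Lim_null_comparison[rotated]) (use that in auto)
    then have "p \<longlonglongrightarrow> x" by (simp add: LIM_zero_iff)
    then show ?thesis by (rule continuous_on_tendsto_compose[OF cont]) auto
  qed
  have "G u v x = G v u x"
    using lim[of y u v, OF y] lim[of y' v u, OF y'] unfolding eq by (rule LIMSEQ_unique)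
  then show ?thesis unfolding G_def .
qed

section \<open>The Poisson structure\<close>

lemma L_hat_apply: "L_hat W (z, a) (\<xi>, r) = (r *\<^sub>R W z, - (W z \<bullet> \<xi>))"
  by (simp add: L_hat_def)

text \<open>The Poisson bracket of the bivector field spanned by W and the energy axis: with X and D
  the derivatives along these two directions, it is X F D G - D F X G.\<close>

lemma bracket_L_hat:
  "bracket (L_hat W) F G y =
    (grad F y \<bullet> (W (fst y), 0)) * (grad G y \<bullet> (0, 1)) -
    (grad F y \<bullet> (0, 1)) * (grad G y \<bullet> (W (fst y), 0))"
  by (cases y; cases "grad F y"; cases "grad G y")
    (simp add: bracket_def L_hat_apply inner_commute mult.commute)

lemma linear_L_hat: "linear (L_hat W y)"
  by (cases y) (auto intro!: linearI simp: L_hat_apply inner_add_right algebra_simps)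

lemma L_hat_skew: "L_hat W y \<xi> \<bullet> \<eta> = - (L_hat W y \<eta> \<bullet> \<xi>)"
  by (cases y; cases \<xi>; cases \<eta>) (simp add: L_hat_apply inner_commute mult.commute)

text \<open>Write \<open>B\<^sub>i\<^sub>j\<close> for the bracket of \<open>F\<^sub>i\<close> and \<open>F\<^sub>j\<close>, \<open>X\<close> for the derivative along \<open>W\<close> and \<open>D\<close> for
  the derivative along the energy axis. The cyclic sums of \<open>B\<^sub>1\<^sub>2 D F\<^sub>3\<close> and of \<open>B\<^sub>1\<^sub>2 X F\<^sub>3\<close> are determinants
  with two equal rows. Differentiating the former along \<open>W\<close> and the latter along the energy axis
  reduces the identity to \<open>X D = D X\<close>. Only the brackets, not the functions \<open>X F\<^sub>i\<close>, are ever
  differentiated along \<open>W\<close>, which is why \<open>W\<close> need not be differentiable.\<close>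

lemma jacobi_identity_L_hat: "jacobi_identity (L_hat W)"
  unfolding jacobi_identity_def
proof (intro allI impI, elim conjE)
  fix F1 F2 F3 :: "'a \<times> real \<Rightarrow> real" and y
  assume sm: "smooth F1" "smooth F2" "smooth F3"
  define B where "B F G = bracket (L_hat W) F G" for F G
  assume "bracket (L_hat W) F1 F2 differentiable at y" "bracket (L_hat W) F3 F1 differentiable at y"
    "bracket (L_hat W) F2 F3 differentiable at y"
  then have diff: "B F1 F2 differentiable at y" "B F3 F1 differentiable at y"
    "B F2 F3 differentiable at y" by (simp_all add: B_def)
  \<comment> \<open>\<open>w\<close> is the value of W at the base point, frozen: a constant vector,
    so that \<open>X F\<close> is smooth although W is only continuous.\<close>
  define w e where "w = (W (fst y), 0 :: real)" and "e = (0 :: 'a, 1 :: real)"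
  define D where "D F x = grad F x \<bullet> e" for F x
  define X where "X F x = grad F x \<bullet> w" for F x
  have line: "((\<lambda>t. f (y + t *\<^sub>R v)) has_real_derivative grad f y \<bullet> v) (at 0)"
    if "f differentiable at y" for f :: "'a \<times> real \<Rightarrow> real" and v
    using DERIV_grad_line[of f y 0 v] that by simp
  have smD: "D F differentiable at y" if "smooth F" for F
    unfolding D_def[abs_def] by (intro smooth_differentiable smooth_grad_inner that)
  have smX: "X F differentiable at y" if "smooth F" for F
    unfolding X_def[abs_def] by (intro smooth_differentiable smooth_grad_inner that)
  have comm: "grad (D F) y \<bullet> w = grad (X F) y \<bullet> e" if "smooth F" for F
    unfolding D_def[abs_def] X_def[abs_def] by (rule mixed_second_derivatives[OF that])
  have zero: "c = 0" if "(f has_real_derivative c) (at 0)" "\<And>t. f t = 0" for f :: "real \<Rightarrow> real" and c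
  proof -
    have "f = (\<lambda>_. 0)" using that(2) by auto
    with that(1) show ?thesis using DERIV_unique[OF _ DERIV_const] by blast
  qed
  have 1: "grad (B F1 F2) y \<bullet> w * D F3 y + grad (D F3) y \<bullet> w * B F1 F2 y +
      (grad (B F3 F1) y \<bullet> w * D F2 y + grad (D F2) y \<bullet> w * B F3 F1 y) +
      (grad (B F2 F3) y \<bullet> w * D F1 y + grad (D F1) y \<bullet> w * B F2 F3 y) = 0"
  proof -
    have der: "((\<lambda>t. B F1 F2 (y + t *\<^sub>R w) * D F3 (y + t *\<^sub>R w) +
        B F3 F1 (y + t *\<^sub>R w) * D F2 (y + t *\<^sub>R w) +
        B F2 F3 (y + t *\<^sub>R w) * D F1 (y + t *\<^sub>R w)) has_real_derivative
      (grad (B F1 F2) y \<bullet> w * D F3 (y + 0 *\<^sub>R w) + grad (D F3) y \<bullet> w * B F1 F2 (y + 0 *\<^sub>R w)) +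
      (grad (B F3 F1) y \<bullet> w * D F2 (y + 0 *\<^sub>R w) + grad (D F2) y \<bullet> w * B F3 F1 (y + 0 *\<^sub>R w)) +
      (grad (B F2 F3) y \<bullet> w * D F1 (y + 0 *\<^sub>R w) + grad (D F1) y \<bullet> w * B F2 F3 (y + 0 *\<^sub>R w))) (at 0)"
      by (intro DERIV_add DERIV_mult line diff smD sm)
    have "B F1 F2 x * D F3 x + B F3 F1 x * D F2 x + B F2 F3 x * D F1 x = 0" for x
      unfolding B_def bracket_L_hat D_def e_def by (simp add: algebra_simps)
    from zero[OF der this] show ?thesis by simp
  qed
  have 2: "grad (B F1 F2) y \<bullet> e * X F3 y + grad (X F3) y \<bullet> e * B F1 F2 y +
      (grad (B F3 F1) y \<bullet> e * X F2 y + grad (X F2) y \<bullet> e * B F3 F1 y) +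
      (grad (B F2 F3) y \<bullet> e * X F1 y + grad (X F1) y \<bullet> e * B F2 F3 y) = 0"
  proof -
    have der: "((\<lambda>t. B F1 F2 (y + t *\<^sub>R e) * X F3 (y + t *\<^sub>R e) +
        B F3 F1 (y + t *\<^sub>R e) * X F2 (y + t *\<^sub>R e) +
        B F2 F3 (y + t *\<^sub>R e) * X F1 (y + t *\<^sub>R e)) has_real_derivative
      (grad (B F1 F2) y \<bullet> e * X F3 (y + 0 *\<^sub>R e) + grad (X F3) y \<bullet> e * B F1 F2 (y + 0 *\<^sub>R e)) +
      (grad (B F3 F1) y \<bullet> e * X F2 (y + 0 *\<^sub>R e) + grad (X F2) y \<bullet> e * B F3 F1 (y + 0 *\<^sub>R e)) +
      (grad (B F2 F3) y \<bullet> e * X F1 (y + 0 *\<^sub>R e) + grad (X F1) y \<bullet> e * B F2 F3 (y + 0 *\<^sub>R e))) (at 0)"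
      by (intro DERIV_add DERIV_mult line diff smX sm)
    have "B F1 F2 (y + t *\<^sub>R e) * X F3 (y + t *\<^sub>R e) +
        B F3 F1 (y + t *\<^sub>R e) * X F2 (y + t *\<^sub>R e) +
        B F2 F3 (y + t *\<^sub>R e) * X F1 (y + t *\<^sub>R e) = 0" for t
    proof -
      have fst_eq: "fst (y + t *\<^sub>R e) = fst y" by (simp add: e_def)
      show ?thesis
        unfolding B_def bracket_L_hat X_def w_def fst_eq by (simp add: algebra_simps)
    qed
    from zero[OF der this] show ?thesis by simp
  qed
  have "bracket (L_hat W) (B F G) K y = grad (B F G) y \<bullet> w * D K y - grad (B F G) y \<bullet> e * X K y"
    for F G K unfolding bracket_L_hat D_def X_def w_def e_def ..
  then show "bracket (L_hat W) (bracket (L_hat W) F1 F2) F3 y +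
      bracket (L_hat W) (bracket (L_hat W) F3 F1) F2 y +
      bracket (L_hat W) (bracket (L_hat W) F2 F3) F1 y = 0"
    using 1 2 unfolding comm[OF sm(1)] comm[OF sm(2)] comm[OF sm(3)] B_def[symmetric]
    by simp
qed

section \<open>The dissipation potentials\<close>

lemma Psi_hat_star_apply:
  "Psi_hat_star h S (z, a) (\<xi>, r) = ereal (h z (\<xi> + (1/2) *\<^sub>R grad S z) - h z ((1/2) *\<^sub>R grad S z))"
  by (simp add: Psi_hat_star_def)

text \<open>Translating the covector by half the gradient produces the affine term. The potential
  ignores \<open>r\<close>, so the supremum of \<open>s * r\<close> over \<open>r\<close> is
  infinite unless \<open>s = 0\<close>: tangent vectors that change the energy have infinite
  cost.\<close>

lemma legendre_Psi_hat_star: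
  assumes "\<And>v. l z v = legendre (\<lambda>\<xi>. ereal (h z \<xi>)) v"
  shows "legendre (Psi_hat_star h S (z, a)) (v, s) =
    (if s = 0 then l z v + ereal (h z ((1/2) *\<^sub>R grad S z) - v \<bullet> ((1/2) *\<^sub>R grad S z)) else \<infinity>)"
proof -
  define D where "D = (1/2) *\<^sub>R grad S z"
  have eq: "legendre (Psi_hat_star h S (z, a)) (v, s) =
      (SUP (\<xi>, r). ereal (v \<bullet> \<xi> + s * r - h z (\<xi> + D) + h z D))"
    unfolding legendre_def
    by (intro SUP_cong refl) (auto simp: Psi_hat_star_apply D_def split: prod.split)
  show ?thesis
  proof (cases "s = 0")
    case True
    have "legendre (Psi_hat_star h S (z, a)) (v, s) =
        (SUP \<xi>. (ereal (v \<bullet> \<xi>) - ereal (h z \<xi>)) + ereal (h z D - v \<bullet> D))"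
      unfolding eq
    proof (intro antisym SUP_least)
      fix p :: "'a \<times> real"
      show "(case p of (\<xi>, r) \<Rightarrow> ereal (v \<bullet> \<xi> + s * r - h z (\<xi> + D) + h z D))
        \<le> (SUP \<xi>. (ereal (v \<bullet> \<xi>) - ereal (h z \<xi>)) + ereal (h z D - v \<bullet> D))"
        using True by (cases p) (auto intro!: SUP_upper2[of "fst p + D"] simp: inner_add_right)
    next
      fix \<xi>
      show "(ereal (v \<bullet> \<xi>) - ereal (h z \<xi>)) + ereal (h z D - v \<bullet> D)
        \<le> (SUP (\<xi>, r). ereal (v \<bullet> \<xi> + s * r - h z (\<xi> + D) + h z D))"
        using True by (intro SUP_upper2[of "(\<xi> - D, 0)"]) (auto simp: inner_diff_right)
    qed
    also have "\<dots> = l z v + ereal (h z D - v \<bullet> D)"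
      unfolding assms legendre_def by (rule SUP_ereal_add_left) auto
    finally show ?thesis using True by (simp add: D_def)
  next
    case False
    have "\<infinity> = (SUP (\<xi>, r). ereal (v \<bullet> \<xi> + s * r - h z (\<xi> + D) + h z D))"
    proof (rule sym, rule SUP_PInfty)
      fix n
      have "s * (real n / s) + (h z D - h z D) = real n" using False by simp
      then show "\<exists>i\<in>UNIV. ereal (real n) \<le> (case i of (\<xi>, r) \<Rightarrow> ereal (v \<bullet> \<xi> + s * r - h z (\<xi> + D) + h z D))"
        by (intro bexI[of _ "(0, real n / s)"]) auto
    qed
    then show ?thesis using False eq by simp
  qed
qed

lemma convex_ereal_legendre: "convex_ereal (legendre (\<lambda>\<xi>. ereal (f \<xi>)))"
  unfolding convex_ereal_def
proof (intro allI impI)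
  fix u v :: 'a and t :: real assume t: "0 < t \<and> t < 1"
  show "legendre (\<lambda>\<xi>. ereal (f \<xi>)) ((1 - t) *\<^sub>R u + t *\<^sub>R v) \<le>
    ereal (1 - t) * legendre (\<lambda>\<xi>. ereal (f \<xi>)) u + ereal t * legendre (\<lambda>\<xi>. ereal (f \<xi>)) v"
  proof (subst legendre_def, rule SUP_least)
    fix \<xi>
    have "ereal (u \<bullet> \<xi> - f \<xi>) \<le> legendre (\<lambda>\<xi>. ereal (f \<xi>)) u" for u
      unfolding legendre_def by (rule SUP_upper2[of \<xi>]) auto
    then have "ereal (1 - t) * ereal (u \<bullet> \<xi> - f \<xi>) + ereal t * ereal (v \<bullet> \<xi> - f \<xi>) \<le>
      ereal (1 - t) * legendre (\<lambda>\<xi>. ereal (f \<xi>)) u + ereal t * legendre (\<lambda>\<xi>. ereal (f \<xi>)) v"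
      using t by (intro add_mono ereal_mult_left_mono) auto
    moreover have "ereal (((1 - t) *\<^sub>R u + t *\<^sub>R v) \<bullet> \<xi>) - ereal (f \<xi>) =
      ereal (1 - t) * ereal (u \<bullet> \<xi> - f \<xi>) + ereal t * ereal (v \<bullet> \<xi> - f \<xi>)"
      by (simp add: inner_add_left algebra_simps)
    ultimately show "ereal (((1 - t) *\<^sub>R u + t *\<^sub>R v) \<bullet> \<xi>) - ereal (f \<xi>) \<le>
      ereal (1 - t) * legendre (\<lambda>\<xi>. ereal (f \<xi>)) u + ereal t * legendre (\<lambda>\<xi>. ereal (f \<xi>)) v"
      by simp
  qed
qed

lemma legendre_even:
  fixes f :: "'a::euclidean_space \<Rightarrow> ereal"
  assumes "\<And>\<xi>. f (- \<xi>) = f \<xi>" shows "legendre f (- v) = legendre f v"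
proof -
  have "legendre f (- v) \<le> legendre f v" for v
    unfolding legendre_def[of f "- v"]
  proof (rule SUP_least)
    fix \<xi>
    have "ereal (v \<bullet> (- \<xi>)) - f (- \<xi>) \<le> legendre f v" unfolding legendre_def by (rule SUP_upper) simp
    then show "ereal (- v \<bullet> \<xi>) - f \<xi> \<le> legendre f v" by (simp add: assms)
  qed
  from this[of v] this[of "- v"] show ?thesis by simp
qed

lemma Psi_hat_star_eq:
  "Psi_hat_star h S y = (\<lambda>p. ereal (h (fst y) (fst p + (1/2) *\<^sub>R grad S (fst y)) -
    h (fst y) ((1/2) *\<^sub>R grad S (fst y))))"
  by (cases y) (auto simp: Psi_hat_star_def)

lemma convex_combination_translate:
  fixes u v c :: "'a::real_vector"
  shows "(1 - t) *\<^sub>R (u + c) + t *\<^sub>R (v + c) = ((1 - t) *\<^sub>R u + t *\<^sub>R v) + c"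
  by (simp add: algebra_simps)

text \<open>Symmetry of \<open>h\<close> about \<open>grad S / 2\<close> is the large deviation form of reversibility.\<close>

locale symmetric_hamiltonian =
  fixes h :: "'a::euclidean_space \<Rightarrow> 'a \<Rightarrow> real" and l :: "'a \<Rightarrow> 'a \<Rightarrow> ereal" and S :: "'a \<Rightarrow> real"
  assumes hl: "hamiltonian_lagrangian h l"
    and S_C1: "Ck 1 S"
    and sym: "\<And>z \<xi>. h z (grad S z - \<xi>) = h z \<xi>"
begin

abbreviation half :: "'a \<Rightarrow> 'a" where "half z \<equiv> (1/2) *\<^sub>R grad S z"

lemma convex_h: "convex_on UNIV (h z)" and h_0: "h z 0 = 0" and l_nonneg: "0 \<le> l z v"
  and l_eq: "l z v = legendre (\<lambda>\<xi>. ereal (h z \<xi>)) v"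
  and h_eq: "ereal (h z \<xi>) = legendre (l z) \<xi>"
  using hl unfolding hamiltonian_lagrangian_def by blast+

lemma sym_half: "h z (half z - \<xi>) = h z (half z + \<xi>)"
proof -
  have "grad S z = half z + half z" unfolding scaleR_add_left[symmetric] by simp
  then have "half z - \<xi> = grad S z - (half z + \<xi>)" by (simp add: algebra_simps)
  with sym show ?thesis by metis
qed

text \<open>By symmetry \<open>half z + \<xi>\<close> and \<open>half z - \<xi>\<close> carry the
  same value, and \<open>half z\<close> is their midpoint. Nonnegativity of
  \<open>Psi_hat_star\<close> is this inequality.\<close>

lemma half_minimal: "h z (half z) \<le> h z (half z + \<xi>)"
proof -
  have "h z ((1 - 1/2) *\<^sub>R (half z + \<xi>) + (1/2) *\<^sub>R (half z - \<xi>)) \<le>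
      (1 - 1/2) * h z (half z + \<xi>) + (1/2) * h z (half z - \<xi>)"
    by (rule convex_onD[OF convex_h]) auto
  moreover have "(1 - 1/2 :: real) *\<^sub>R (half z + \<xi>) + (1/2) *\<^sub>R (half z - \<xi>) = half z"
    by (simp add: algebra_simps flip: scaleR_add_left)
  ultimately show ?thesis using sym_half[of z \<xi>] by simp
qed

lemma legendre_eq:
  "legendre (Psi_hat_star h S (z, a)) (v, s) =
    (if s = 0 then l z v + ereal (h z (half z) - v \<bullet> half z) else \<infinity>)"
  by (rule legendre_Psi_hat_star) (rule l_eq)

text \<open>Inherited from the given duality of \<open>h\<close> and \<open>l\<close>: vectors with
  \<open>s \<noteq> 0\<close> contribute minus infinity to the outer supremum, and over
  \<open>s = 0\<close> it is the supremum defining \<open>h\<close>, up to a shift of the covector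
  and a constant.\<close>

lemma legendre_legendre:
  "legendre (legendre (Psi_hat_star h S (z, a))) (\<xi>, r) = Psi_hat_star h S (z, a) (\<xi>, r)"
proof -
  have shift: "ereal ((\<xi>, r) \<bullet> (v, 0)) - legendre (Psi_hat_star h S (z, a)) (v, 0) =
      (ereal ((\<xi> + half z) \<bullet> v) - l z v) + ereal (- h z (half z))" for v
    unfolding legendre_eq
    using l_nonneg[of z v] by (cases "l z v") (simp_all add: inner_commute inner_add_right)
  have "legendre (legendre (Psi_hat_star h S (z, a))) (\<xi>, r) =
      (SUP v. (ereal ((\<xi> + half z) \<bullet> v) - l z v) + ereal (- h z (half z)))"
    unfolding legendre_def[of "legendre (Psi_hat_star h S (z, a))"] shift[symmetric]
  proof (intro antisym SUP_least)
    fix p :: "'a \<times> real"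
    obtain v s where p: "p = (v, s)" by (cases p)
    show "ereal ((\<xi>, r) \<bullet> p) - legendre (Psi_hat_star h S (z, a)) p \<le>
      (SUP v. ereal ((\<xi>, r) \<bullet> (v, 0)) - legendre (Psi_hat_star h S (z, a)) (v, 0))"
    proof (cases "s = 0")
      case True
      then show ?thesis unfolding p by (intro SUP_upper2[of v]) auto
    next
      case False
      then show ?thesis by (simp add: p legendre_eq)
    qed
  qed (rule SUP_upper, simp)
  also have "\<dots> = (SUP v. ereal ((\<xi> + half z) \<bullet> v) - l z v) + ereal (- h z (half z))"
    by (rule SUP_ereal_add_left) auto
  also have "\<dots> = ereal (h z (\<xi> + half z)) + ereal (- h z (half z))"
    unfolding h_eq legendre_def ..
  finally show ?thesis by (simp add: Psi_hat_star_apply)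
qed

lemma symmetric_dissipation_potentials:
  "symmetric_dissipation_potentials (\<lambda>y. legendre (Psi_hat_star h S y)) (Psi_hat_star h S)"
  unfolding symmetric_dissipation_potentials_def
proof (intro allI conjI)
  fix y :: "'a \<times> real" and v \<xi> :: "'a \<times> real"
  show nn: "0 \<le> Psi_hat_star h S y \<xi>" for \<xi>
    using half_minimal by (simp add: Psi_hat_star_eq add.commute)
  show 0: "Psi_hat_star h S y 0 = 0" by (simp add: Psi_hat_star_eq)
  have "ereal (v \<bullet> 0) - Psi_hat_star h S y 0 \<le> legendre (Psi_hat_star h S y) v" for v
    unfolding legendre_def by (rule SUP_upper) simp
  then show l: "0 \<le> legendre (Psi_hat_star h S y) v" for v by (simp add: 0 flip: zero_ereal_def)
  have "legendre (Psi_hat_star h S y) 0 \<le> 0"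
    unfolding legendre_def
  proof (rule SUP_least)
    fix \<xi> show "ereal (0 \<bullet> \<xi>) - Psi_hat_star h S y \<xi> \<le> 0"
      using nn[of \<xi>] by (simp add: Psi_hat_star_eq)
  qed
  with l show "legendre (Psi_hat_star h S y) 0 = 0" by (simp add: antisym)
  show "Psi_hat_star h S y = legendre (legendre (Psi_hat_star h S y))"
  proof
    fix p show "Psi_hat_star h S y p = legendre (legendre (Psi_hat_star h S y)) p"
      by (cases y; cases p) (simp add: legendre_legendre)
  qed
  show "convex_ereal (legendre (Psi_hat_star h S y))"
    unfolding Psi_hat_star_eq by (rule convex_ereal_legendre)
  show even: "Psi_hat_star h S y (- \<xi>) = Psi_hat_star h S y \<xi>" for \<xi>
    using sym_half[of "fst y" "fst \<xi>"] by (simp add: Psi_hat_star_eq add.commute)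
  show "legendre (Psi_hat_star h S y) (- v) = legendre (Psi_hat_star h S y) v"
    by (rule legendre_even) (rule even)
  show "convex_ereal (Psi_hat_star h S y)"
    unfolding convex_ereal_def
  proof (intro allI impI)
    fix u v :: "'a \<times> real" and t :: real assume t: "0 < t \<and> t < 1"
    let ?D = "half (fst y)"
    have "h (fst y) ((1 - t) *\<^sub>R (fst u + ?D) + t *\<^sub>R (fst v + ?D)) \<le>
        (1 - t) * h (fst y) (fst u + ?D) + t * h (fst y) (fst v + ?D)"
      using t by (intro convex_onD[OF convex_h]) auto
    moreover have "(1 - t) *\<^sub>R (fst u + ?D) + t *\<^sub>R (fst v + ?D) =
        fst ((1 - t) *\<^sub>R u + t *\<^sub>R v) + ?D" by (simp add: convex_combination_translate)
    ultimately show "Psi_hat_star h S y ((1 - t) *\<^sub>R u + t *\<^sub>R v) \<le>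
        ereal (1 - t) * Psi_hat_star h S y u + ereal t * Psi_hat_star h S y v"
      by (simp add: Psi_hat_star_eq algebra_simps)
  qed
qed simp

text \<open>In the last condition the first potential contributes
  \<open>h z (half z) - (F z - W z) \<bullet> half z\<close>, the second
  \<open>- h z (half z)\<close>, the power term \<open>F z \<bullet> half z\<close>. What is left,
  \<open>W z \<bullet> half z\<close>, vanishes by \<open>orth\<close>, which is also the degeneracy
  of \<open>L_hat\<close> along the entropy.\<close>

lemma GENERIC_hat:
  assumes orth: "\<And>z. W z \<bullet> grad S z = 0" and zero: "\<And>z. l z (F z - W z) = 0"
  shows "GENERIC (\<lambda>(z, a). (F z, 0)) (\<lambda>(z, a). S z) (\<lambda>(z, a). a) (L_hat W)
    (\<lambda>y. legendre (Psi_hat_star h S y)) (Psi_hat_star h S)"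
  unfolding GENERIC_def
proof (intro allI conjI)
  fix y \<xi> \<eta> :: "'a \<times> real" and \<alpha>
  obtain z a where y: "y = (z, a)" by (cases y)
  show "Ck 1 (\<lambda>(z, a::real). S z)" "Ck 1 (\<lambda>(z :: 'a, a::real). a)"
    by (rule Ck1_fst_comp[OF S_C1], rule Ck1_snd)
  show "symmetric_dissipation_potentials (\<lambda>y. legendre (Psi_hat_star h S y)) (Psi_hat_star h S)"
    by (rule symmetric_dissipation_potentials)
  show "linear (L_hat W y)" "L_hat W y \<xi> \<bullet> \<eta> = - (L_hat W y \<eta> \<bullet> \<xi>)" "jacobi_identity (L_hat W)"
    by (rule linear_L_hat, rule L_hat_skew, rule jacobi_identity_L_hat)
  show "L_hat W y (grad (\<lambda>(z, a). S z) y) = 0"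
    by (simp add: y Ck1_fst_comp(2)[OF S_C1] L_hat_apply orth zero_prod_def)
  show "Psi_hat_star h S y (\<xi> + \<alpha> *\<^sub>R grad (\<lambda>(z, a). a) y) = Psi_hat_star h S y \<xi>"
    by (simp add: Psi_hat_star_eq grad_snd)
  have "(case y of (z, a) \<Rightarrow> (F z, 0 :: real)) - L_hat W y (grad (\<lambda>(z, a). a) y) = (F z - W z, 0)"
    by (simp add: y grad_snd L_hat_apply)
  moreover have "(- (1/2)) *\<^sub>R grad (\<lambda>(z, a). S z) y = (- half z, 0)"
    by (simp add: y Ck1_fst_comp(2)[OF S_C1])
  moreover have "(case y of (z, a) \<Rightarrow> (F z, 0 :: real)) \<bullet> grad (\<lambda>(z, a). S z) y = F z \<bullet> grad S z"
    by (simp add: y Ck1_fst_comp(2)[OF S_C1])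
  ultimately show "legendre (Psi_hat_star h S y)
        ((case y of (z, a) \<Rightarrow> (F z, 0)) - L_hat W y (grad (\<lambda>(z, a). a) y)) +
      Psi_hat_star h S y (- (1/2) *\<^sub>R grad (\<lambda>(z, a). S z) y) +
      ereal (1/2 * ((case y of (z, a) \<Rightarrow> (F z, 0)) \<bullet> grad (\<lambda>(z, a). S z) y)) = 0"
    by (simp add: y legendre_eq zero Psi_hat_star_apply h_0 inner_diff_left orth
      del: case_prod_conv)
qed

text \<open>The potentials arise from \<open>h z\<close> and \<open>l z\<close> by a translation and
  affine terms in the first component; the second component is ignored by the dual potential and
  forced to be 0 by the primal one. Hence strict convexity modulo the energy covector for the
  former, and differentiability along the energy-preserving hyperplane for the latter.\<close>

lemma regular_potentials_hat:
  assumes "regular_potentials (\<lambda>_. 0) l (\<lambda>z \<xi>. ereal (h z \<xi>))"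
  shows "regular_potentials (grad (\<lambda>(z, a). a)) (\<lambda>y. legendre (Psi_hat_star h S y))
    (Psi_hat_star h S)"
  unfolding regular_potentials_def
proof (intro allI conjI)
  fix y :: "'a \<times> real"
  obtain z a where y: "y = (z, a)" by (cases y)
  have sc: "strictly_convex_mod {0} (\<lambda>\<xi>. ereal (h z \<xi>))" and C1: "C1_along UNIV (\<lambda>\<xi>. ereal (h z \<xi>))"
    and sc': "strictly_convex_mod {0} (l z)" and C1': "C1_along UNIV (l z)"
    using assms unfolding regular_potentials_def by auto
  show "strictly_convex_mod (span {grad (\<lambda>(z, a). a) y}) (Psi_hat_star h S y)"
    unfolding strictly_convex_mod_def grad_snd
  proof (intro allI impI, elim conjE)
    fix u v :: "'a \<times> real" and t :: real
    assume t: "0 < t" "t < 1" and uv: "u - v \<notin> span {(0, 1)}"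
    have "fst u - fst v \<notin> {0}"
    proof
      assume "fst u - fst v \<in> {0}"
      then have "u - v = (snd u - snd v) *\<^sub>R (0, 1)" by (simp add: prod_eq_iff)
      with uv show False by (metis span_base span_scale singletonI)
    qed
    then have "(fst u + half z) - (fst v + half z) \<notin> {0}" by simp
    with sc t have "ereal (h z ((1 - t) *\<^sub>R (fst u + half z) + t *\<^sub>R (fst v + half z))) <
        ereal (1 - t) * ereal (h z (fst u + half z)) + ereal t * ereal (h z (fst v + half z))"
      unfolding strictly_convex_mod_def by (metis MInfty_neq_ereal(1) ereal_less(2) less_ereal.simps(4))
    moreover have "(1 - t) *\<^sub>R (fst u + half z) + t *\<^sub>R (fst v + half z) =
        fst ((1 - t) *\<^sub>R u + t *\<^sub>R v) + half z" by (simp add: convex_combination_translate)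
    ultimately show "Psi_hat_star h S y ((1 - t) *\<^sub>R u + t *\<^sub>R v) <
        ereal (1 - t) * Psi_hat_star h S y u + ereal t * Psi_hat_star h S y v"
      by (simp add: y Psi_hat_star_eq algebra_simps)
  qed
  show "C1_along UNIV (Psi_hat_star h S y)"
  proof -
    from C1 obtain g where g: "continuous_on UNIV g"
      "\<And>v. (h z has_derivative (\<lambda>h. g v \<bullet> h)) (at v)"
      unfolding C1_along_def by (auto simp: Let_def gt_ex)
    have U: "{v \<in> UNIV. \<exists>e>0. \<forall>w\<in>UNIV. dist w v < e \<longrightarrow> Psi_hat_star h S y w < \<infinity>} = UNIV"
      by (auto simp: Psi_hat_star_eq gt_ex)
    have "continuous_on UNIV (\<lambda>p::'a \<times> real. (g (fst p + half z), 0 :: real))"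
      by (intro continuous_intros continuous_on_compose2[OF g(1)]) auto
    moreover have "((\<lambda>w. real_of_ereal (Psi_hat_star h S y w)) has_derivative
        (\<lambda>h. (g (fst p + half z), 0) \<bullet> h)) (at p within UNIV)" for p :: "'a \<times> real"
    proof -
      have "((\<lambda>w::'a \<times> real. fst w + half z) has_derivative fst) (at p)"
        by (auto intro!: derivative_eq_intros)
      from has_derivative_compose[OF this g(2)]
      have "((\<lambda>w. h z (fst w + half z)) has_derivative (\<lambda>w. g (fst p + half z) \<bullet> fst w)) (at p)" .
      then have "((\<lambda>w. h z (fst w + half z) - h z (half z)) has_derivative
          (\<lambda>w. g (fst p + half z) \<bullet> fst w - 0)) (at p)"
        by (intro has_derivative_diff has_derivative_const)
      then show ?thesis by (simp add: y Psi_hat_star_eq inner_prod_def)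
    qed
    ultimately show ?thesis unfolding C1_along_def Let_def U by blast
  qed
  have fin: "legendre (Psi_hat_star h S y) (v, s) < \<infinity> \<longleftrightarrow> s = 0 \<and> l z v < \<infinity>" for v s
    by (cases "l z v") (auto simp: y legendre_eq)
  show "strictly_convex_mod {0} (legendre (Psi_hat_star h S y))"
    unfolding strictly_convex_mod_def
  proof (intro allI impI, elim conjE)
    fix p q :: "'a \<times> real" and t :: real
    assume t: "0 < t" "t < 1" and f: "legendre (Psi_hat_star h S y) p < \<infinity>"
      "legendre (Psi_hat_star h S y) q < \<infinity>" and pq: "p - q \<notin> {0}"
    obtain u v where uv: "p = (u, 0)" "q = (v, 0)" "l z u < \<infinity>" "l z v < \<infinity>"
      using f fin by (metis surj_pair)
    with pq have "u - v \<notin> {0}" by (auto simp: zero_prod_def)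
    with sc' t uv have less: "l z ((1 - t) *\<^sub>R u + t *\<^sub>R v) < ereal (1 - t) * l z u + ereal t * l z v"
      unfolding strictly_convex_mod_def by blast
    obtain lu lv where luv: "l z u = ereal lu" "l z v = ereal lv"
      using uv l_nonneg[of z u] l_nonneg[of z v] by (cases "l z u"; cases "l z v") auto
    from less obtain lw where lw: "l z ((1 - t) *\<^sub>R u + t *\<^sub>R v) = ereal lw"
      using l_nonneg[of z "(1 - t) *\<^sub>R u + t *\<^sub>R v"] luv
      by (cases "l z ((1 - t) *\<^sub>R u + t *\<^sub>R v)") auto
    show "legendre (Psi_hat_star h S y) ((1 - t) *\<^sub>R p + t *\<^sub>R q) <
        ereal (1 - t) * legendre (Psi_hat_star h S y) p + ereal t * legendre (Psi_hat_star h S y) q"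
    proof -
      define d c where "d = half z" and "c w = h z d - w \<bullet> d" for w
      have c: "c ((1 - t) *\<^sub>R u + t *\<^sub>R v) = (1 - t) * c u + t * c v"
        by (simp add: c_def inner_add_left left_diff_distrib right_diff_distrib)
      have pq_eq: "(1 - t) *\<^sub>R p + t *\<^sub>R q = ((1 - t) *\<^sub>R u + t *\<^sub>R v, 0)" by (simp add: uv)
      have "lw < (1 - t) * lu + t * lv" using less by (simp add: luv lw)
      then show ?thesis
        unfolding pq_eq y legendre_eq d_def[symmetric] c_def[symmetric] c lw
        unfolding uv legendre_eq d_def[symmetric] c_def[symmetric] luv
        by (simp add: distrib_left)
    qed
  qed
  show "C1_along {v. v \<bullet> grad (\<lambda>(z, a). a) y = 0} (legendre (Psi_hat_star h S y))"
  proof -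
    define V where "V = {v :: 'a \<times> real. v \<bullet> (0, 1) = 0}"
    define U where "U = {v \<in> UNIV. \<exists>e>0. \<forall>w\<in>UNIV. dist w v < e \<longrightarrow> l z w < \<infinity>}"
    define U' where "U' = {v \<in> V. \<exists>e>0. \<forall>w\<in>V. dist w v < e \<longrightarrow> legendre (Psi_hat_star h S y) w < \<infinity>}"
    have V: "p \<in> V \<longleftrightarrow> snd p = 0" for p by (cases p) (simp add: V_def)
    have UU': "fst p \<in> U" if "p \<in> U'" for p
    proof -
      have "snd p = 0" using that by (simp add: U'_def V)
      then obtain v where p: "p = (v, 0)" by (metis prod.collapse)
      with that obtain e where e: "e > 0" "\<forall>w\<in>V. dist w p < e \<longrightarrow> legendre (Psi_hat_star h S y) w < \<infinity>"
        unfolding U'_def by blast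
      have "l z w < \<infinity>" if "dist w v < e" for w
        using e(2) fin[of w 0] that by (auto simp: V p dist_Pair_Pair)
      with e(1) show ?thesis unfolding U_def p by auto
    qed
    from C1' obtain g where g: "continuous_on U g"
      "\<And>v. v \<in> U \<Longrightarrow> ((\<lambda>w. real_of_ereal (l z w)) has_derivative (\<lambda>h. g v \<bullet> h)) (at v)"
      unfolding C1_along_def Let_def U_def[symmetric] by auto
    have "continuous_on U' (\<lambda>p. (g (fst p) - half z, 0 :: real))"
      using UU' by (intro continuous_intros continuous_on_compose2[OF g(1)]) auto
    moreover have "((\<lambda>w. real_of_ereal (legendre (Psi_hat_star h S y) w)) has_derivative
        (\<lambda>h. (g (fst p) - half z, 0) \<bullet> h)) (at p within V)" if p: "p \<in> U'" for p
    proof -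
      from UU'[OF p] have "((\<lambda>w. real_of_ereal (l z w)) has_derivative (\<lambda>h. g (fst p) \<bullet> h)) (at (fst p))"
        by (rule g(2))
      from has_derivative_compose[OF has_derivative_fst[OF has_derivative_ident] this]
      have "((\<lambda>w. real_of_ereal (l z (fst w))) has_derivative (\<lambda>w. g (fst p) \<bullet> fst w)) (at p within V)" .
      moreover have "((\<lambda>w. h z (half z) - fst w \<bullet> half z) has_derivative (\<lambda>w. 0 - fst w \<bullet> half z)) (at p within V)"
        by (auto intro!: derivative_eq_intros)
      ultimately have d: "((\<lambda>w. real_of_ereal (l z (fst w)) + (h z (half z) - fst w \<bullet> half z)) has_derivative
          (\<lambda>w. g (fst p) \<bullet> fst w + (0 - fst w \<bullet> half z))) (at p within V)"
        by (rule has_derivative_add)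
      from p obtain e where e: "e > 0" "\<forall>w\<in>V. dist w p < e \<longrightarrow> legendre (Psi_hat_star h S y) w < \<infinity>"
        and pV: "p \<in> V" unfolding U'_def by blast
      \<comment> \<open>\<open>real_of_ereal\<close> sends infinity to 0, so the affine part can be
        split off only where \<open>l z\<close> is finite, as it is near \<open>p\<close> within
        \<open>V\<close>.\<close>
      have "real_of_ereal (l z (fst w)) + (h z (half z) - fst w \<bullet> half z) =
          real_of_ereal (legendre (Psi_hat_star h S y) w)" if "w \<in> V" "dist w p < e" for w
      proof -
        obtain v where w: "w = (v, 0)" using \<open>w \<in> V\<close> V by (metis prod.collapse)
        with e that fin[of v 0] have "l z v < \<infinity>" by auto
        with l_nonneg[of z v] show ?thesis by (cases "l z v") (auto simp: w y legendre_eq)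
      qed
      from has_derivative_transform_within[OF d e(1) pV this]
      show ?thesis by (simp add: inner_prod_def inner_diff_left inner_commute[of _ "grad S z"])
    qed
    ultimately show ?thesis
      unfolding C1_along_def Let_def grad_snd V_def[symmetric] U'_def[symmetric] by blast
  qed
qed

end

section \<open>Skorokhod neighbourhoods and large deviations\<close>

lemma time_changes_id: "(\<lambda>t. t) \<in> time_changes"
  by (auto simp: time_changes_def strict_mono_on_def)

lemma time_changes_nonneg: "\<tau> \<in> time_changes \<Longrightarrow> 0 \<le> t \<Longrightarrow> 0 \<le> \<tau> t"
  unfolding time_changes_def by (metis (mono_tags, lifting) atLeast_iff image_eqI mem_Collect_eq)

lemma time_changes_comp:
  assumes "\<tau> \<in> time_changes" "\<sigma> \<in> time_changes" shows "(\<lambda>t. \<tau> (\<sigma> t)) \<in> time_changes"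
proof -
  have "(\<lambda>t. \<tau> (\<sigma> t)) ` {0..} = \<tau> ` \<sigma> ` {0..}" by (simp add: image_image)
  then have "(\<lambda>t. \<tau> (\<sigma> t)) ` {0..} = {0..}" using assms by (simp add: time_changes_def)
  moreover have "strict_mono_on {0..} (\<lambda>t. \<tau> (\<sigma> t))"
    using assms time_changes_nonneg[OF assms(2)]
    unfolding time_changes_def strict_mono_on_def by simp
  ultimately show ?thesis by (simp add: time_changes_def)
qed

lemma skorokhod_nbhd_self: "y \<in> cadlag \<Longrightarrow> 0 < e \<Longrightarrow> y \<in> skorokhod_nbhd y T e"
  unfolding skorokhod_nbhd_def using time_changes_id by force

lemma skorokhod_nbhdE:
  assumes "y \<in> skorokhod_nbhd x T e"
  obtains \<tau> where "y \<in> cadlag" "\<tau> \<in> time_changes"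
    "\<forall>t\<in>{0..T}. \<bar>\<tau> t - t\<bar> < e \<and> dist (y t) (x (\<tau> t)) < e"
  using assms unfolding skorokhod_nbhd_def by auto

text \<open>Time changes compose. The horizon is enlarged because \<open>\<sigma> t\<close> may lie
  beyond \<open>T\<close>, by less than \<open>e / 2\<close>.\<close>

lemma skorokhod_nbhd_triangle:
  assumes z: "z \<in> skorokhod_nbhd y (T + e) (e / 2)" and w: "w \<in> skorokhod_nbhd z T (e / 2)"
  shows "w \<in> skorokhod_nbhd y T e"
proof -
  obtain \<tau> where \<tau>: "z \<in> cadlag" "\<tau> \<in> time_changes"
    "\<forall>t\<in>{0..T + e}. \<bar>\<tau> t - t\<bar> < e / 2 \<and> dist (z t) (y (\<tau> t)) < e / 2"
    using z by (rule skorokhod_nbhdE)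
  obtain \<sigma> where \<sigma>: "w \<in> cadlag" "\<sigma> \<in> time_changes"
    "\<forall>t\<in>{0..T}. \<bar>\<sigma> t - t\<bar> < e / 2 \<and> dist (w t) (z (\<sigma> t)) < e / 2"
    using w by (rule skorokhod_nbhdE)
  have "\<bar>\<tau> (\<sigma> t) - t\<bar> < e \<and> dist (w t) (y (\<tau> (\<sigma> t))) < e" if t: "0 \<le> t" "t \<le> T" for t
  proof -
    have 1: "\<bar>\<sigma> t - t\<bar> < e / 2" "dist (w t) (z (\<sigma> t)) < e / 2" using bspec[OF \<sigma>(3), of t] t by auto
    have "0 \<le> \<sigma> t" using time_changes_nonneg[OF \<sigma>(2) t(1)] .
    moreover have "\<sigma> t \<le> T + e" using 1 t unfolding abs_if by (auto split: if_splits)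
    ultimately have 2: "\<bar>\<tau> (\<sigma> t) - \<sigma> t\<bar> < e / 2" "dist (z (\<sigma> t)) (y (\<tau> (\<sigma> t))) < e / 2"
      using bspec[OF \<tau>(3), of "\<sigma> t"] by auto
    have "\<bar>\<tau> (\<sigma> t) - t\<bar> < e" using 1(1) 2(1) by linarith
    moreover have "dist (w t) (y (\<tau> (\<sigma> t))) < e"
      using dist_triangle[of "w t" "y (\<tau> (\<sigma> t))" "z (\<sigma> t)"] 1(2) 2(2) by linarith
    ultimately show ?thesis ..
  qed
  then show ?thesis
    unfolding skorokhod_nbhd_def using \<sigma>(1) time_changes_comp[OF \<tau>(2) \<sigma>(2)]
    by (intro CollectI conjI bexI[of _ "\<lambda>t. \<tau> (\<sigma> t)"]) auto
qed

text \<open>The neighbourhoods \<open>skorokhod_nbhd\<close> come without a proof of openness. This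
  interior is open, by halving the radius in the triangle inequality, so the large deviation bounds
  apply to it.\<close>

definition skorokhod_interior :: "(real \<Rightarrow> 'a::metric_space) set \<Rightarrow> (real \<Rightarrow> 'a) set" where
  "skorokhod_interior N = {y \<in> cadlag. \<exists>T e. 0 < e \<and> skorokhod_nbhd y T e \<subseteq> N}"

lemma skorokhod_interior_subset: "skorokhod_interior N \<subseteq> N"
  unfolding skorokhod_interior_def using skorokhod_nbhd_self by blast

lemma openin_skorokhod_interior: "openin skorokhod (skorokhod_interior N)"
  unfolding openin_skorokhod skorokhod_open_def
proof (intro conjI ballI)
  show "skorokhod_interior N \<subseteq> cadlag" by (auto simp: skorokhod_interior_def)
  fix y assume "y \<in> skorokhod_interior N"
  then obtain T e where Te: "0 < e" "skorokhod_nbhd y T e \<subseteq> N"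
    unfolding skorokhod_interior_def by blast
  have "skorokhod_nbhd y (T + e) (e / 2) \<subseteq> skorokhod_interior N"
  proof
    fix z assume z: "z \<in> skorokhod_nbhd y (T + e) (e / 2)"
    then have "skorokhod_nbhd z T (e / 2) \<subseteq> N" using skorokhod_nbhd_triangle Te(2) by blast
    moreover have "z \<in> cadlag" using z by (simp add: skorokhod_nbhd_def)
    ultimately show "z \<in> skorokhod_interior N"
      unfolding skorokhod_interior_def using Te(1) half_gt_zero by blast
  qed
  then show "\<exists>T e. 0 < e \<and> skorokhod_nbhd y T e \<subseteq> skorokhod_interior N"
    using Te(1) half_gt_zero by blast
qed

section \<open>From large deviation bounds to individual paths\<close>

lemma log_prob_mono:
  assumes "finite_measure M" "A \<subseteq> B" "B \<in> sets M"
  shows "log_prob M A \<le> log_prob M B"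
proof -
  have "measure M A \<le> measure M B" by (rule finite_measure.finite_measure_mono[OF assms])
  moreover have "0 < measure M A" if "measure M A \<noteq> 0"
    using that measure_nonneg[of M A] by linarith
  ultimately show ?thesis unfolding log_prob_def by (cases "measure M A = 0") auto
qed

lemma sets_skorokhod_borel_open: "openin skorokhod U \<Longrightarrow> U \<in> sets skorokhod_borel"
  unfolding skorokhod_borel_def
  using openin_subset[of skorokhod, unfolded topspace_skorokhod]
  by (subst sets_measure_of) auto

lemma space_skorokhod_borel: "space skorokhod_borel = cadlag"
  by (simp add: skorokhod_borel_def space_measure_of_conv)

locale skorokhod_LDP =
  fixes Q :: "nat \<Rightarrow> (real \<Rightarrow> 'a::metric_space) measure" and I :: "(real \<Rightarrow> 'a) \<Rightarrow> ereal"
  assumes LDP: "LDP skorokhod Q I"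
    and prob: "\<And>n. prob_space (Q n)"
    and sets_Q: "\<And>n. sets (Q n) = sets skorokhod_borel"
begin

definition rate :: "(real \<Rightarrow> 'a) set \<Rightarrow> nat \<Rightarrow> ereal" where
  "rate N n = ereal (1 / real n) * log_prob (Q n) N"

lemma rate_mono: "M \<subseteq> N \<Longrightarrow> (\<And>n. N \<in> sets (Q n)) \<Longrightarrow> rate M n \<le> rate N n"
  unfolding rate_def
  by (intro ereal_mult_left_mono log_prob_mono prob_space.finite_measure prob) auto

text \<open>The interior of \<open>N\<close> is an open set containing \<gamma>, and the infimum of
  the rate over it is at most \<open>I \<gamma>\<close>.\<close>

lemma lower_bound:
  assumes "\<gamma> \<in> cadlag" "0 < e" "skorokhod_nbhd \<gamma> T e \<subseteq> N" "\<And>n. N \<in> sets (Q n)"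
  shows "- I \<gamma> \<le> liminf (rate N)"
proof -
  let ?G = "skorokhod_interior N"
  have "\<gamma> \<in> ?G" using assms unfolding skorokhod_interior_def by blast
  then have "- I \<gamma> \<le> - (INF x\<in>?G. I x)" by (simp add: INF_lower)
  also have "\<dots> \<le> liminf (rate ?G)"
    unfolding rate_def[abs_def] using LDP openin_skorokhod_interior unfolding LDP_def by blast
  also have "\<dots> \<le> liminf (rate N)"
    by (intro Liminf_mono always_eventually allI rate_mono skorokhod_interior_subset assms)
  finally show ?thesis .
qed

text \<open>The closed set \<open>?C\<close> is the closure of \<open>N\<close>. Sublevel sets of
  \<open>I\<close> need not be compact, so the infimum over \<open>?C\<close> need not be attained;
  hence the slack between \<open>c\<close> and \<open>c'\<close>, and a \<gamma> that is only almost
  optimal.\<close>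

lemma upper_bound:
  assumes "N \<subseteq> cadlag" "- c \<le> limsup (rate N)" "c < c'"
  obtains \<gamma> where "\<gamma> \<in> cadlag" "I \<gamma> < c'"
    "\<And>T e. 0 < e \<Longrightarrow> \<exists>y\<in>N. y \<in> skorokhod_nbhd \<gamma> T e"
proof -
  let ?C = "cadlag - skorokhod_interior (cadlag - N)"
  have "closedin skorokhod ?C"
    using closedin_diff[OF closedin_topspace openin_skorokhod_interior]
    by (simp add: topspace_skorokhod)
  have "?C \<in> sets (Q n)" for n
    unfolding sets_Q space_skorokhod_borel[symmetric]
    by (intro sets.compl_sets sets_skorokhod_borel_open openin_skorokhod_interior)
  then have "limsup (rate N) \<le> limsup (rate ?C)"
    using skorokhod_interior_subset[of "cadlag - N"] assms(1)
    by (intro Limsup_mono always_eventually allI rate_mono) auto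
  also have "\<dots> \<le> - (INF x\<in>?C. I x)"
    unfolding rate_def[abs_def] using LDP \<open>closedin skorokhod ?C\<close> unfolding LDP_def by blast
  finally have "- c \<le> - (INF x\<in>?C. I x)" using assms(2) by (rule order_trans[rotated])
  then have "(INF x\<in>?C. I x) < c'" using assms(3) by (simp add: order_le_less_trans)
  then obtain \<gamma> where \<gamma>: "\<gamma> \<in> ?C" "I \<gamma> < c'" unfolding INF_less_iff by blast
  have "\<exists>y\<in>N. y \<in> skorokhod_nbhd \<gamma> T e" if "0 < e" for T e
  proof (rule ccontr)
    assume "\<not> ?thesis"
    then have "skorokhod_nbhd \<gamma> T e \<subseteq> cadlag - N" unfolding skorokhod_nbhd_def by blast
    with \<gamma>(1) that show False unfolding skorokhod_interior_def by blast
  qed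
  with \<gamma> show thesis by (intro that) auto
qed

end

section \<open>Evaluation at two times\<close>

text \<open>Evaluation at a fixed time is not continuous on Skorokhod space, but it is so at
  continuous paths, where a small time change moves \<open>\<gamma> (\<tau> t)\<close> little. Paths
  of finite rate are continuous, so this suffices.\<close>

lemma skorokhod_nbhd_subset_two_times:
  assumes cont: "continuous_on {0..} \<gamma>" and t: "0 \<le> t" and r: "0 < r"
  obtains T e where "0 < e"
    "skorokhod_nbhd \<gamma> T e \<subseteq> {y \<in> cadlag. y 0 \<in> ball (\<gamma> 0) r \<and> y t \<in> ball (\<gamma> t) r}"
proof -
  have "\<exists>d>0. \<forall>s\<ge>0. \<bar>s - u\<bar> < d \<longrightarrow> dist (\<gamma> s) (\<gamma> u) < r / 2" if "0 \<le> u" for u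
    using cont[unfolded continuous_on_iff, rule_format, of u "r / 2"] r that
    by (auto simp: dist_real_def)
  from this[of 0] this[OF t] obtain d d' where d: "0 < d" "\<And>s. 0 \<le> s \<Longrightarrow> \<bar>s - 0\<bar> < d \<Longrightarrow> dist (\<gamma> s) (\<gamma> 0) < r / 2"
    and d': "0 < d'" "\<And>s. 0 \<le> s \<Longrightarrow> \<bar>s - t\<bar> < d' \<Longrightarrow> dist (\<gamma> s) (\<gamma> t) < r / 2"
    by auto
  define e where "e = min (r / 2) (min d d')"
  have e: "0 < e" "e \<le> r / 2" "e \<le> d" "e \<le> d'" using d d' r by (auto simp: e_def)
  have "skorokhod_nbhd \<gamma> t e \<subseteq> {y \<in> cadlag. y 0 \<in> ball (\<gamma> 0) r \<and> y t \<in> ball (\<gamma> t) r}"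
  proof
    fix y assume "y \<in> skorokhod_nbhd \<gamma> t e"
    then obtain \<tau> where \<tau>: "y \<in> cadlag" "\<tau> \<in> time_changes"
      "\<forall>s\<in>{0..t}. \<bar>\<tau> s - s\<bar> < e \<and> dist (y s) (\<gamma> (\<tau> s)) < e"
      by (rule skorokhod_nbhdE)
    have "dist (\<gamma> (\<tau> 0)) (\<gamma> 0) < r / 2"
      using bspec[OF \<tau>(3), of 0] t e time_changes_nonneg[OF \<tau>(2), of 0] by (intro d(2)) auto
    then have "dist (y 0) (\<gamma> 0) < r"
      using bspec[OF \<tau>(3), of 0] t e dist_triangle[of "y 0" "\<gamma> 0" "\<gamma> (\<tau> 0)"] by simp
    moreover have "dist (\<gamma> (\<tau> t)) (\<gamma> t) < r / 2"
      using bspec[OF \<tau>(3), of t] t e time_changes_nonneg[OF \<tau>(2) t] by (intro d'(2)) auto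
    then have "dist (y t) (\<gamma> t) < r"
      using bspec[OF \<tau>(3), of t] t e dist_triangle[of "y t" "\<gamma> t" "\<gamma> (\<tau> t)"] by simp
    ultimately show "y \<in> {y \<in> cadlag. y 0 \<in> ball (\<gamma> 0) r \<and> y t \<in> ball (\<gamma> t) r}"
      using \<tau>(1) by (simp add: dist_commute)
  qed
  with e(1) show thesis by (rule that)
qed

lemma skorokhod_limit_two_times:
  assumes cont: "continuous_on {0..} \<gamma>" and t: "0 \<le> t" and "closed C" "closed D"
    and meets: "\<And>T e. 0 < e \<Longrightarrow> \<exists>y\<in>{y \<in> cadlag. y 0 \<in> C \<and> y t \<in> D}. y \<in> skorokhod_nbhd \<gamma> T e"
  shows "\<gamma> 0 \<in> C" "\<gamma> t \<in> D"
proof -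
  have "\<exists>x\<in>C. \<exists>y\<in>D. dist x (\<gamma> 0) < r \<and> dist y (\<gamma> t) < r" if "0 < r" for r
  proof -
    obtain T e where "0 < e"
      "skorokhod_nbhd \<gamma> T e \<subseteq> {y \<in> cadlag. y 0 \<in> ball (\<gamma> 0) r \<and> y t \<in> ball (\<gamma> t) r}"
      using skorokhod_nbhd_subset_two_times[OF cont t \<open>0 < r\<close>] .
    with meets[of e T] show ?thesis by (auto simp: dist_commute)
  qed
  then have "\<gamma> 0 \<in> closure C" "\<gamma> t \<in> closure D"
    unfolding closure_approachable by blast+
  with assms show "\<gamma> 0 \<in> C" "\<gamma> t \<in> D" by (simp_all add: closure_closed)
qed

section \<open>Absolutely continuous paths and their cost\<close>

lemma has_densityD:
  assumes "has_density \<gamma> g" "0 \<le> t"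
  shows "g integrable_on {0..t}" "\<gamma> t = \<gamma> 0 + integral {0..t} g"
proof -
  have si: "set_integrable lborel {0..t} g" and eq: "\<gamma> t = \<gamma> 0 + (LINT s:{0..t}|lborel. g s)"
    using assms unfolding has_density_def by blast+
  show "g integrable_on {0..t}" by (rule set_borel_integral_eq_integral(1)[OF si])
  show "\<gamma> t = \<gamma> 0 + integral {0..t} g" using eq unfolding set_borel_integral_eq_integral(2)[OF si] .
qed

lemma has_density_set_integrable:
  assumes "has_density \<gamma> g" "0 \<le> a"
  shows "set_integrable lborel {a..b} g"
proof -
  have "set_integrable lborel {0..max 0 b} g" using assms unfolding has_density_def by auto
  then show ?thesis by (rule set_integrable_subset) (use assms in auto)
qed

lemma has_density_increment:
  assumes "has_density \<gamma> g" "0 \<le> a" "a \<le> b"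
  shows "\<gamma> b - \<gamma> a = (LINT s:{a..b}|lborel. g s)"
proof -
  have "integral {0..a} g + integral {a..b} g = integral {0..b} g"
    using assms by (intro Henstock_Kurzweil_Integration.integral_combine has_densityD(1)) auto
  then have "\<gamma> b - \<gamma> a = integral {a..b} g"
    using has_densityD(2)[OF assms(1), of a] has_densityD(2)[OF assms(1), of b] assms
    by (simp add: algebra_simps)
  then show ?thesis
    by (simp add: set_borel_integral_eq_integral(2)[OF has_density_set_integrable[OF assms(1,2)]])
qed

lemma has_density_continuous:
  assumes "has_density \<gamma> g" shows "continuous_on {0..} \<gamma>"
proof -
  have cont: "continuous_on {0..b} \<gamma>" if "0 \<le> b" for b
  proof -
    have "continuous_on {0..b} (\<lambda>t. \<gamma> 0 + integral {0..t} g)"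
      by (intro continuous_intros indefinite_integral_continuous_1 has_densityD(1)[OF assms] that)
    then show ?thesis
      by (rule continuous_on_eq) (rule has_densityD(2)[OF assms, symmetric], simp)
  qed
  show ?thesis
    unfolding continuous_on_def
  proof
    fix x :: real assume "x \<in> {0..}"
    then have x: "0 \<le> x" by simp
    have "(\<gamma> \<longlongrightarrow> \<gamma> x) (at x within {0..x + 1})"
      using cont[of "x + 1"] x unfolding continuous_on_def by simp
    moreover have "at x within {0..x + 1} = at x within {0..}"
      by (rule at_within_nhd[of x "{..<x + 1}"]) auto
    ultimately show "(\<gamma> \<longlongrightarrow> \<gamma> x) (at x within {0..})" by (simp only:)
  qed
qed

lemma has_density_measurable:
  assumes "has_density \<gamma> g"
  shows "set_borel_measurable borel {0..} g" "set_borel_measurable borel {0..} \<gamma>"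
proof -
  have "(\<lambda>s. indicator {0..} s *\<^sub>R g s) \<in> borel_measurable borel"
  proof (rule borel_measurable_LIMSEQ_metric)
    fix n :: nat
    have "set_integrable lborel {0..real n} g" using assms by (rule has_density_set_integrable) simp
    then show "(\<lambda>s. indicator {0..real n} s *\<^sub>R g s) \<in> borel_measurable borel"
      unfolding set_integrable_def using borel_measurable_integrable by fastforce
  next
    fix s :: real
    obtain N where N: "s \<le> real N" using real_arch_simple by blast
    have "\<forall>\<^sub>F n in sequentially. indicator {0..real n} s *\<^sub>R g s = indicator {0..} s *\<^sub>R g s"
      using eventually_ge_at_top[of N]
    proof eventually_elim
      case (elim n)
      then have "s \<le> real n" using N by linarith
      then show ?case by (simp add: indicator_def)
    qed
    then show "(\<lambda>n. indicator {0..real n} s *\<^sub>R g s) \<longlonglongrightarrow> indicator {0..} s *\<^sub>R g s"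
      by (rule tendsto_eventually)
  qed
  then show "set_borel_measurable borel {0..} g" unfolding set_borel_measurable_def .
  show "set_borel_measurable borel {0..} \<gamma>"
    unfolding set_borel_measurable_def
    by (intro borel_measurable_continuous_on_indicator has_density_continuous[OF assms]) simp
qed

section \<open>Almost everywhere uniqueness of densities\<close>

text \<open>Half-lines form an intersection-stable generator of the Borel sets; \<open>total\<close>
  serves the complement step of the induction.\<close>

lemma AE_eq_0_of_atMost_integrals:
  fixes d :: "real \<Rightarrow> real"
  assumes d: "integrable lborel d" and 0: "\<And>x. (LINT s:{..x}|lborel. d s) = 0"
    and total: "(LINT s|lborel. d s) = 0"
  shows "AE s in lborel. d s = 0"
proof (rule density_unique_real[OF d])
  fix A :: "real set" assume "A \<in> sets lborel"
  have borel: "sets (borel :: real measure) = sigma_sets UNIV (range atMost)"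
    unfolding borel_eq_atMost by (rule sets_measure_of) simp
  have A: "A \<in> sigma_sets UNIV (range atMost)"
    using \<open>A \<in> sets lborel\<close> by (simp only: sets_lborel borel)
  have si: "set_integrable lborel A d" if "A \<in> sets borel" for A
    unfolding set_integrable_def by (rule integrable_mult_indicator) (use d that in simp_all)
  have sets: "A \<in> sets borel" if "A \<in> sigma_sets UNIV (range (atMost :: real \<Rightarrow> _))" for A
    using that by (simp only: borel)
  have "Int_stable (range (atMost :: real \<Rightarrow> _))"
  proof (rule Int_stableI)
    fix P Q :: "real set" assume "P \<in> range atMost" "Q \<in> range atMost"
    then obtain a b where "P = {..a}" "Q = {..b}" by blast
    then show "P \<inter> Q \<in> range atMost" by (simp add: Int_atMost)
  qed
  moreover have "range (atMost :: real \<Rightarrow> _) \<subseteq> Pow UNIV" by simp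
  moreover note A
  ultimately have "(LINT s:A|lborel. d s) = 0"
  proof (induction rule: sigma_sets_induct_disjoint)
    case (basic A)
    then obtain x where "A = {..x}" by blast
    then show ?case by (simp only: 0)
  next
    case (compl A)
    have "(LINT s:A \<union> (UNIV - A)|lborel. d s) = (LINT s:A|lborel. d s) + (LINT s:UNIV - A|lborel. d s)"
    proof (rule set_integral_Un)
      show "set_integrable lborel A d" by (rule si[OF sets[OF compl(1)]])
      show "set_integrable lborel (UNIV - A) d"
        by (rule si) (use sets[OF compl(1)] in \<open>simp only: Compl_eq_Diff_UNIV[symmetric] borel_comp\<close>)
    qed blast
    moreover have "A \<union> (UNIV - A) = UNIV" by blast
    moreover have "(LINT s:UNIV|lborel. d s) = 0"
      using total by (simp add: set_lebesgue_integral_def)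
    ultimately show ?case using compl(2) by (simp only: add_0_left)
  next
    case (union A)
    have Ai: "A i \<in> sets borel" for i by (rule sets) (use union(2) in blast)
    then have "range A \<subseteq> sets borel" by blast
    then have U: "(\<Union>i. A i) \<in> sets borel" by (rule sets.countable_UN)
    have "(LINT s:(\<Union>i. A i)|lborel. d s) = (\<Sum>i. LINT s:A i|lborel. d s)"
    proof (rule lebesgue_integral_countable_add)
      show "set_integrable lborel (\<Union>i. A i) d" by (rule si[OF U])
      show "A i \<in> sets lborel" for i using Ai by (simp only: sets_lborel)
      show "A i \<inter> A j = {}" if "i \<noteq> j" for i j
        using union(1) that by (simp add: disjoint_family_on_def)
    qed
    then show ?case using union.IH by (simp only: suminf_zero)
  qed (simp add: set_lebesgue_integral_def)
  then show "(LINT s:A|lborel. d s) = (LINT s:A|lborel. 0)" by (simp add: set_lebesgue_integral_def)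
qed simp

text \<open>The rate function evaluates the Lagrangian on a density picked by \<open>SOME\<close>;
  uniqueness lets any density compute the cost. Densities are only locally integrable, hence the
  truncation to \<open>{0..real N}\<close>; the criterion is real-valued, hence the
  coordinates.\<close>

lemma has_density_unique:
  assumes g: "has_density \<gamma> g" and g': "has_density \<gamma> g'"
  shows "AE s in lborel. 0 \<le> s \<longrightarrow> g s = g' s"
proof -
  have "AE s in lborel. indicator {0..real N} s * ((g s - g' s) \<bullet> b) = 0" if "b \<in> Basis" for N b
  proof (rule AE_eq_0_of_atMost_integrals)
    have si: "set_integrable lborel {0..x} (\<lambda>s. g s - g' s)" for x
      by (intro set_integral_diff(1) has_density_set_integrable[OF g]
        has_density_set_integrable[OF g']) auto
    have eq: "indicator {0..x} s * ((g s - g' s) \<bullet> b) = (indicator {0..x} s *\<^sub>R (g s - g' s)) \<bullet> b"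
      for x s :: real by simp
    show "integrable lborel (\<lambda>s. indicator {0..real N} s * ((g s - g' s) \<bullet> b))"
      unfolding eq using si unfolding set_integrable_def by (intro integrable_inner_left) auto
    have zero: "(LINT s:{0..x}|lborel. (g s - g' s) \<bullet> b) = 0" for x
    proof -
      have "(LINT s:{0..x}|lborel. g s - g' s) = 0"
      proof (cases "0 \<le> x")
        case True
        then have "(LINT s:{0..x}|lborel. g s - g' s) = (LINT s:{0..x}|lborel. g s) - (LINT s:{0..x}|lborel. g' s)"
          by (intro set_integral_diff(2) has_density_set_integrable[OF g]
            has_density_set_integrable[OF g']) auto
        also have "\<dots> = (\<gamma> x - \<gamma> 0) - (\<gamma> x - \<gamma> 0)"
          using has_density_increment[OF g, of 0 x] has_density_increment[OF g', of 0 x] True by simp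
        finally show ?thesis by simp
      qed (simp add: set_lebesgue_integral_def)
      moreover have "(LINT s|lborel. (indicator {0..x} s *\<^sub>R (g s - g' s)) \<bullet> b) =
          (LINT s|lborel. indicator {0..x} s *\<^sub>R (g s - g' s)) \<bullet> b"
        using si[of x] unfolding set_integrable_def by (intro integral_inner_left)
      ultimately have "(LINT s|lborel. (indicator {0..x} s *\<^sub>R (g s - g' s)) \<bullet> b) = 0"
        unfolding set_lebesgue_integral_def by simp
      then show ?thesis unfolding set_lebesgue_integral_def by simp
    qed
    show "(LINT s:{..x}|lborel. indicator {0..real N} s * ((g s - g' s) \<bullet> b)) = 0" for x
    proof -
      have "(LINT s:{..x}|lborel. indicator {0..real N} s * ((g s - g' s) \<bullet> b)) =
          (LINT s:{0..min x (real N)}|lborel. (g s - g' s) \<bullet> b)"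
        unfolding set_lebesgue_integral_def
        by (rule Bochner_Integration.integral_cong) (auto simp: indicator_def)
      with zero show ?thesis by simp
    qed
    show "(LINT s|lborel. indicator {0..real N} s * ((g s - g' s) \<bullet> b)) = 0"
      using zero[of "real N"] unfolding set_lebesgue_integral_def by simp
  qed
  then have "AE s in lborel. \<forall>b\<in>Basis. \<forall>N. indicator {0..real N} s * ((g s - g' s) \<bullet> b) = 0"
    by (intro AE_finite_allI[OF finite_Basis]) (subst AE_all_countable, blast)
  then show ?thesis
  proof eventually_elim
    case (elim s)
    show ?case
    proof
      assume "0 \<le> s"
      obtain N where "s \<le> real N" using real_arch_simple by blast
      show "g s = g' s"
      proof (rule euclidean_eqI)
        fix b :: 'a assume "b \<in> Basis"
        with elim have "indicator {0..real N} s * ((g s - g' s) \<bullet> b) = 0" by blast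
        with \<open>0 \<le> s\<close> \<open>s \<le> real N\<close> show "g s \<bullet> b = g' s \<bullet> b" by (simp add: inner_diff_left)
      qed
    qed
  qed
qed

section \<open>The cost of a path and its dual lower bound\<close>

definition cost :: "('a::euclidean_space \<Rightarrow> 'a \<Rightarrow> ereal) \<Rightarrow> (real \<Rightarrow> 'a) \<Rightarrow> (real \<Rightarrow> 'a) \<Rightarrow> ennreal" where
  "cost l \<gamma> g = (\<integral>\<^sup>+s\<in>{0..}. e2ennreal (l (\<gamma> s) (g s)) \<partial>lborel)"

lemma lagrangian_rate_eq:
  assumes "has_density \<gamma> g"
  shows "lagrangian_rate I0 l \<gamma> = I0 (\<gamma> 0) + enn2ereal (cost l \<gamma> g)"
proof -
  let ?g = "SOME g. has_density \<gamma> g"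
  have "has_density \<gamma> ?g" using assms by (rule someI[of "has_density \<gamma>"])
  from has_density_unique[OF this assms]
  have "AE s in lborel. e2ennreal (l (\<gamma> s) (?g s)) * indicator {0..} s =
      e2ennreal (l (\<gamma> s) (g s)) * indicator {0..} s"
    by eventually_elim (simp add: indicator_def)
  then have "cost l \<gamma> ?g = cost l \<gamma> g" unfolding cost_def by (rule nn_integral_cong_AE)
  moreover have "\<exists>g. has_density \<gamma> g" using assms by blast
  then have "lagrangian_rate I0 l \<gamma> = I0 (\<gamma> 0) + enn2ereal (cost l \<gamma> ?g)"
    unfolding lagrangian_rate_def cost_def by (rule if_P)
  ultimately show ?thesis by (simp only:)
qed

lemma lagrangian_rate_lessE:
  assumes "lagrangian_rate (\<lambda>z. ereal (S z)) l \<gamma> < ereal c"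
  obtains g \<kappa> where "has_density \<gamma> g" "0 \<le> \<kappa>" "cost l \<gamma> g = ennreal \<kappa>" "S (\<gamma> 0) + \<kappa> < c"
proof -
  have "\<exists>g. has_density \<gamma> g"
  proof (rule ccontr)
    assume "\<not> ?thesis"
    then have "lagrangian_rate (\<lambda>z. ereal (S z)) l \<gamma> = \<infinity>"
      unfolding lagrangian_rate_def by (rule if_not_P)
    with assms show False by simp
  qed
  then obtain g where g: "has_density \<gamma> g" by blast
  have less: "ereal (S (\<gamma> 0)) + enn2ereal (cost l \<gamma> g) < ereal c"
    using assms unfolding lagrangian_rate_eq[OF g] .
  show thesis
  proof (cases "cost l \<gamma> g")
    case (real \<kappa>)
    with less show thesis by (intro that[OF g, of \<kappa>]) auto
  next
    case top
    with less show thesis by simp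
  qed
qed

text \<open>Young's inequality integrated over \<open>{a..b}\<close> against a constant covector. It
  controls the displacement of a path of which only the total cost is known.\<close>

lemma dual_bound:
  assumes g: "has_density \<gamma> g" and ab: "0 \<le> a" "a \<le> b" and \<kappa>: "0 \<le> \<kappa>" "cost l \<gamma> g \<le> ennreal \<kappa>"
    and hl: "\<And>z v. ereal (v \<bullet> \<xi> - h z \<xi>) \<le> l z v"
    and K: "\<And>s. a \<le> s \<Longrightarrow> s \<le> b \<Longrightarrow> h (\<gamma> s) \<xi> \<le> K"
  shows "(\<gamma> b - \<gamma> a) \<bullet> \<xi> \<le> K * (b - a) + \<kappa>"
proof -
  have si: "set_integrable lborel {a..b} g" by (rule has_density_set_integrable[OF g ab(1)])
  have i: "integrable lborel (\<lambda>s. (indicator {a..b} s *\<^sub>R g s) \<bullet> \<xi>)"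
    using si unfolding set_integrable_def by (intro integrable_inner_left)
  have i': "integrable lborel (\<lambda>s. indicator {a..b} s * K)"
    by (intro integrable_mult_left integrable_real_indicator) (auto simp: emeasure_lborel_Icc_eq)
  have diff: "(LINT s|lborel. (indicator {a..b} s *\<^sub>R g s) \<bullet> \<xi> - indicator {a..b} s * K) =
      (LINT s|lborel. (indicator {a..b} s *\<^sub>R g s) \<bullet> \<xi>) - (LINT s|lborel. indicator {a..b} s * K)"
    by (rule Bochner_Integration.integral_diff[OF i i'])
  have "(LINT s|lborel. (indicator {a..b} s *\<^sub>R g s) \<bullet> \<xi>) = (\<gamma> b - \<gamma> a) \<bullet> \<xi>"
    using si unfolding has_density_increment[OF g ab] set_integrable_def set_lebesgue_integral_def
    by (intro integral_inner_left)
  moreover have "(LINT s|lborel. indicator {a..b} s * K) = K * (b - a)" using ab by simp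
  ultimately have "(LINT s|lborel. (indicator {a..b} s *\<^sub>R g s) \<bullet> \<xi> - indicator {a..b} s * K) =
      (\<gamma> b - \<gamma> a) \<bullet> \<xi> - K * (b - a)" using diff by (simp only:)
  moreover have "(LINT s|lborel. (indicator {a..b} s *\<^sub>R g s) \<bullet> \<xi> - indicator {a..b} s * K) \<le> \<kappa>"
  proof (rule integral_real_bounded[OF \<kappa>(1)])
    \<comment> \<open>Only the positive part has to be compared, and the nonnegative cost density
      dominates it; outside \<open>{a..b}\<close> it vanishes.\<close>
    have "(\<integral>\<^sup>+s. ennreal ((indicator {a..b} s *\<^sub>R g s) \<bullet> \<xi> - indicator {a..b} s * K) \<partial>lborel) \<le> cost l \<gamma> g"
      unfolding cost_def
    proof (rule nn_integral_mono)
      fix s :: real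
      show "ennreal ((indicator {a..b} s *\<^sub>R g s) \<bullet> \<xi> - indicator {a..b} s * K) \<le>
        e2ennreal (l (\<gamma> s) (g s)) * indicator {0..} s"
      proof (cases "s \<in> {a..b}")
        case True
        have "ereal (g s \<bullet> \<xi> - K) \<le> ereal (g s \<bullet> \<xi> - h (\<gamma> s) \<xi>)" using K True by simp
        also have "\<dots> \<le> l (\<gamma> s) (g s)" by (rule hl)
        finally have "e2ennreal (ereal (g s \<bullet> \<xi> - K)) \<le> e2ennreal (l (\<gamma> s) (g s))"
          by (rule e2ennreal_mono)
        with True ab show ?thesis by (simp add: e2ennreal_ereal)
      qed simp
    qed
    with \<kappa>(2) show "(\<integral>\<^sup>+s. ennreal ((indicator {a..b} s *\<^sub>R g s) \<bullet> \<xi> - indicator {a..b} s * K) \<partial>lborel) \<le> ennreal \<kappa>"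
      by (rule order_trans[rotated])
  qed
  ultimately show ?thesis by simp
qed

section \<open>Peano's existence theorem\<close>

text \<open>Tonelli's scheme: iterating the integral operator with delayed argument becomes stationary on
  \<open>[0, 1]\<close> after finitely many steps.\<close>

lemma delayed_solution:
  fixes q :: "'a::euclidean_space \<Rightarrow> 'a"
  assumes cont: "continuous_on UNIV q" and bound: "\<And>z. norm (q z) \<le> M" and \<delta>: "0 < \<delta>"
  obtains \<phi> where "\<And>s s'. norm (\<phi> s - \<phi> s') \<le> M * \<bar>s - s'\<bar>" "\<phi> 0 = x"
    "\<And>s. s \<le> 1 \<Longrightarrow> \<phi> s = x + integral {0..s} (\<lambda>r. q (\<phi> (r - \<delta>)))"
proof -
  define T where "T \<psi> s = x + integral {0..s} (\<lambda>r. q (\<psi> (r - \<delta>)))" for \<psi> :: "real \<Rightarrow> 'a" and s :: real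
  define f where "f m = (T ^^ m) (\<lambda>_. x)" for m
  have M: "0 \<le> M" using bound norm_ge_zero order_trans by blast
  have T_lip: "norm (T \<psi> s - T \<psi> s') \<le> M * \<bar>s - s'\<bar>"
    if \<psi>: "continuous_on UNIV \<psi>" for \<psi> s s'
  proof -
    have c: "continuous_on A (\<lambda>r. q (\<psi> (r - \<delta>)))" for A
      by (intro continuous_on_compose2[OF cont] continuous_on_compose2[OF \<psi>] continuous_intros) auto
    have pos: "norm (T \<psi> b - T \<psi> a) \<le> M * (b - a)" if "0 \<le> a" "a \<le> b" for a b
    proof -
      have "integral {0..a} (\<lambda>r. q (\<psi> (r - \<delta>))) + integral {a..b} (\<lambda>r. q (\<psi> (r - \<delta>))) =
          integral {0..b} (\<lambda>r. q (\<psi> (r - \<delta>)))"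
        using that by (intro Henstock_Kurzweil_Integration.integral_combine integrable_continuous_real c) auto
      then have "T \<psi> b - T \<psi> a = integral {a..b} (\<lambda>r. q (\<psi> (r - \<delta>)))"
        unfolding T_def by (simp add: algebra_simps)
      then show ?thesis using integral_bound[OF that(2) c] bound by simp
    qed
    have le: "norm (T \<psi> s - T \<psi> s') \<le> M * (s - s')" if "s' \<le> s" for s s'
    proof -
      have "T \<psi> s = T \<psi> (max 0 s)" "T \<psi> s' = T \<psi> (max 0 s')"
        unfolding T_def by (auto simp: max_def)
      then have "norm (T \<psi> s - T \<psi> s') \<le> M * (max 0 s - max 0 s')"
        using pos[of "max 0 s'" "max 0 s"] that by auto
      also have "\<dots> \<le> M * (s - s')" using M that by (intro mult_left_mono) auto
      finally show ?thesis .
    qed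
    show ?thesis
      using le[of s' s] le[of s s'] by (cases "s' \<le> s") (auto simp: norm_minus_commute)
  qed
  have lip_cont: "continuous_on UNIV \<psi>"
    if "\<And>s s'. norm (\<psi> s - \<psi> s') \<le> M * \<bar>s - s'\<bar>" for \<psi> :: "real \<Rightarrow> 'a"
  proof (rule lipschitz_on_continuous_on)
    show "M-lipschitz_on UNIV \<psi>" using that M by (intro lipschitz_onI) (auto simp: dist_norm)
  qed
  have f_lip: "norm (f m s - f m s') \<le> M * \<bar>s - s'\<bar>" for m s s'
  proof (induction m arbitrary: s s')
    case (Suc m)
    then have "continuous_on UNIV (f m)" by (rule lip_cont)
    then show ?case unfolding f_def by (simp add: T_lip)
  qed (simp add: f_def M)
  \<comment> \<open>\<open>T \<psi>\<close> up to time \<open>s\<close> uses \<psi> only up to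
    \<open>s - \<delta>\<close>, so every iteration extends the agreement by \<delta>; at
    nonpositive times all iterates equal \<open>x\<close>.\<close>
  have stable: "f (Suc m) s = f m s" if "s \<le> real m * \<delta>" for m s
    using that
  proof (induction m arbitrary: s)
    case 0
    then show ?case by (auto simp: f_def T_def integral_null)
  next
    case (Suc m)
    have "f (Suc (Suc m)) s = T (f (Suc m)) s" "f (Suc m) s = T (f m) s" by (simp_all add: f_def)
    moreover have "T (f (Suc m)) s = T (f m) s"
    proof -
      have "integral {0..s} (\<lambda>r. q (f (Suc m) (r - \<delta>))) = integral {0..s} (\<lambda>r. q (f m (r - \<delta>)))"
      proof (rule integral_cong)
        fix r assume "r \<in> {0..s}"
        then have "r - \<delta> \<le> real m * \<delta>" using Suc.prems by (simp add: algebra_simps)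
        then show "q (f (Suc m) (r - \<delta>)) = q (f m (r - \<delta>))" by (simp only: Suc.IH)
      qed
      then show ?thesis unfolding T_def by (simp only:)
    qed
    ultimately show ?case by (simp only:)
  qed
  obtain m where m: "1 \<le> real m * \<delta>"
    using reals_Archimedean3[OF \<delta>] by (metis less_imp_le)
  show thesis
  proof (rule that[of "f m"])
    show "norm (f m s - f m s') \<le> M * \<bar>s - s'\<bar>" for s s' by (rule f_lip)
    have eq: "f m s = x + integral {0..s} (\<lambda>r. q (f m (r - \<delta>)))" if "s \<le> 1" for s
    proof -
      have "f m s = f (Suc m) s" by (rule stable[symmetric]) (use m that in linarith)
      also have "\<dots> = T (f m) s" by (simp add: f_def)
      finally show ?thesis unfolding T_def .
    qed
    then show "f m s = x + integral {0..s} (\<lambda>r. q (f m (r - \<delta>)))" if "s \<le> 1" for s using that .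
    show "f m 0 = x" using eq[of 0] by (metis add.right_neutral atLeastAtMost_singleton integral_singleton zero_le_one)
  qed
qed

text \<open>The delayed solutions share the Lipschitz constant \<open>M\<close>, so Arzela-Ascoli
  extracts a uniform limit on \<open>{0..1}\<close>. The delay shifts values by at most
  \<open>M * \<delta> n\<close>, and dominated convergence yields the integral equation for the
  limit.\<close>

theorem peano:
  fixes q :: "'a::euclidean_space \<Rightarrow> 'a"
  assumes cont: "continuous_on UNIV q" and bound: "\<And>z. norm (q z) \<le> M"
  obtains \<phi> where "\<phi> 0 = x"
    "\<And>s. s \<in> {0..1} \<Longrightarrow> (\<phi> has_vector_derivative q (\<phi> s)) (at s within {0..1})"
proof -
  define \<delta> where "\<delta> n = 1 / real (Suc n)" for n
  have \<delta>: "0 < \<delta> n" for n by (simp add: \<delta>_def)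
  have \<delta>0: "\<delta> \<longlonglongrightarrow> 0" unfolding \<delta>_def by (rule LIMSEQ_Suc[OF lim_1_over_n])
  have M: "0 \<le> M" using bound norm_ge_zero order_trans by blast
  have "\<exists>\<phi>. (\<forall>s s'. norm (\<phi> s - \<phi> s') \<le> M * \<bar>s - s'\<bar>) \<and> \<phi> 0 = x \<and>
      (\<forall>s\<le>1. \<phi> s = x + integral {0..s} (\<lambda>r. q (\<phi> (r - \<delta> n))))" for n
    by (rule delayed_solution[OF cont bound \<delta>[of n], of x]) blast
  then have "\<exists>\<phi>. \<forall>n. (\<forall>s s'. norm (\<phi> n s - \<phi> n s') \<le> M * \<bar>s - s'\<bar>) \<and> \<phi> n 0 = x \<and>
      (\<forall>s\<le>1. \<phi> n s = x + integral {0..s} (\<lambda>r. q (\<phi> n (r - \<delta> n))))" by (intro choice allI)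
  then obtain \<phi> where "\<forall>n. (\<forall>s s'. norm (\<phi> n s - \<phi> n s') \<le> M * \<bar>s - s'\<bar>) \<and> \<phi> n 0 = x \<and>
      (\<forall>s\<le>1. \<phi> n s = x + integral {0..s} (\<lambda>r. q (\<phi> n (r - \<delta> n))))" by (rule exE)
  then have lip: "norm (\<phi> n s - \<phi> n s') \<le> M * \<bar>s - s'\<bar>" and \<phi>0: "\<phi> n 0 = x"
    and \<phi>: "s \<le> 1 \<Longrightarrow> \<phi> n s = x + integral {0..s} (\<lambda>r. q (\<phi> n (r - \<delta> n)))" for n s s' by blast+
  obtain g k where g: "continuous_on {0..1} g" and k: "strict_mono (k :: nat \<Rightarrow> nat)"
    and lim: "\<And>e. 0 < e \<Longrightarrow> \<exists>N. \<forall>n x. N \<le> n \<and> x \<in> {0..1} \<longrightarrow> norm (\<phi> (k n) x - g x) < e"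
  proof (rule Arzela_Ascoli[of "{0..1}" \<phi> "norm x + M"])
    show "norm (\<phi> n s) \<le> norm x + M" if "s \<in> {0..1}" for n s
    proof -
      have "norm (\<phi> n s - x) \<le> M * \<bar>s - 0\<bar>" using lip[of n s 0] by (simp only: \<phi>0)
      also have "\<dots> \<le> M * 1" using M that by (intro mult_left_mono) auto
      finally show ?thesis using norm_triangle_sub[of "\<phi> n s" x] by simp
    qed
    fix s e :: real assume e: "0 < e"
    show "\<exists>d. 0 < d \<and> (\<forall>n y. y \<in> {0..1} \<and> norm (s - y) < d \<longrightarrow> norm (\<phi> n s - \<phi> n y) < e)"
    \<comment> \<open>\<open>M + 1\<close> rather than \<open>M\<close>, because \<open>M\<close>
      may be 0.\<close>
    proof (intro exI[of _ "e / (M + 1)"] conjI allI impI)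
      show "0 < e / (M + 1)" using e M by simp
      fix n y assume "y \<in> {0..1} \<and> norm (s - y) < e / (M + 1)"
      then have "(M + 1) * \<bar>s - y\<bar> < e" using M by (simp add: field_simps)
      then show "norm (\<phi> n s - \<phi> n y) < e" using lip[of n s y] by (simp add: distrib_right)
    qed
  qed (use that in auto)
  have conv: "(\<lambda>n. \<phi> (k n) s) \<longlonglongrightarrow> g s" if "s \<in> {0..1}" for s
    unfolding LIMSEQ_iff using lim that by meson
  have conv': "(\<lambda>n. \<phi> (k n) (s - \<delta> (k n))) \<longlonglongrightarrow> g s" if "s \<in> {0..1}" for s
  proof -
    have "(\<lambda>n. M * \<delta> (k n)) \<longlonglongrightarrow> M * 0"
      using LIMSEQ_subseq_LIMSEQ[OF \<delta>0 k] by (intro tendsto_mult_left) (simp add: o_def)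
    then have "(\<lambda>n. M * \<delta> (k n)) \<longlonglongrightarrow> 0" by simp
    moreover have "norm (\<phi> (k n) (s - \<delta> (k n)) - \<phi> (k n) s) \<le> M * \<delta> (k n)" for n
      using lip[of "k n" "s - \<delta> (k n)" s] \<delta>[of "k n"] by simp
    then have "\<forall>\<^sub>F n in sequentially. norm (\<phi> (k n) (s - \<delta> (k n)) - \<phi> (k n) s) \<le> M * \<delta> (k n)"
      by (intro always_eventually allI)
    ultimately have "(\<lambda>n. \<phi> (k n) (s - \<delta> (k n)) - \<phi> (k n) s) \<longlonglongrightarrow> 0"
      by (rule Lim_null_comparison[rotated])
    from tendsto_add[OF this conv[OF that]] show ?thesis by simp
  qed
  have g_eq: "g s = x + integral {0..s} (\<lambda>r. q (g r))" if s: "s \<in> {0..1}" for s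
  proof -
    have "(\<lambda>n. integral {0..s} (\<lambda>r. q (\<phi> (k n) (r - \<delta> (k n))))) \<longlonglongrightarrow> integral {0..s} (\<lambda>r. q (g r))"
    proof (rule dominated_convergence(2))
      fix n
      have "continuous_on UNIV (\<phi> (k n))"
      proof (rule lipschitz_on_continuous_on)
        show "M-lipschitz_on UNIV (\<phi> (k n))" using lip M by (intro lipschitz_onI) (auto simp: dist_norm)
      qed
      then have "continuous_on {0..s} (\<lambda>r. \<phi> (k n) (r - \<delta> (k n)))"
        by (rule continuous_on_compose2) (auto intro: continuous_intros)
      then have "continuous_on {0..s} (\<lambda>r. q (\<phi> (k n) (r - \<delta> (k n))))"
        by (rule continuous_on_compose2[OF cont]) simp
      then show "(\<lambda>r. q (\<phi> (k n) (r - \<delta> (k n)))) integrable_on {0..s}"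
        by (rule integrable_continuous_real)
      show "(\<lambda>_::real. M) integrable_on {0..s}" by (rule integrable_const_ivl)
      show "norm (q (\<phi> (k n) (r - \<delta> (k n)))) \<le> M" for r by (rule bound)
    next
      fix r assume "r \<in> {0..s}"
      then have "r \<in> {0..1}" using s by auto
      from conv'[OF this] show "(\<lambda>n. q (\<phi> (k n) (r - \<delta> (k n)))) \<longlonglongrightarrow> q (g r)"
        by (rule continuous_on_tendsto_compose[OF cont]) auto
    qed
    then have "(\<lambda>n. x + integral {0..s} (\<lambda>r. q (\<phi> (k n) (r - \<delta> (k n))))) \<longlonglongrightarrow>
        x + integral {0..s} (\<lambda>r. q (g r))" by (intro tendsto_intros)
    moreover have "\<phi> (k n) s = x + integral {0..s} (\<lambda>r. q (\<phi> (k n) (r - \<delta> (k n))))" for n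
      using s by (intro \<phi>) auto
    then have "(\<lambda>n. x + integral {0..s} (\<lambda>r. q (\<phi> (k n) (r - \<delta> (k n))))) \<longlonglongrightarrow> g s"
      using conv[OF s] by (simp only:)
    ultimately show ?thesis by (rule LIMSEQ_unique[rotated])
  qed
  show thesis
  proof (rule that)
    show "g 0 = x" using g_eq[of 0] by (metis add.right_neutral atLeastAtMost_iff atLeastAtMost_singleton integral_singleton order_refl zero_le_one)
    fix s :: real assume s: "s \<in> {0..1}"
    have "continuous_on {0..1} (\<lambda>r. q (g r))"
      by (rule continuous_on_compose2[OF cont g]) simp
    from integral_has_vector_derivative[OF this s]
    have "((\<lambda>u. x + integral {0..u} (\<lambda>r. q (g r))) has_vector_derivative q (g s)) (at s within {0..1})"
      by (auto intro!: derivative_eq_intros)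
    then show "(g has_vector_derivative q (g s)) (at s within {0..1})"
      by (rule has_vector_derivative_transform[OF s, rotated]) (rule g_eq)
  qed
qed

section \<open>Concatenation of paths\<close>

lemma has_density_cadlag:
  assumes "has_density \<gamma> g" "\<gamma> \<in> extensional {0..}"
  shows "\<gamma> \<in> cadlag"
proof -
  have lim: "(\<gamma> \<longlongrightarrow> \<gamma> t) (at t within {0..})" if "0 \<le> t" for t
    using has_density_continuous[OF assms(1)] that unfolding continuous_on_def by simp
  have right: "continuous (at_right t) \<gamma>" if "0 \<le> t" for t
    unfolding continuous_within by (rule tendsto_within_subset[OF lim[OF that]]) (use that in auto)
  have left: "(\<gamma> \<longlongrightarrow> \<gamma> t) (at_left t)" if "0 < t" for t
  proof -
    have "(\<gamma> \<longlongrightarrow> \<gamma> t) (at t within {0..<t})"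
      by (rule tendsto_within_subset[OF lim]) (use that in auto)
    moreover have "at t within {0..<t} = at_left t"
      by (rule at_within_nhd[of t "{0<..}"]) (use that in auto)
    ultimately show ?thesis by simp
  qed
  show ?thesis unfolding cadlag_def using assms(2) right left by blast
qed

text \<open>As a supremum of functions continuous in \<open>(z, v)\<close>, the Lagrangian is lower
  semicontinuous: its strict superlevel sets are open.\<close>

lemma lagrangian_measurable:
  fixes h :: "'a::euclidean_space \<Rightarrow> 'a \<Rightarrow> real"
  assumes cont: "\<And>\<xi>. continuous_on UNIV (\<lambda>z. h z \<xi>)"
    and l: "\<And>z v. l z v = legendre (\<lambda>\<xi>. ereal (h z \<xi>)) v"
  shows "(\<lambda>(z, v). l z v) \<in> borel_measurable borel"
proof (rule borel_measurableI_greater)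
  fix y
  have "{p. y < (case p of (z, v) \<Rightarrow> l z v)} = (\<Union>\<xi>. {p. y < ereal (snd p \<bullet> \<xi> - h (fst p) \<xi>)})"
    by (auto simp: l legendre_def less_SUP_iff)
  moreover have "open {p. y < ereal (snd p \<bullet> \<xi> - h (fst p) \<xi>)}" for \<xi>
    by (intro open_Collect_less continuous_intros continuous_on_compose2[OF cont]) auto
  ultimately have "open {p. y < (case p of (z, v) \<Rightarrow> l z v)}" by auto
  then show "{p \<in> space borel. y < (case p of (z, v) \<Rightarrow> l z v)} \<in> sets borel"
    using borel_open by simp
qed

lemma cost_integrand_measurable:
  assumes l: "(\<lambda>(z, v). l z v) \<in> borel_measurable borel" and g: "has_density \<gamma> g"
  shows "(\<lambda>s. e2ennreal (l (\<gamma> s) (g s)) * indicator {0..} s) \<in> borel_measurable borel"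
proof -
  have "(\<lambda>s. (indicator {0..} s *\<^sub>R \<gamma> s, indicator {0..} s *\<^sub>R g s)) \<in> borel_measurable borel"
    using has_density_measurable[OF g] unfolding set_borel_measurable_def
    by (intro borel_measurable_Pair)
  from measurable_compose[OF this l]
  have "(\<lambda>s. e2ennreal (l (indicator {0..} s *\<^sub>R \<gamma> s) (indicator {0..} s *\<^sub>R g s)) * indicator {0..} s)
      \<in> borel_measurable borel" by simp
  moreover have "e2ennreal (l (indicator {0..} s *\<^sub>R \<gamma> s) (indicator {0..} s *\<^sub>R g s)) * indicator {0..} s =
      e2ennreal (l (\<gamma> s) (g s)) * indicator {0..} s" for s :: real
    by (simp add: indicator_def)
  ultimately show ?thesis by simp
qed

definition concat_path :: "real \<Rightarrow> (real \<Rightarrow> 'a) \<Rightarrow> (real \<Rightarrow> 'a) \<Rightarrow> real \<Rightarrow> 'a" where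
  "concat_path t \<psi> \<sigma> s = (if s < 0 then undefined else if s \<le> t then \<psi> s else \<sigma> (s - t))"

definition concat_density :: "real \<Rightarrow> (real \<Rightarrow> 'a) \<Rightarrow> (real \<Rightarrow> 'a) \<Rightarrow> real \<Rightarrow> 'a" where
  "concat_density t f g s = (if s \<le> t then f s else g (s - t))"

text \<open>The half-open interval fits the convention of \<open>concat_density\<close>, which
  counts time \<open>t\<close> with the first piece; dropping the point 0 does not change the
  integral.\<close>

lemma LINT_shift:
  fixes g :: "real \<Rightarrow> 'a::euclidean_space"
  assumes g: "has_density \<sigma> g" and c: "0 \<le> c"
  shows "integrable lborel (\<lambda>s. indicator {0<..c} (s - t) *\<^sub>R g (s - t))"
    "(LINT s|lborel. indicator {0<..c} (s - t) *\<^sub>R g (s - t)) = \<sigma> c - \<sigma> 0"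
proof -
  have si: "set_integrable lborel A g" if "A \<subseteq> {0..c}" "A \<in> sets lborel" for A
    using has_density_set_integrable[OF g, of 0 c] that by (auto intro: set_integrable_subset)
  have "{0..c} = {0..0} \<union> {0<..c}" using c by auto
  then have "(LINT s:{0..c}|lborel. g s) = (LINT s:{0..0}|lborel. g s) + (LINT s:{0<..c}|lborel. g s)"
    using c by (simp only:) (rule set_integral_Un; auto intro: si)
  then have eq: "(LINT s:{0<..c}|lborel. g s) = \<sigma> c - \<sigma> 0"
    using has_density_increment[OF g, of 0 0] has_density_increment[OF g, of 0 c] c by simp
  have int: "integrable lborel (\<lambda>s. indicator {0<..c} s *\<^sub>R g s)"
    by (rule si[of "{0<..c}", unfolded set_integrable_def]) auto
  from lborel_integrable_real_affine[OF int, of 1 "- t"]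
  show "integrable lborel (\<lambda>s. indicator {0<..c} (s - t) *\<^sub>R g (s - t))" by simp
  from lborel_integral_real_affine[of 1 "\<lambda>s. indicator {0<..c} s *\<^sub>R g s" "- t"] eq
  show "(LINT s|lborel. indicator {0<..c} (s - t) *\<^sub>R g (s - t)) = \<sigma> c - \<sigma> 0"
    by (simp add: set_lebesgue_integral_def)
qed

lemma concat_has_density:
  fixes \<sigma> :: "real \<Rightarrow> 'a::euclidean_space"
  assumes g: "has_density \<sigma> g" and t: "0 \<le> t" and f: "continuous_on {0..t} f"
    and \<psi>: "\<And>s. s \<in> {0..t} \<Longrightarrow> (\<psi> has_vector_derivative f s) (at s within {0..t})"
    and match: "\<psi> t = \<sigma> 0"
  shows "has_density (concat_path t \<psi> \<sigma>) (concat_density t f g)"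
  unfolding has_density_def
proof (intro allI impI)
  fix b :: real assume b: "0 \<le> b"
  let ?\<gamma> = "concat_path t \<psi> \<sigma>" and ?G = "concat_density t f g"
  have part: "set_integrable lborel {0..c} f" "(LINT s:{0..c}|lborel. f s) = \<psi> c - \<psi> 0" if "0 \<le> c" "c \<le> t" for c
  proof -
    have c: "continuous_on {0..c} f" using continuous_on_subset[OF f] that by auto
    then show "set_integrable lborel {0..c} f" by (rule borel_integrable_atLeastAtMost')
    show "(LINT s:{0..c}|lborel. f s) = \<psi> c - \<psi> 0"
      unfolding set_lebesgue_integral_def
    proof (rule integral_FTC_atLeastAtMost[OF that(1) _ c])
      fix s assume "0 \<le> s" "s \<le> c"
      then show "(\<psi> has_vector_derivative f s) (at s within {0..c})"
        using that by (intro has_vector_derivative_within_subset[OF \<psi>]) auto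
    qed
  qed
  have \<gamma>0: "?\<gamma> 0 = \<psi> 0" using t by (simp add: concat_path_def)
  show "set_integrable lborel {0..b} ?G \<and> ?\<gamma> b = ?\<gamma> 0 + (LINT s:{0..b}|lborel. ?G s)"
  proof (cases "b \<le> t")
    case True
    have eq: "indicator {0..b} s *\<^sub>R ?G s = indicator {0..b} s *\<^sub>R f s" for s
      using True by (simp add: concat_density_def indicator_def)
    have "?\<gamma> b = \<psi> b" using b True by (simp add: concat_path_def)
    then show ?thesis
      using part[OF b True] \<gamma>0 by (simp add: set_integrable_def set_lebesgue_integral_def eq)
  next
    case False
    have eq: "indicator {0..b} s *\<^sub>R ?G s =
        indicator {0..t} s *\<^sub>R f s + indicator {0<..b - t} (s - t) *\<^sub>R g (s - t)" for s
      using False t by (simp add: concat_density_def indicator_def)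
    have c: "0 \<le> b - t" using False by simp
    have "?\<gamma> b = \<sigma> (b - t)" using b False by (simp add: concat_path_def)
    moreover have int: "integrable lborel (\<lambda>s. indicator {0..t} s *\<^sub>R f s)"
      using part(1)[of t] t unfolding set_integrable_def by simp
    have "(LINT s:{0..b}|lborel. ?G s) = (\<psi> t - \<psi> 0) + (\<sigma> (b - t) - \<sigma> 0)"
      unfolding set_lebesgue_integral_def eq
        Bochner_Integration.integral_add[OF int LINT_shift(1)[OF g c]] LINT_shift(2)[OF g c]
      using part(2)[of t] t by (simp add: set_lebesgue_integral_def)
    moreover have "set_integrable lborel {0..b} ?G"
      unfolding set_integrable_def eq
      by (rule Bochner_Integration.integrable_add[OF int LINT_shift(1)[OF g c]])
    ultimately show ?thesis using \<gamma>0 match by simp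
  qed
qed

text \<open>The integrand is dominated by the constant \<open>c\<close> on \<open>{0..t}\<close>
  plus the shifted integrand of \<sigma>. At \<open>s = t\<close> both terms are present, which is
  harmless for an upper bound.\<close>

lemma concat_cost:
  fixes \<sigma> :: "real \<Rightarrow> 'a::euclidean_space"
  assumes l: "(\<lambda>(z, v). l z v) \<in> borel_measurable borel" and g: "has_density \<sigma> g" and t: "0 \<le> t"
    and c: "\<And>s. 0 \<le> s \<Longrightarrow> s \<le> t \<Longrightarrow> l (\<psi> s) (f s) \<le> ereal c" and c0: "0 \<le> c"
  shows "cost l (concat_path t \<psi> \<sigma>) (concat_density t f g) \<le> ennreal (c * t) + cost l \<sigma> g"
proof -
  let ?F = "\<lambda>s. e2ennreal (l (\<sigma> s) (g s)) * indicator {0..} s"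
  have F: "?F \<in> borel_measurable borel" by (rule cost_integrand_measurable[OF l g])
  have F': "(\<lambda>s. ?F (- t + 1 * s)) \<in> borel_measurable borel"
    by (rule measurable_compose[OF _ F]) simp
  have "cost l (concat_path t \<psi> \<sigma>) (concat_density t f g) \<le>
      (\<integral>\<^sup>+s. ennreal c * indicator {0..t} s + ?F (- t + 1 * s) \<partial>lborel)"
    unfolding cost_def
  proof (rule nn_integral_mono)
    fix s :: real
    consider "s < 0" | "0 \<le> s" "s \<le> t" | "t < s" by linarith
    then show "e2ennreal (l (concat_path t \<psi> \<sigma> s) (concat_density t f g s)) * indicator {0..} s \<le>
        ennreal c * indicator {0..t} s + ?F (- t + 1 * s)"
    proof cases
      case 2
      have "e2ennreal (l (\<psi> s) (f s)) \<le> ennreal c"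
        using e2ennreal_mono[OF c[OF 2]] by (simp add: e2ennreal_ereal)
      with 2 show ?thesis
        by (simp add: concat_path_def concat_density_def add_increasing2)
    next
      case 3
      with t show ?thesis by (simp add: concat_path_def concat_density_def)
    qed simp
  qed
  also have "\<dots> = (\<integral>\<^sup>+s. ennreal c * indicator {0..t} s \<partial>lborel) + (\<integral>\<^sup>+s. ?F (- t + 1 * s) \<partial>lborel)"
    by (rule nn_integral_add) (use F' in simp_all)
  also have "(\<integral>\<^sup>+s. ennreal c * indicator {0..t} s \<partial>lborel) = ennreal (c * t)"
    using t c0 by (simp add: nn_integral_cmult_indicator ennreal_mult)
  also have "(\<integral>\<^sup>+s. ?F (- t + 1 * s) \<partial>lborel) = cost l \<sigma> g"
    unfolding cost_def using nn_integral_real_affine[OF F, of 1 "- t"] by simp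
  finally show ?thesis .
qed

section \<open>Subgradients and proximal maps\<close>

definition subgradient :: "('a::euclidean_space \<Rightarrow> real) \<Rightarrow> 'a \<Rightarrow> 'a \<Rightarrow> bool" where
  "subgradient f \<xi> p \<longleftrightarrow> (\<forall>\<eta>. f \<xi> + p \<bullet> (\<eta> - \<xi>) \<le> f \<eta>)"

text \<open>The equality case of Young's inequality: moving with a subgradient velocity has a finite
  and explicit cost.\<close>

lemma legendre_subgradient:
  assumes "subgradient f \<xi> p"
  shows "legendre (\<lambda>\<xi>. ereal (f \<xi>)) p = ereal (p \<bullet> \<xi> - f \<xi>)"
proof (rule antisym)
  show "legendre (\<lambda>\<xi>. ereal (f \<xi>)) p \<le> ereal (p \<bullet> \<xi> - f \<xi>)"
    unfolding legendre_def
  proof (rule SUP_least)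
    fix \<eta>
    have "f \<xi> + p \<bullet> (\<eta> - \<xi>) \<le> f \<eta>" using assms unfolding subgradient_def by blast
    then show "ereal (p \<bullet> \<eta>) - ereal (f \<eta>) \<le> ereal (p \<bullet> \<xi> - f \<xi>)" by (simp add: inner_diff_right)
  qed
  show "ereal (p \<bullet> \<xi> - f \<xi>) \<le> legendre (\<lambda>\<xi>. ereal (f \<xi>)) p"
    unfolding legendre_def by (rule SUP_upper2[of \<xi>]) auto
qed

text \<open>Near-maximizers of \<open>\<xi> \<bullet> v - l v\<close> satisfy the subgradient
  inequality up to \<open>1 / real (Suc n)\<close>. Testing it in the direction of
  \<open>v n\<close> bounds them through the values of \<open>f\<close> on the unit ball around
  \<xi>; a limit point is a subgradient.\<close>

lemma subgradient_exists:
  fixes f :: "'a::euclidean_space \<Rightarrow> real"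
  assumes cont: "continuous_on UNIV f" and l: "\<And>v. l v = legendre (\<lambda>\<xi>. ereal (f \<xi>)) v"
    and f: "\<And>\<xi>. ereal (f \<xi>) = legendre l \<xi>"
  obtains p where "subgradient f \<xi> p"
proof -
  have "\<exists>v. \<forall>\<eta>. f \<xi> + v \<bullet> (\<eta> - \<xi>) - 1 / real (Suc n) \<le> f \<eta>" for n
  proof -
    have "ereal (f \<xi> - 1 / real (Suc n)) < legendre l \<xi>" unfolding f[symmetric] by simp
    then obtain v where v: "ereal (f \<xi> - 1 / real (Suc n)) < ereal (\<xi> \<bullet> v) - l v"
      unfolding legendre_def less_SUP_iff by blast
    have "f \<xi> + v \<bullet> (\<eta> - \<xi>) - 1 / real (Suc n) \<le> f \<eta>" for \<eta>
    proof -
      have le: "ereal (v \<bullet> \<eta> - f \<eta>) \<le> l v"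
        unfolding l legendre_def by (rule SUP_upper2[of \<eta>]) auto
      then show ?thesis using v
        by (cases "l v") (auto simp: inner_diff_right inner_commute)
    qed
    then show ?thesis by blast
  qed
  then obtain v where v: "\<And>n \<eta>. f \<xi> + v n \<bullet> (\<eta> - \<xi>) - 1 / real (Suc n) \<le> f \<eta>" by metis
  have "compact (f ` cball \<xi> 1)"
    by (intro compact_continuous_image continuous_on_subset[OF cont]) auto
  then obtain K where K: "\<And>\<eta>. \<eta> \<in> cball \<xi> 1 \<Longrightarrow> \<bar>f \<eta>\<bar> \<le> K"
    using compact_imp_bounded bounded_real by (metis (no_types, lifting) imageI)
  have bound: "v n \<in> cball 0 (K - f \<xi> + 1)" for n
  proof -
    let ?u = "sgn (v n)"
    have "\<xi> + ?u \<in> cball \<xi> 1" by (simp add: dist_norm norm_sgn)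
    then have "f (\<xi> + ?u) \<le> K" using K[of "\<xi> + ?u"] by linarith
    moreover have "v n \<bullet> ?u = norm (v n)"
      by (cases "v n = 0") (simp_all add: sgn_div_norm power2_norm_eq_inner[symmetric] power2_eq_square)
    moreover have "1 / real (Suc n) \<le> 1" by simp
    moreover have "f \<xi> + v n \<bullet> ?u - 1 / real (Suc n) \<le> f (\<xi> + ?u)"
      using v[of n "\<xi> + ?u"] by (simp only: add_diff_cancel_left')
    ultimately have "norm (v n) \<le> K - f \<xi> + 1" by linarith
    then show ?thesis by simp
  qed
  obtain p r where r: "strict_mono (r :: nat \<Rightarrow> nat)" "(v \<circ> r) \<longlonglongrightarrow> p"
    using compact_cball[of 0 "K - f \<xi> + 1"] bound unfolding compact_def by blast
  have "subgradient f \<xi> p"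
    unfolding subgradient_def
  proof
    fix \<eta>
    have "(\<lambda>n. 1 / real (Suc (r n))) \<longlonglongrightarrow> 0"
      using LIMSEQ_subseq_LIMSEQ[OF LIMSEQ_Suc[OF lim_1_over_n] r(1)] by (simp add: o_def)
    then have "(\<lambda>n. f \<xi> + (v \<circ> r) n \<bullet> (\<eta> - \<xi>) - 1 / real (Suc (r n))) \<longlonglongrightarrow> f \<xi> + p \<bullet> (\<eta> - \<xi>) - 0"
      by (intro tendsto_intros r(2))
    then have "(\<lambda>n. f \<xi> + (v \<circ> r) n \<bullet> (\<eta> - \<xi>) - 1 / real (Suc (r n))) \<longlonglongrightarrow> f \<xi> + p \<bullet> (\<eta> - \<xi>)" by simp
    then show "f \<xi> + p \<bullet> (\<eta> - \<xi>) \<le> f \<eta>"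
      by (rule LIMSEQ_le_const2) (use v in auto)
  qed
  then show thesis by (rule that)
qed

section \<open>The proximal map of a convex Hamiltonian\<close>

locale hamiltonian =
  fixes h :: "'a::euclidean_space \<Rightarrow> 'a \<Rightarrow> real"
  assumes cont: "continuous_on UNIV (\<lambda>(z, \<xi>). h z \<xi>)"
    and convex: "\<And>z. convex_on UNIV (h z)"
    and h_0: "\<And>z. h z 0 = 0"
begin

lemma continuous_h: "continuous_on A f \<Longrightarrow> continuous_on A g \<Longrightarrow> continuous_on A (\<lambda>x. h (f x) (g x))"
  using continuous_on_compose2[OF cont, of A "\<lambda>x. (f x, g x)"] by (simp add: continuous_on_Pair)

lemma bounded_h: "\<exists>K\<ge>0. \<forall>z\<in>cball x R. \<forall>\<xi>\<in>cball 0 1. h z \<xi> \<le> K"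
proof -
  have "compact ((\<lambda>(z, \<xi>). h z \<xi>) ` (cball x R \<times> cball 0 1))"
    by (intro compact_continuous_image continuous_on_subset[OF cont] compact_Times) auto
  then have "bounded ((\<lambda>(z, \<xi>). h z \<xi>) ` (cball x R \<times> cball 0 1))" by (rule compact_imp_bounded)
  then obtain K where "\<forall>y\<in>(\<lambda>(z, \<xi>). h z \<xi>) ` (cball x R \<times> cball 0 1). \<bar>y\<bar> \<le> K"
    unfolding bounded_real by blast
  then have "\<forall>z\<in>cball x R. \<forall>\<xi>\<in>cball 0 1. h z \<xi> \<le> max K 0" by force
  then show ?thesis by (meson max.cobounded2)
qed

lemma linear_lower_bound:
  assumes "\<And>\<xi>. \<xi> \<in> cball 0 1 \<Longrightarrow> h z \<xi> \<le> K"
  shows "- K * norm \<xi> \<le> h z \<xi>"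
proof (cases "\<xi> = 0")
  case False
  define r where "r = norm \<xi>"
  have r: "0 < r" using False by (simp add: r_def)
  \<comment> \<open>The weight that places 0 on the segment from \<xi> to the unit vector opposite
    to it; \<open>h z\<close> vanishes there.\<close>
  let ?t = "r / (1 + r)"
  have conv: "h z ((1 - ?t) *\<^sub>R \<xi> + ?t *\<^sub>R (- (1 / r) *\<^sub>R \<xi>)) \<le> (1 - ?t) * h z \<xi> + ?t * h z (- (1 / r) *\<^sub>R \<xi>)"
    using r by (intro convex_onD[OF convex]) (auto simp: divide_simps)
  have zero: "(1 - ?t) *\<^sub>R \<xi> + ?t *\<^sub>R (- (1 / r) *\<^sub>R \<xi>) = 0"
  proof -
    have "(1 - ?t) *\<^sub>R \<xi> + ?t *\<^sub>R (- (1 / r) *\<^sub>R \<xi>) = ((1 - ?t) + ?t * (- (1 / r))) *\<^sub>R \<xi>"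
      by (simp only: scaleR_add_left scaleR_scaleR)
    also have "(1 - ?t) + ?t * (- (1 / r)) = 0" using r by (simp add: divide_simps)
    finally show ?thesis by simp
  qed
  have "h z (- (1 / r) *\<^sub>R \<xi>) \<le> K" by (rule assms) (use r in \<open>simp add: r_def\<close>)
  then have "?t * h z (- (1 / r) *\<^sub>R \<xi>) \<le> ?t * K" using r by (intro mult_left_mono) auto
  with conv have "0 \<le> (1 - ?t) * h z \<xi> + ?t * K" unfolding zero h_0 by linarith
  also have "\<dots> = (h z \<xi> + r * K) / (1 + r)"
  proof -
    have "1 - ?t = 1 / (1 + r)" using r by (simp add: divide_simps)
    then show ?thesis by (simp add: add_divide_distrib)
  qed
  finally have "0 \<le> h z \<xi> + r * K" using r by (simp add: zero_le_divide_iff)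
  then show ?thesis by (simp add: r_def mult.commute)
qed (simp add: h_0)

text \<open>The two subgradient inequalities, each tested at the other point, add up to
  \<open>(\<eta> - \<xi>) \<bullet> (\<eta> - \<xi>) \<le> 0\<close>: adding the identity makes the
  monotone subdifferential strictly monotone.\<close>

lemma prox_unique:
  assumes "subgradient (h z) \<xi> (v - \<xi>)" "subgradient (h z) \<eta> (v - \<eta>)"
  shows "\<xi> = \<eta>"
proof -
  have "h z \<xi> + (v - \<xi>) \<bullet> (\<eta> - \<xi>) \<le> h z \<eta>" "h z \<eta> + (v - \<eta>) \<bullet> (\<xi> - \<eta>) \<le> h z \<xi>"
    using assms unfolding subgradient_def by blast+
  moreover have "(v - \<xi>) \<bullet> (\<eta> - \<xi>) + (v - \<eta>) \<bullet> (\<xi> - \<eta>) = (\<eta> - \<xi>) \<bullet> (\<eta> - \<xi>)"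
    by (simp add: inner_diff_left inner_diff_right algebra_simps)
  ultimately have "(\<eta> - \<xi>) \<bullet> (\<eta> - \<xi>) \<le> 0" by linarith
  then have "(\<eta> - \<xi>) \<bullet> (\<eta> - \<xi>) = 0" using inner_ge_zero[of "\<eta> - \<xi>"] by linarith
  then show ?thesis by simp
qed

text \<open>Testing the subgradient inequality at 0 sets the square of \<open>norm \<xi>\<close>
  against terms linear in \<open>norm \<xi>\<close>. The bound is locally uniform in
  \<open>z\<close> because \<open>K\<close> is.\<close>

lemma prox_bound:
  assumes "\<And>\<xi>. \<xi> \<in> cball 0 1 \<Longrightarrow> h z \<xi> \<le> K" and "0 \<le> K" and "subgradient (h z) \<xi> (v - \<xi>)"
  shows "norm \<xi> \<le> K + norm v"
proof -
  have "h z \<xi> + (v - \<xi>) \<bullet> (0 - \<xi>) \<le> h z 0" using assms(3) unfolding subgradient_def by blast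
  then have "h z \<xi> - v \<bullet> \<xi> + norm \<xi> * norm \<xi> \<le> 0"
    by (simp add: h_0 inner_diff_left power2_norm_eq_inner[symmetric] power2_eq_square)
  moreover have "v \<bullet> \<xi> \<le> norm v * norm \<xi>" by (rule norm_cauchy_schwarz)
  moreover have "- K * norm \<xi> \<le> h z \<xi>" using assms(1) by (rule linear_lower_bound)
  ultimately have "norm \<xi> * norm \<xi> \<le> (K + norm v) * norm \<xi>" by (simp add: algebra_simps)
  then show ?thesis using assms(2) by (cases "\<xi> = 0") auto
qed

text \<open>The point \<open>\<xi>\<close> maximizes \<open>v \<bullet> \<xi> - h z \<xi> - norm \<xi>^2 / 2\<close>.\<close>

lemma prox_exists: "\<exists>\<xi>. subgradient (h z) \<xi> (v - \<xi>)"
proof -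
  define \<phi> where "\<phi> \<xi> = h z \<xi> - v \<bullet> \<xi> + (\<xi> \<bullet> \<xi>) / 2" for \<xi>
  obtain K where K: "0 \<le> K" "\<And>\<xi>. \<xi> \<in> cball 0 1 \<Longrightarrow> h z \<xi> \<le> K"
    using bounded_h[of z 0] by auto
  \<comment> \<open>Beyond this radius the quadratic term outweighs the linear lower bound, so
    \<phi> is nonnegative there, while it vanishes at 0.\<close>
  define M where "M = 2 * (K + norm v)"
  have M: "0 \<le> M" using K by (simp add: M_def)
  have "continuous_on (cball 0 M) \<phi>"
    unfolding \<phi>_def by (intro continuous_intros continuous_h) auto
  then obtain \<xi> where \<xi>: "\<xi> \<in> cball 0 M" "\<And>\<eta>. \<eta> \<in> cball 0 M \<Longrightarrow> \<phi> \<xi> \<le> \<phi> \<eta>"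
    using continuous_attains_inf[of "cball 0 M" \<phi>] M by auto
  have min: "\<phi> \<xi> \<le> \<phi> \<eta>" for \<eta>
  proof (cases "\<eta> \<in> cball 0 M")
    case False
    then have "M < norm \<eta>" by simp
    have "\<phi> \<xi> \<le> \<phi> 0" using M by (intro \<xi>) simp
    also have "\<phi> 0 = 0" by (simp add: \<phi>_def h_0)
    also have "0 \<le> norm \<eta> * (norm \<eta> / 2 - (K + norm v))"
      using \<open>M < norm \<eta>\<close> by (intro mult_nonneg_nonneg) (auto simp: M_def)
    also have "\<dots> = - K * norm \<eta> - norm v * norm \<eta> + (norm \<eta> * norm \<eta>) / 2" by (simp add: algebra_simps)
    also have "\<dots> \<le> \<phi> \<eta>"
      using linear_lower_bound[of z K \<eta>] K(2) norm_cauchy_schwarz[of v \<eta>]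
      by (simp add: \<phi>_def power2_norm_eq_inner[symmetric] power2_eq_square)
    finally show ?thesis .
  qed (rule \<xi>)
  have "subgradient (h z) \<xi> (v - \<xi>)"
    unfolding subgradient_def
  proof
    fix \<eta>
    define w where "w = \<eta> - \<xi>"
    \<comment> \<open>Minimality along the segment towards \<eta>, combined with convexity and
      divided by \<open>t\<close>; the quadratic remainder disappears as \<open>t\<close> tends to
      0.\<close>
    have le: "h z \<xi> + (v - \<xi>) \<bullet> w - t * (w \<bullet> w) / 2 \<le> h z \<eta>" if t: "0 < t" "t < 1" for t
    proof -
      have "h z ((1 - t) *\<^sub>R \<xi> + t *\<^sub>R \<eta>) \<le> (1 - t) * h z \<xi> + t * h z \<eta>"
        using t by (intro convex_onD[OF convex]) auto
      moreover have eq: "(1 - t) *\<^sub>R \<xi> + t *\<^sub>R \<eta> = \<xi> + t *\<^sub>R w" by (simp add: w_def algebra_simps)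
      moreover have "\<phi> \<xi> \<le> \<phi> (\<xi> + t *\<^sub>R w)" by (rule min)
      moreover have "\<phi> (\<xi> + t *\<^sub>R w) = h z (\<xi> + t *\<^sub>R w) - v \<bullet> \<xi> - t * (v \<bullet> w) +
          (\<xi> \<bullet> \<xi> + 2 * t * (\<xi> \<bullet> w) + t * (t * (w \<bullet> w))) / 2"
        by (simp add: \<phi>_def inner_add_left inner_add_right inner_commute algebra_simps)
      ultimately have "t * (h z \<xi> + (v - \<xi>) \<bullet> w - t * (w \<bullet> w) / 2) \<le> t * h z \<eta>"
        by (simp add: \<phi>_def inner_diff_left field_simps)
      then show ?thesis using t by simp
    qed
    have "((\<lambda>t. h z \<xi> + (v - \<xi>) \<bullet> w - t * (w \<bullet> w) / 2) \<longlongrightarrow> h z \<xi> + (v - \<xi>) \<bullet> w - 0 * (w \<bullet> w) / 2) (at_right 0)"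
      by (intro tendsto_intros) simp
    moreover have "\<forall>\<^sub>F t in at_right 0. h z \<xi> + (v - \<xi>) \<bullet> w - t * (w \<bullet> w) / 2 \<le> h z \<eta>"
      using le by (intro eventually_at_rightI[of 0 1]) auto
    ultimately have "h z \<xi> + (v - \<xi>) \<bullet> w - 0 * (w \<bullet> w) / 2 \<le> h z \<eta>"
      by (rule tendsto_upperbound) simp
    then show "h z \<xi> + (v - \<xi>) \<bullet> (\<eta> - \<xi>) \<le> h z \<eta>" by (simp add: w_def)
  qed
  then show ?thesis by blast
qed

text \<open>The resolvent of the subdifferential of \<open>h z\<close> at a fixed \<open>v\<close>,
  read as a function of the base point \<open>z\<close>. The field \<open>v - prox v z\<close> then
  selects a subgradient of \<open>h z\<close> at \<open>prox v z\<close>.\<close>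

definition prox :: "'a \<Rightarrow> 'a \<Rightarrow> 'a" where
  "prox v z = (THE \<xi>. subgradient (h z) \<xi> (v - \<xi>))"

lemma subgradient_prox: "subgradient (h z) (prox v z) (v - prox v z)"
proof -
  have "\<exists>!\<xi>. subgradient (h z) \<xi> (v - \<xi>)" using prox_exists prox_unique by blast
  then show ?thesis unfolding prox_def by (rule theI')
qed

lemma prox_eqI: "subgradient (h z) \<xi> (v - \<xi>) \<Longrightarrow> prox v z = \<xi>"
  using subgradient_prox prox_unique by blast

text \<open>A closed graph in a compact range: the subgradient inequalities are closed conditions on
  \<open>(z, \<xi>)\<close>, uniqueness identifies their solution set with the graph, and
  \<open>prox_bound\<close> provides a ball for all values over \<open>cball x 1\<close>.\<close>

lemma continuous_prox: "continuous_on UNIV (prox v)"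
proof -
  have cball: "continuous_on (cball x 1) (prox v)" for x
  proof -
    obtain K where K: "0 \<le> K" "\<And>z \<xi>. z \<in> cball x 1 \<Longrightarrow> \<xi> \<in> cball 0 1 \<Longrightarrow> h z \<xi> \<le> K"
      using bounded_h[of x 1] by blast
    show ?thesis
    proof (rule continuous_from_closed_graph)
      show "compact (cball (0 :: 'a) (K + norm v))" by simp
      show "prox v \<in> cball x 1 \<rightarrow> cball 0 (K + norm v)"
      proof
        fix z assume "z \<in> cball x 1"
        then show "prox v z \<in> cball 0 (K + norm v)"
          using prox_bound[OF K(2) K(1) subgradient_prox] by simp
      qed
      have "(\<lambda>z. (z, prox v z)) ` cball x 1 = (cball x 1 \<times> UNIV) \<inter>
          (\<Inter>\<eta>. {(z, \<xi>). h z \<xi> + (v - \<xi>) \<bullet> (\<eta> - \<xi>) \<le> h z \<eta>})" (is "?l = ?r")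
      proof
        show "?l \<subseteq> ?r" using subgradient_prox unfolding subgradient_def by auto
        show "?r \<subseteq> ?l"
        proof
          fix p assume p: "p \<in> ?r"
          then have "subgradient (h (fst p)) (snd p) (v - snd p)" unfolding subgradient_def by auto
          then have "prox v (fst p) = snd p" by (rule prox_eqI)
          with p show "p \<in> ?l" by (auto intro!: image_eqI[of _ _ "fst p"])
        qed
      qed
      moreover have "closed {(z, \<xi>). h z \<xi> + (v - \<xi>) \<bullet> (\<eta> - \<xi>) \<le> h z \<eta>}" for \<eta>
        unfolding case_prod_unfold
        by (intro closed_Collect_le continuous_intros continuous_h)
      ultimately show "closed ((\<lambda>z. (z, prox v z)) ` cball x 1)"
        by (auto intro!: closed_Int closed_Times closed_INT)
    qed
  qed
  have "isCont (prox v) x" for x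
    by (rule continuous_on_interior[OF cball[of x]]) (simp add: interior_cball)
  then show ?thesis by (simp add: continuous_at_imp_continuous_on)
qed

end

section \<open>Large deviations of stationary Markov processes\<close>

definition two_times :: "real \<Rightarrow> 'a::metric_space set \<Rightarrow> 'a set \<Rightarrow> (real \<Rightarrow> 'a) set" where
  "two_times t C D = {\<gamma> \<in> cadlag. \<gamma> 0 \<in> C \<and> \<gamma> t \<in> D}"

lemma sets_two_times:
  assumes "markov_law P \<mu> Q" "0 \<le> t" "C \<in> sets borel" "D \<in> sets borel"
  shows "two_times t C D \<in> sets Q"
proof -
  have 1: "space Q = cadlag" and m: "\<And>t. 0 \<le> t \<Longrightarrow> (\<lambda>\<gamma>. \<gamma> t) \<in> borel_measurable Q"
    using assms(1) unfolding markov_law_def by auto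
  have "two_times t C D = ((\<lambda>\<gamma>. \<gamma> 0) -` C \<inter> space Q) \<inter> ((\<lambda>\<gamma>. \<gamma> t) -` D \<inter> space Q)"
    unfolding 1 two_times_def by auto
  also have "\<dots> \<in> sets Q"
    by (intro sets.Int measurable_sets[OF m] assms) auto
  finally show ?thesis .
qed

lemma measure_two_times:
  assumes law: "markov_law P \<mu> Q" and P: "P t \<in> borel \<rightarrow>\<^sub>M prob_algebra borel" and t: "0 \<le> t"
    and C: "C \<in> sets borel" and D: "D \<in> sets borel"
  shows "measure Q (two_times t C D) = (LINT x:C|\<mu>. measure (P t x) D)"
proof -
  have space: "space Q = cadlag" and m: "(\<lambda>\<gamma>. \<gamma> 0) \<in> borel_measurable Q"
    and \<mu>: "distr Q borel (\<lambda>\<gamma>. \<gamma> 0) = \<mu>"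
    and markov: "\<And>s t A B. 0 \<le> s \<Longrightarrow> 0 \<le> t \<Longrightarrow> A \<in> past s \<Longrightarrow> B \<in> sets borel \<Longrightarrow>
      measure Q (A \<inter> {\<gamma> \<in> cadlag. \<gamma> (s + t) \<in> B}) = (LINT \<gamma>:A|Q. measure (P t (\<gamma> s)) B)"
    using law unfolding markov_law_def by auto
  let ?A = "{\<gamma> \<in> cadlag. \<gamma> 0 \<in> C}"
  have "?A \<in> past 0" unfolding past_def by (intro sigma_sets.Basic) (use C in force)
  from markov[OF order_refl t this D]
  have "measure Q (two_times t C D) = (LINT \<gamma>:?A|Q. measure (P t (\<gamma> 0)) D)"
    by (simp add: two_times_def Int_def conj_ac)
  also have "\<dots> = (LINT \<gamma>|Q. indicator C (\<gamma> 0) *\<^sub>R measure (P t (\<gamma> 0)) D)"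
    unfolding set_lebesgue_integral_def
    by (rule Bochner_Integration.integral_cong) (auto simp: space indicator_def)
  also have "\<dots> = (LINT x|distr Q borel (\<lambda>\<gamma>. \<gamma> 0). indicator C x *\<^sub>R measure (P t x) D)"
  proof (rule integral_distr[symmetric, OF m])
    have "(\<lambda>x. measure (P t x) D) \<in> borel_measurable borel"
      by (rule measurable_compose[OF P measurable_measure_prob_algebra[OF D]])
    then show "(\<lambda>x. indicator C x *\<^sub>R measure (P t x) D) \<in> borel_measurable borel"
      using C by (intro borel_measurable_scaleR borel_measurable_indicator)
  qed
  finally show ?thesis unfolding \<mu> set_lebesgue_integral_def .
qed

lemma measure_two_times_UNIV:
  assumes "markov_law P \<mu> Q" and C: "C \<in> sets borel"
  shows "measure Q (two_times t C UNIV) = measure \<mu> C"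
proof -
  have space: "space Q = cadlag" and m: "(\<lambda>\<gamma>. \<gamma> 0) \<in> borel_measurable Q"
    and \<mu>: "distr Q borel (\<lambda>\<gamma>. \<gamma> 0) = \<mu>"
    using assms(1) unfolding markov_law_def by auto
  have "two_times t C UNIV = (\<lambda>\<gamma>. \<gamma> 0) -` C \<inter> space Q"
    unfolding space two_times_def by auto
  then show ?thesis using measure_distr[OF m C] \<mu> by simp
qed

text \<open>Integrating the transition probabilities against the invariant law returns that law,
  whatever the time \<open>t\<close>.\<close>

lemma measure_UNIV_two_times:
  assumes law: "markov_law P \<mu> Q" and P: "P t \<in> borel \<rightarrow>\<^sub>M prob_algebra borel" and t: "0 \<le> t"
    and inv: "invariant_measure P \<mu>" and D: "D \<in> sets borel"
  shows "measure Q (two_times t UNIV D) = measure \<mu> D"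
proof -
  from inv have \<mu>: "prob_space \<mu>" "sets \<mu> = sets borel" and eq: "\<mu> \<bind> P t = \<mu>"
    unfolding invariant_measure_def using t by (auto simp: space_prob_algebra)
  interpret prob_space \<mu> by (rule \<mu>(1))
  have "P t \<in> measurable \<mu> (subprob_algebra borel)"
    using measurable_prob_algebraD[OF P] by (simp add: measurable_cong_sets[OF \<mu>(2) refl])
  from measure_bind[OF this D] have "measure \<mu> D = (LINT x|\<mu>. measure (P t x) D)" by (simp add: eq)
  then show ?thesis
    using measure_two_times[OF law P t _ D, of UNIV] by (simp add: set_lebesgue_integral_def)
qed

section \<open>Almost optimal paths of a stationary process\<close>

lemma log_prob_cong: "measure M A = measure N B \<Longrightarrow> log_prob M A = log_prob N B"
  unfolding log_prob_def by (simp only:)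

text \<open>The common setting for the process \<open>X\<close> with \<open>h1\<close> and the
  process \<open>Y\<close> with \<open>h2\<close>. The process starts in its invariant law, so
  \<open>S\<close> governs the initial point as well as the position at every later time.\<close>

locale stationary_LDP = hamiltonian h
  for h :: "'a::euclidean_space \<Rightarrow> 'a \<Rightarrow> real" +
  fixes l :: "'a \<Rightarrow> 'a \<Rightarrow> ereal" and S :: "'a \<Rightarrow> real" and \<pi> :: "nat \<Rightarrow> 'a measure"
    and P :: "nat \<Rightarrow> real \<Rightarrow> 'a \<Rightarrow> 'a measure" and Q :: "nat \<Rightarrow> (real \<Rightarrow> 'a) measure"
  assumes hl: "hamiltonian_lagrangian h l"
    and S_C1: "Ck 1 S"
    and LDP_\<pi>: "LDP euclidean \<pi> (\<lambda>z. ereal (S z))"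
    and LDP_Q: "LDP skorokhod Q (lagrangian_rate (\<lambda>z. ereal (S z)) l)"
    and law: "\<And>n. markov_law (P n) (\<pi> n) (Q n)"
    and semigroup: "\<And>n. transition_semigroup (P n)"
    and inv: "\<And>n. invariant_measure (P n) (\<pi> n)"
begin

lemma prob_space_Q: "prob_space (Q n)" and sets_Q: "sets (Q n) = sets skorokhod_borel"
  using law[of n] unfolding markov_law_def by blast+

sublocale skorokhod_LDP Q "lagrangian_rate (\<lambda>z. ereal (S z)) l"
  by (rule skorokhod_LDP.intro[OF LDP_Q prob_space_Q sets_Q])

lemma P_measurable: "0 \<le> t \<Longrightarrow> P n t \<in> borel \<rightarrow>\<^sub>M prob_algebra borel"
  using semigroup unfolding transition_semigroup_def by blast

lemma S_cont: "continuous_on UNIV S"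
proof (rule continuous_at_imp_continuous_on, rule ballI)
  fix x show "isCont S x"
    using S_C1 by (intro differentiable_imp_continuous_within) simp
qed

lemma l_nonneg: "0 \<le> l z v" and l_eq: "l z v = legendre (\<lambda>\<xi>. ereal (h z \<xi>)) v"
  and h_eq: "ereal (h z \<xi>) = legendre (l z) \<xi>"
  using hl unfolding hamiltonian_lagrangian_def by blast+

lemma l_ge: "ereal (v \<bullet> \<xi> - h z \<xi>) \<le> l z v"
  unfolding l_eq legendre_def by (rule SUP_upper2[of \<xi>]) auto

text \<open>A relation with a real \<kappa>, so that only paths of finite cost qualify.\<close>

definition path_cost :: "(real \<Rightarrow> 'a) \<Rightarrow> real \<Rightarrow> bool" where
  "path_cost \<gamma> \<kappa> \<longleftrightarrow> \<gamma> \<in> cadlag \<and> 0 \<le> \<kappa> \<and> (\<exists>g. has_density \<gamma> g \<and> cost l \<gamma> g = ennreal \<kappa>)"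

lemma path_cost_rate:
  assumes "path_cost \<gamma> \<kappa>"
  shows "lagrangian_rate (\<lambda>z. ereal (S z)) l \<gamma> = ereal (S (\<gamma> 0) + \<kappa>)"
  using assms lagrangian_rate_eq unfolding path_cost_def by (fastforce simp: enn2ereal_ennreal)

lemma path_cost_continuous: "path_cost \<gamma> \<kappa> \<Longrightarrow> continuous_on {0..} \<gamma>"
  unfolding path_cost_def using has_density_continuous by blast

text \<open>The almost optimal path lies in the closure of the event; since it is continuous and
  \<open>C\<close>, \<open>D\<close> are closed, it inherits the conditions at both times.\<close>

lemma path_upper:
  assumes t: "0 \<le> t" and C: "closed C" "closed D" and c: "ereal (- c) \<le> limsup (rate (two_times t C D))"
    and "c < c'"
  obtains \<sigma> \<kappa> where "path_cost \<sigma> \<kappa>" "\<sigma> 0 \<in> C" "\<sigma> t \<in> D" "S (\<sigma> 0) + \<kappa> < c'"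
proof -
  have "two_times t C D \<subseteq> cadlag" by (auto simp: two_times_def)
  moreover have "- ereal c \<le> limsup (rate (two_times t C D))" using c by simp
  moreover have "ereal c < ereal c'" using \<open>c < c'\<close> by simp
  ultimately show thesis
  proof (rule upper_bound)
    fix \<sigma> assume \<sigma>: "\<sigma> \<in> cadlag" "lagrangian_rate (\<lambda>z. ereal (S z)) l \<sigma> < ereal c'"
      "\<And>T e. 0 < e \<Longrightarrow> \<exists>y\<in>two_times t C D. y \<in> skorokhod_nbhd \<sigma> T e"
    obtain g \<kappa> where g: "has_density \<sigma> g" "0 \<le> \<kappa>" "cost l \<sigma> g = ennreal \<kappa>" "S (\<sigma> 0) + \<kappa> < c'"
      using lagrangian_rate_lessE[OF \<sigma>(2)] .
    show thesis
    proof (rule that)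
      show "path_cost \<sigma> \<kappa>" unfolding path_cost_def using \<sigma>(1) g by blast
      show "\<sigma> 0 \<in> C" "\<sigma> t \<in> D"
        using skorokhod_limit_two_times[OF has_density_continuous[OF g(1)] t C]
          \<sigma>(3)[unfolded two_times_def] by blast+
    qed (rule g)
  qed
qed

lemma path_lower:
  assumes \<gamma>: "path_cost \<gamma> \<kappa>" and t: "0 \<le> t" and r: "0 < r"
    and C: "C \<in> sets borel" "D \<in> sets borel" "ball (\<gamma> 0) r \<subseteq> C" "ball (\<gamma> t) r \<subseteq> D"
  shows "ereal (- (S (\<gamma> 0) + \<kappa>)) \<le> liminf (rate (two_times t C D))"
proof -
  obtain T e where e: "0 < e"
    "skorokhod_nbhd \<gamma> T e \<subseteq> {y \<in> cadlag. y 0 \<in> ball (\<gamma> 0) r \<and> y t \<in> ball (\<gamma> t) r}"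
    using skorokhod_nbhd_subset_two_times[OF path_cost_continuous[OF \<gamma>] t r] .
  then have "skorokhod_nbhd \<gamma> T e \<subseteq> two_times t C D" using C unfolding two_times_def by blast
  from lower_bound[OF _ e(1) this sets_two_times[OF law t C(1,2)]]
  show ?thesis using \<gamma> unfolding path_cost_rate[OF \<gamma>] path_cost_def by simp
qed

lemma LDP_cball: "ereal (- S x) \<le> liminf (\<lambda>n. ereal (1 / real n) * log_prob (\<pi> n) (cball x r))" if "0 < r"
proof -
  have "ereal (- S x) \<le> - (INF z\<in>ball x r. ereal (S z))"
    using that INF_lower[of x "ball x r" "\<lambda>z. ereal (S z)"]
    by (simp flip: uminus_ereal.simps)
  also have "\<dots> \<le> liminf (\<lambda>n. ereal (1 / real n) * log_prob (\<pi> n) (ball x r))"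
    using LDP_\<pi> unfolding LDP_def by simp
  also have "\<dots> \<le> liminf (\<lambda>n. ereal (1 / real n) * log_prob (\<pi> n) (cball x r))"
  proof (intro Liminf_mono always_eventually allI ereal_mult_left_mono log_prob_mono)
    fix n
    have "prob_space (\<pi> n)" and sets: "sets (\<pi> n) = sets borel"
      using inv[of n] unfolding invariant_measure_def by (auto simp: space_prob_algebra)
    then show "finite_measure (\<pi> n)" by (simp add: prob_space.finite_measure)
    show "cball x r \<in> sets (\<pi> n)" by (simp add: sets)
  qed auto
  finally show ?thesis .
qed

text \<open>The event restricts only the initial point, so its probability is the mass of the ball.
  For small \<open>r\<close>, continuity of \<open>S\<close> makes \<kappa> almost zero.\<close>

lemma low_cost_start:
  assumes "0 < r" "0 < \<epsilon>"
  obtains \<sigma> \<kappa> where "path_cost \<sigma> \<kappa>" "\<sigma> 0 \<in> cball x r" "S (\<sigma> 0) + \<kappa> < S x + \<epsilon>"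
proof -
  have "rate (two_times 0 (cball x r) UNIV) = (\<lambda>n. ereal (1 / real n) * log_prob (\<pi> n) (cball x r))"
    by (rule ext) (simp add: rate_def log_prob_cong[OF measure_two_times_UNIV[OF law]])
  then have "ereal (- S x) \<le> liminf (rate (two_times 0 (cball x r) UNIV))"
    using LDP_cball[OF assms(1), of x] by (simp only:)
  also have "\<dots> \<le> limsup (rate (two_times 0 (cball x r) UNIV))" by (rule Liminf_le_Limsup) simp
  finally have "ereal (- S x) \<le> limsup (rate (two_times 0 (cball x r) UNIV))" .
  then show thesis
    by (rule path_upper[where c' = "S x + \<epsilon>", OF order_refl closed_cball closed_UNIV])
      (use assms that in auto)
qed

text \<open>By invariance, being near \<open>x\<close> at time \<open>t\<close> has the mass of the
  ball as its probability, although nothing is imposed at time 0.\<close>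

lemma low_cost_end:
  assumes "0 \<le> t" "0 < r" "0 < \<epsilon>"
  obtains \<sigma> \<kappa> where "path_cost \<sigma> \<kappa>" "\<sigma> t \<in> cball x r" "S (\<sigma> 0) + \<kappa> < S x + \<epsilon>"
proof -
  have "rate (two_times t UNIV (cball x r)) = (\<lambda>n. ereal (1 / real n) * log_prob (\<pi> n) (cball x r))"
    by (rule ext) (simp add: rate_def
      log_prob_cong[OF measure_UNIV_two_times[OF law P_measurable[OF assms(1)] assms(1) inv]])
  then have "ereal (- S x) \<le> liminf (rate (two_times t UNIV (cball x r)))"
    using LDP_cball[OF assms(2), of x] by (simp only:)
  also have "\<dots> \<le> limsup (rate (two_times t UNIV (cball x r)))" by (rule Liminf_le_Limsup) simp
  finally have "ereal (- S x) \<le> limsup (rate (two_times t UNIV (cball x r)))" .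
  then show thesis
    by (rule path_upper[where c' = "S x + \<epsilon>", OF assms(1) closed_UNIV closed_cball])
      (use assms that in auto)
qed

text \<open>The path bounds from below the probability of being near \<open>\<gamma> t\<close> at
  time \<open>t\<close>. By invariance this is the mass of a small ball, which the principle for
  \<pi> bounds from above.\<close>

lemma quasipotential_bound:
  assumes \<gamma>: "path_cost \<gamma> \<kappa>" and t: "0 \<le> t"
  shows "S (\<gamma> t) \<le> S (\<gamma> 0) + \<kappa>"
proof (rule field_le_epsilon)
  fix e :: real assume e: "0 < e"
  have "isCont S (\<gamma> t)" using S_cont by (simp add: continuous_on_eq_continuous_at)
  then obtain d where d: "0 < d" "\<And>z. dist z (\<gamma> t) < d \<Longrightarrow> dist (S z) (S (\<gamma> t)) < e"
    using e unfolding continuous_at_eps_delta by (metis dist_norm)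
  let ?C = "cball (\<gamma> t) (d / 2)"
  have rate_eq: "rate (two_times t UNIV ?C) = (\<lambda>n. ereal (1 / real n) * log_prob (\<pi> n) ?C)"
    by (rule ext) (simp add: rate_def
      log_prob_cong[OF measure_UNIV_two_times[OF law P_measurable[OF t] t inv]])
  have "ereal (- (S (\<gamma> 0) + \<kappa>)) \<le> liminf (rate (two_times t UNIV ?C))"
    using d(1) by (intro path_lower[OF \<gamma> t, of "d / 2"]) auto
  also have "\<dots> \<le> limsup (rate (two_times t UNIV ?C))" by (rule Liminf_le_Limsup) simp
  also have "\<dots> = limsup (\<lambda>n. ereal (1 / real n) * log_prob (\<pi> n) ?C)"
    unfolding rate_eq ..
  also have "\<dots> \<le> - (INF z\<in>?C. ereal (S z))"
    using LDP_\<pi> unfolding LDP_def by simp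
  also have "\<dots> \<le> - ereal (S (\<gamma> t) - e)"
  proof -
    have "ereal (S (\<gamma> t) - e) \<le> (INF z\<in>?C. ereal (S z))"
    proof (rule INF_greatest)
      fix z assume "z \<in> ?C"
      then have "dist z (\<gamma> t) < d" using d(1) by (simp add: dist_commute)
      from d(2)[OF this] show "ereal (S (\<gamma> t) - e) \<le> ereal (S z)" by (simp add: dist_real_def)
    qed
    then show ?thesis by (simp only: ereal_minus_le_minus)
  qed
  finally show "S (\<gamma> t) \<le> S (\<gamma> 0) + \<kappa> + e" by simp
qed

text \<open>Only the conditions at the times 0 and \<open>t\<close> are exchanged: \<sigma> need not
  be the time reversal of \<gamma>, and its end points and cost are all that is claimed.\<close>

lemma reversed_path:
  assumes rev: "\<And>n. reversible_measure (P n) (\<pi> n)" and \<gamma>: "path_cost \<gamma> \<kappa>" and t: "0 \<le> t"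
    and "0 < r" "0 < \<epsilon>"
  obtains \<sigma> \<kappa>' where "path_cost \<sigma> \<kappa>'" "\<sigma> 0 \<in> cball (\<gamma> t) r" "\<sigma> t \<in> cball (\<gamma> 0) r"
    "S (\<sigma> 0) + \<kappa>' < S (\<gamma> 0) + \<kappa> + \<epsilon>"
proof -
  let ?C = "cball (\<gamma> 0) r" and ?D = "cball (\<gamma> t) r"
  have swap: "measure (Q n) (two_times t ?C ?D) = measure (Q n) (two_times t ?D ?C)" for n
  proof -
    have "(LINT x:?C|\<pi> n. measure (P n t x) ?D) = (LINT x:?D|\<pi> n. measure (P n t x) ?C)"
      using rev[of n] t unfolding reversible_measure_def by (meson borel_closed closed_cball)
    then show ?thesis by (simp add: measure_two_times[OF law P_measurable[OF t] t])
  qed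
  have eq: "rate (two_times t ?C ?D) = rate (two_times t ?D ?C)"
    unfolding rate_def log_prob_def swap ..
  have "ereal (- (S (\<gamma> 0) + \<kappa>)) \<le> liminf (rate (two_times t ?C ?D))"
    by (rule path_lower[OF \<gamma> t \<open>0 < r\<close>]) auto
  also have "\<dots> \<le> limsup (rate (two_times t ?C ?D))" by (rule Liminf_le_Limsup) simp
  finally have "ereal (- (S (\<gamma> 0) + \<kappa>)) \<le> limsup (rate (two_times t ?D ?C))" unfolding eq .
  then show thesis
    by (rule path_upper[where c' = "S (\<gamma> 0) + \<kappa> + \<epsilon>", OF t closed_cball closed_cball])
      (use assms that in auto)
qed

end

section \<open>Paths over short times\<close>

lemma has_vector_derivative_deviation:
  fixes \<phi> :: "real \<Rightarrow> 'a::euclidean_space"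
  assumes t: "0 \<le> t"
    and d: "\<And>s. s \<in> {0..t} \<Longrightarrow> (\<phi> has_vector_derivative f s) (at s within {0..t})"
    and f: "\<And>s. s \<in> {0..t} \<Longrightarrow> norm (f s - p) \<le> \<eta>"
  shows "norm (\<phi> t - \<phi> 0 - t *\<^sub>R p) \<le> \<eta> * t"
proof -
  have "((\<lambda>s. f s - p) has_integral (\<phi> t - t *\<^sub>R p) - (\<phi> 0 - 0 *\<^sub>R p)) {0..t}"
    by (rule fundamental_theorem_of_calculus[OF t])
      (auto intro!: derivative_eq_intros d)
  then have "((\<lambda>s. f s - p) has_integral \<phi> t - \<phi> 0 - t *\<^sub>R p) {0..t}" by (simp add: algebra_simps)
  moreover have "0 \<le> \<eta>" using f[of 0] t norm_ge_zero order_trans by (metis atLeastAtMost_iff order_refl)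
  ultimately have "norm (\<phi> t - \<phi> 0 - t *\<^sub>R p) \<le> \<eta> * Sigma_Algebra.measure lborel {0..t}"
    using f by (intro has_integral_bound_real[where f = "\<lambda>s. f s - p"]) auto
  then show ?thesis using t by simp
qed

text \<open>Consider the first exit from the ball.\<close>

lemma confinement:
  fixes \<phi> :: "real \<Rightarrow> 'a::metric_space"
  assumes cont: "continuous_on {0..t} \<phi>"
    and step: "\<And>\<tau>. \<tau> \<in> {0..t} \<Longrightarrow> (\<forall>s\<in>{0..\<tau>}. \<phi> s \<in> cball x R) \<Longrightarrow> dist (\<phi> \<tau>) (\<phi> 0) \<le> b"
    and less: "dist (\<phi> 0) x + b < R" and s: "s \<in> {0..t}" and b: "0 \<le> b"
  shows "\<phi> s \<in> cball x R"
proof (rule ccontr)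
  assume "\<phi> s \<notin> cball x R"
  define D where "D s = dist (\<phi> s) x" for s
  have D: "continuous_on {0..t} D" unfolding D_def by (intro continuous_intros cont)
  define T where "T = {r \<in> {0..t}. R \<le> D r}"
  have "s \<in> T" using s \<open>\<phi> s \<notin> cball x R\<close> by (simp add: T_def D_def dist_commute)
  have "closed ({0..t} \<inter> D -` {R..})" by (rule continuous_closed_preimage[OF D]) auto
  moreover have "T = {0..t} \<inter> D -` {R..}" by (auto simp: T_def)
  ultimately have "compact T"
    using bounded_subset[of "{0..t}" T] by (auto simp: compact_eq_bounded_closed)
  then obtain \<tau> where \<tau>: "\<tau> \<in> T" "\<And>r. r \<in> T \<Longrightarrow> \<tau> \<le> r"
    using compact_attains_inf[of T] \<open>s \<in> T\<close> by blast
  have \<tau>t: "0 \<le> \<tau>" "\<tau> \<le> t" "R \<le> D \<tau>" using \<tau>(1) by (auto simp: T_def)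
  have D0: "D 0 < R" using less b by (simp add: D_def)
  have "\<exists>r\<ge>0. r \<le> \<tau> \<and> D r = R"
    using D0 \<tau>t by (intro IVT' continuous_on_subset[OF D]) auto
  then obtain r where r: "0 \<le> r" "r \<le> \<tau>" "D r = R" by blast
  then have "r \<in> T" using \<tau>t by (simp add: T_def)
  with \<tau>(2) r have "D \<tau> = R" by (metis order_antisym)
  have "\<phi> u \<in> cball x R" if "u \<in> {0..\<tau>}" for u
  proof (cases "u = \<tau>")
    case True
    then show ?thesis using \<open>D \<tau> = R\<close> by (simp add: D_def dist_commute)
  next
    case False
    then have "u \<notin> T" using that \<tau>(2) by fastforce
    then show ?thesis using that \<tau>t by (auto simp: T_def D_def dist_commute)
  qed
  then have "dist (\<phi> \<tau>) (\<phi> 0) \<le> b" using step[of \<tau>] \<tau>t by simp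
  then have "D \<tau> < R"
    using less dist_triangle[of "\<phi> \<tau>" x "\<phi> 0"] unfolding D_def by linarith
  with \<tau>t(3) show False by simp
qed

lemma continuous_cball_bound:
  fixes f :: "'a::metric_space \<Rightarrow> 'b::metric_space"
  assumes "continuous_on UNIV f" "0 < e"
  obtains R where "0 < R" "R \<le> 1" "\<And>z. z \<in> cball x R \<Longrightarrow> dist (f z) (f x) \<le> e"
proof -
  obtain d where d: "0 < d" "\<And>z. dist z x < d \<Longrightarrow> dist (f z) (f x) < e"
    using assms unfolding continuous_on_iff by (metis UNIV_I)
  show thesis
  proof (rule that[of "min 1 (d / 2)"])
    fix z assume "z \<in> cball x (min 1 (d / 2))"
    then have "dist z x < d" using d(1) by (simp add: dist_commute)
    with d(2) show "dist (f z) (f x) \<le> e" by (simp add: less_imp_le)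
  qed (use d(1) in auto)
qed

lemma difference_quotient_tendsto:
  fixes S :: "'a::euclidean_space \<Rightarrow> real"
  assumes S: "S differentiable at x" and t: "\<And>n. 0 < t n" "t \<longlonglongrightarrow> 0"
    and y: "(\<lambda>n. (y n - x) /\<^sub>R t n) \<longlonglongrightarrow> u"
  shows "(\<lambda>n. (S (y n) - S x) / t n) \<longlonglongrightarrow> grad S x \<bullet> u"
proof -
  define e where "e z = (S z - (S x + grad S x \<bullet> (z - x))) / norm (z - x)" for z
  have e: "(e \<longlongrightarrow> 0) (at x)"
    using has_derivative_grad[OF S] unfolding has_derivative_within e_def[abs_def] by simp
  \<comment> \<open>Division by zero gives the value that makes \<open>e\<close> continuous at
    \<open>x\<close>, so indices with \<open>y n = x\<close> fit in.\<close>
  have "e x = 0" by (simp add: e_def)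
  with e have "isCont e x" by (simp add: isCont_def)
  have "(\<lambda>n. t n *\<^sub>R ((y n - x) /\<^sub>R t n)) \<longlonglongrightarrow> 0 *\<^sub>R u" by (intro tendsto_scaleR t y)
  moreover have "t n *\<^sub>R ((y n - x) /\<^sub>R t n) = y n - x" for n using t(1)[of n] by simp
  ultimately have "(\<lambda>n. y n - x) \<longlonglongrightarrow> 0" by simp
  then have "y \<longlonglongrightarrow> x" by (simp add: LIM_zero_iff)
  then have "(\<lambda>n. e (y n)) \<longlonglongrightarrow> e x" using \<open>isCont e x\<close> by (rule isCont_tendsto_compose[rotated])
  then have "(\<lambda>n. grad S x \<bullet> ((y n - x) /\<^sub>R t n) + e (y n) * norm ((y n - x) /\<^sub>R t n)) \<longlonglongrightarrow>
      grad S x \<bullet> u + e x * norm u" by (intro tendsto_intros y)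
  moreover have "grad S x \<bullet> ((y n - x) /\<^sub>R t n) + e (y n) * norm ((y n - x) /\<^sub>R t n) = (S (y n) - S x) / t n" for n
  proof -
    have "e (y n) * norm (y n - x) = S (y n) - S x - grad S x \<bullet> (y n - x)"
      by (cases "y n = x") (simp_all add: e_def)
    moreover have "norm ((y n - x) /\<^sub>R t n) = norm (y n - x) / t n"
      using t(1)[of n] by (simp add: divide_inverse mult.commute)
    ultimately have "e (y n) * norm ((y n - x) /\<^sub>R t n) = (S (y n) - S x - grad S x \<bullet> (y n - x)) / t n"
      by (metis times_divide_eq_right)
    moreover have "grad S x \<bullet> ((y n - x) /\<^sub>R t n) = (grad S x \<bullet> (y n - x)) / t n"
      by (simp add: divide_inverse mult.commute)
    ultimately show ?thesis by (simp add: diff_divide_distrib)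
  qed
  ultimately show ?thesis by (simp add: \<open>e x = 0\<close>)
qed

context stationary_LDP
begin

lemma path_dual_bound:
  assumes "path_cost \<gamma> \<kappa>" "0 \<le> a" "a \<le> b" "\<And>s. a \<le> s \<Longrightarrow> s \<le> b \<Longrightarrow> h (\<gamma> s) \<xi> \<le> K"
  shows "(\<gamma> b - \<gamma> a) \<bullet> \<xi> \<le> K * (b - a) + \<kappa>"
proof -
  obtain g where g: "has_density \<gamma> g" "cost l \<gamma> g = ennreal \<kappa>" and \<kappa>: "0 \<le> \<kappa>"
    using assms(1) unfolding path_cost_def by blast
  show ?thesis
  proof (rule dual_bound[where h = h, OF g(1) assms(2,3) \<kappa>])
    show "cost l \<gamma> g \<le> ennreal \<kappa>" by (simp add: g(2))
  qed (rule l_ge, rule assms(4))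
qed

text \<open>While the path stays in the ball, the dual bound in the direction of its displacement
  limits that displacement to \<open>K * t + \<kappa>\<close>; \<open>confinement\<close> removes
  the proviso.\<close>

lemma path_confined:
  assumes \<gamma>: "path_cost \<gamma> \<kappa>" and t: "0 \<le> t" and K: "0 \<le> K" "\<And>z \<xi>. z \<in> cball x R \<Longrightarrow> \<xi> \<in> cball 0 1 \<Longrightarrow> h z \<xi> \<le> K"
    and less: "dist (\<gamma> 0) x + (K * t + \<kappa>) < R" and s: "s \<in> {0..t}"
  shows "\<gamma> s \<in> cball x R"
proof (rule confinement[where b = "K * t + \<kappa>" and \<phi> = \<gamma> and t = t])
  show "dist (\<gamma> 0) x + (K * t + \<kappa>) < R" "s \<in> {0..t}" by (rule less, rule s)
  have "0 \<le> \<kappa>" using \<gamma> unfolding path_cost_def by blast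
  then show "0 \<le> K * t + \<kappa>" using K t by simp
  show "continuous_on {0..t} \<gamma>" by (rule continuous_on_subset[OF path_cost_continuous[OF \<gamma>]]) auto
  fix \<tau> assume \<tau>: "\<tau> \<in> {0..t}" and "\<forall>s\<in>{0..\<tau>}. \<gamma> s \<in> cball x R"
  then have "(\<gamma> \<tau> - \<gamma> 0) \<bullet> sgn (\<gamma> \<tau> - \<gamma> 0) \<le> K * (\<tau> - 0) + \<kappa>"
    by (intro path_dual_bound[OF \<gamma>] K(2)) (auto simp: norm_sgn)
  also have "\<dots> \<le> K * t + \<kappa>" using K(1) \<tau> by (simp add: mult_left_mono)
  also have "(\<gamma> \<tau> - \<gamma> 0) \<bullet> sgn (\<gamma> \<tau> - \<gamma> 0) = dist (\<gamma> \<tau>) (\<gamma> 0)"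
    by (cases "\<gamma> \<tau> = \<gamma> 0")
      (simp_all add: dist_norm sgn_div_norm power2_norm_eq_inner[symmetric] power2_eq_square)
  finally show "dist (\<gamma> \<tau>) (\<gamma> 0) \<le> K * t + \<kappa>" .
qed

text \<open>A path reaching \<open>x\<close> with velocity \<open>p\<close>: follow the continuous field of proximal subgradients
  through \<open>p\<close> backwards in time, starting from the initial point of a path of almost zero cost.\<close>

lemma approaching_path:
  assumes p: "subgradient (h x) \<xi> p" and \<eta>: "0 < \<eta>"
  obtains t0 where "0 < t0"
    "\<And>t \<epsilon>. 0 < t \<Longrightarrow> t \<le> t0 \<Longrightarrow> 0 < \<epsilon> \<Longrightarrow> \<exists>\<gamma> \<kappa>. path_cost \<gamma> \<kappa> \<and> dist (\<gamma> t) x \<le> \<epsilon> \<and>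
      norm (\<gamma> t - \<gamma> 0 - t *\<^sub>R p) \<le> \<eta> * t \<and> \<kappa> \<le> t * (p \<bullet> \<xi> - h x \<xi> + \<eta>) + \<epsilon>"
proof -
  \<comment> \<open>With this \<open>v\<close> the proximal point over \<open>x\<close> is \<xi>, so
    the field \<open>q\<close> takes the value \<open>p\<close> at \<open>x\<close>.\<close>
  define v where "v = p + \<xi>"
  define q where "q z = v - prox v z" for z
  define L where "L z = q z \<bullet> prox v z - h z (prox v z)" for z
  have sub: "subgradient (h z) (prox v z) (q z)" for z unfolding q_def by (rule subgradient_prox)
  have lL: "l z (q z) = ereal (L z)" for z
    unfolding l_eq L_def by (rule legendre_subgradient[OF sub])
  have "prox v x = \<xi>" by (rule prox_eqI) (simp add: v_def p)
  then have qx: "q x = p" and Lx: "L x = p \<bullet> \<xi> - h x \<xi>" by (simp_all add: q_def L_def v_def)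
  have q_cont: "continuous_on UNIV q" unfolding q_def by (intro continuous_intros continuous_prox)
  have L_cont: "continuous_on UNIV L"
    unfolding L_def by (intro continuous_intros q_cont continuous_prox continuous_h)
  obtain R1 where R1: "0 < R1" "\<And>z. z \<in> cball x R1 \<Longrightarrow> dist (q z) (q x) \<le> \<eta>"
    using continuous_cball_bound[OF q_cont \<eta>] by metis
  obtain R2 where R2: "0 < R2" "\<And>z. z \<in> cball x R2 \<Longrightarrow> dist (L z) (L x) \<le> \<eta>"
    using continuous_cball_bound[OF L_cont \<eta>] by metis
  define R where "R = min R1 R2"
  have R: "0 < R" using R1 R2 by (simp add: R_def)
  have qR: "norm (q z - p) \<le> \<eta>" and LR: "L z \<le> L x + \<eta>" if "z \<in> cball x R" for z
    using R1(2)[of z] R2(2)[of z] that by (auto simp: R_def qx dist_norm)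
  define M where "M = norm p + \<eta>"
  have M: "0 < M" using \<eta> by (simp add: M_def add_nonneg_pos)
  have qM: "norm (q z) \<le> M" if "z \<in> cball x R" for z
    using qR[OF that] norm_triangle_sub[of "q z" p] by (simp add: M_def)
  \<comment> \<open>Peano's theorem asks for a bounded field on the whole space, hence the
    projection onto the ball; the sign is reversed because \<phi> runs backwards from the start of
    \<sigma>.\<close>
  define f where "f z = - q (closest_point (cball x R) z)" for z
  have in_cball: "closest_point (cball x R) z \<in> cball x R" for z
    using R by (intro closest_point_in_set) auto
  have f_cont: "continuous_on UNIV f"
    unfolding f_def using R
    by (intro continuous_intros continuous_on_compose2[OF q_cont] continuous_on_closest_point) auto
  have fM: "norm (f z) \<le> M" for z unfolding f_def using qM[OF in_cball] by simp
  have f_eq: "f z = - q z" if "z \<in> cball x R" for z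
    unfolding f_def using closest_point_self[OF that] by simp
  \<comment> \<open>At speed at most \<open>M\<close> the solution moves at most
    \<open>R / 2\<close> within \<open>t0\<close>; the other half of the radius is left for the
    distance of its starting point from \<open>x\<close>.\<close>
  define t0 where "t0 = min 1 (R / (2 * M))"
  have t0: "0 < t0" "t0 \<le> 1" "M * t0 \<le> R / 2"
    using R M by (auto simp: t0_def min_def field_simps)
  show thesis
  proof (rule that[OF t0(1)])
    fix t \<epsilon> :: real assume t: "0 < t" "t \<le> t0" and \<epsilon>: "0 < \<epsilon>"
    obtain R3 where R3: "0 < R3" "\<And>z. z \<in> cball x R3 \<Longrightarrow> dist (S z) (S x) \<le> \<epsilon> / 2"
      using continuous_cball_bound[OF S_cont, of "\<epsilon> / 2"] \<epsilon> by (metis half_gt_zero)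
    \<comment> \<open>Three demands on the start of \<sigma>: within \<epsilon> of \<open>x\<close>,
      within half of \<open>R\<close>, and so near that \<open>S\<close> changes by at most
      \<open>\<epsilon> / 2\<close>, which forces \<open>\<kappa> \<le> \<epsilon>\<close>.\<close>
    define r where "r = min (min \<epsilon> (R / 2)) R3"
    have r: "0 < r" "r \<le> \<epsilon>" "r \<le> R / 2" "r \<le> R3" using \<epsilon> R R3 by (auto simp: r_def)
    obtain \<sigma> \<kappa> where \<sigma>: "path_cost \<sigma> \<kappa>" "\<sigma> 0 \<in> cball x r" "S (\<sigma> 0) + \<kappa> < S x + \<epsilon> / 2"
      using low_cost_start[OF r(1), of "\<epsilon> / 2" x] \<epsilon> by (metis half_gt_zero)
    have "dist (S (\<sigma> 0)) (S x) \<le> \<epsilon> / 2" using \<sigma>(2) r(4) by (intro R3) auto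
    with \<sigma>(3) have \<kappa>: "\<kappa> \<le> \<epsilon>" unfolding dist_real_def by linarith
    obtain g where g: "has_density \<sigma> g" "cost l \<sigma> g = ennreal \<kappa>" and \<kappa>0: "0 \<le> \<kappa>"
      using \<sigma>(1) unfolding path_cost_def by blast
    obtain \<phi> where \<phi>0: "\<phi> 0 = \<sigma> 0"
      and \<phi>: "\<And>s. s \<in> {0..1} \<Longrightarrow> (\<phi> has_vector_derivative f (\<phi> s)) (at s within {0..1})"
      using peano[OF f_cont fM, of "\<sigma> 0"] by metis
    have \<phi>': "(\<phi> has_vector_derivative f (\<phi> s)) (at s within {0..u})" if "s \<in> {0..u}" "u \<le> 1" for s u
      by (rule has_vector_derivative_within_subset[OF \<phi>]) (use that in auto)
    have \<phi>R: "\<phi> s \<in> cball x R" if s: "0 \<le> s" "s \<le> t" for s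
    proof -
      have "norm (\<phi> s - \<phi> 0 - s *\<^sub>R 0) \<le> M * s"
        using s t t0(2) fM by (intro has_vector_derivative_deviation[OF s(1) \<phi>']) auto
      also have "\<dots> \<le> M * t0" using s t M by (intro mult_left_mono) auto
      also have "\<dots> \<le> R / 2" by (rule t0(3))
      finally have "dist (\<phi> s) (\<sigma> 0) \<le> R / 2" by (simp add: \<phi>0 dist_norm)
      then show ?thesis
        using \<sigma>(2) r(3) dist_triangle[of x "\<phi> s" "\<sigma> 0"] by (simp add: dist_commute)
    qed
    define \<psi> where "\<psi> s = \<phi> (t - s)" for s
    have \<psi>R: "\<psi> s \<in> cball x R" if "s \<in> {0..t}" for s
      unfolding \<psi>_def using that by (intro \<phi>R) auto
    have \<psi>: "(\<psi> has_vector_derivative q (\<psi> s)) (at s within {0..t})" if s: "s \<in> {0..t}" for s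
    proof -
      have "(\<lambda>s. t - s) ` {0..t} \<subseteq> {0..1}" using t t0(2) by auto
      then have "(\<phi> has_vector_derivative f (\<phi> (t - s))) (at (t - s) within (\<lambda>s. t - s) ` {0..t})"
        using s t t0(2) by (intro has_vector_derivative_within_subset[OF \<phi>]) auto
      moreover have "((\<lambda>s. t - s) has_vector_derivative - 1) (at s within {0..t})"
        by (auto intro!: derivative_eq_intros)
      ultimately have "(\<phi> \<circ> (\<lambda>s. t - s) has_vector_derivative (- 1) *\<^sub>R f (\<phi> (t - s))) (at s within {0..t})"
        by (intro vector_diff_chain_within)
      then show ?thesis using f_eq[OF \<psi>R[OF s]] by (simp add: \<psi>_def[abs_def] o_def)
    qed
    have q\<psi>: "continuous_on {0..t} (\<lambda>s. q (\<psi> s))"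
    proof (rule continuous_on_compose2[OF q_cont])
      show "continuous_on {0..t} \<psi>"
        unfolding continuous_on_eq_continuous_within
        using \<psi> has_vector_derivative_continuous by blast
    qed simp
    have match: "\<psi> t = \<sigma> 0" by (simp add: \<psi>_def \<phi>0)
    let ?\<gamma> = "concat_path t \<psi> \<sigma>" and ?g = "concat_density t (\<lambda>s. q (\<psi> s)) g"
    have dens: "has_density ?\<gamma> ?g"
      using t by (intro concat_has_density[OF g(1) _ q\<psi> \<psi> match]) auto
    have ext: "?\<gamma> \<in> extensional {0..}" by (auto simp: extensional_def concat_path_def)
    have meas: "(\<lambda>(z, v). l z v) \<in> borel_measurable borel"
      by (rule lagrangian_measurable[OF continuous_h l_eq]) (auto intro: continuous_intros)
    have "0 \<le> L x" using l_nonneg[of x "q x"] by (simp add: lL)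
    have "cost l ?\<gamma> ?g \<le> ennreal ((L x + \<eta>) * t) + cost l \<sigma> g"
    proof (rule concat_cost[OF meas g(1)])
      fix s assume "0 \<le> s" "s \<le> t"
      then show "l (\<psi> s) (q (\<psi> s)) \<le> ereal (L x + \<eta>)"
        unfolding lL using LR[OF \<psi>R, of s] by simp
    qed (use t \<open>0 \<le> L x\<close> \<eta> in auto)
    also have "\<dots> = ennreal ((L x + \<eta>) * t + \<kappa>)"
      unfolding g(2) using t \<open>0 \<le> L x\<close> \<eta> \<kappa>0 by (intro ennreal_plus[symmetric]) auto
    finally have cost_le: "cost l ?\<gamma> ?g \<le> ennreal ((L x + \<eta>) * t + \<kappa>)" .
    then obtain \<kappa>' where \<kappa>': "0 \<le> \<kappa>'" "cost l ?\<gamma> ?g = ennreal \<kappa>'"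
      by (metis ennreal_cases ennreal_less_top leD top.not_eq_extremum)
    have "path_cost ?\<gamma> \<kappa>'"
      unfolding path_cost_def using has_density_cadlag[OF dens ext] \<kappa>' dens by blast
    moreover have "\<kappa>' \<le> t * (p \<bullet> \<xi> - h x \<xi> + \<eta>) + \<epsilon>"
    proof -
      have "0 \<le> (L x + \<eta>) * t + \<kappa>" using t \<open>0 \<le> L x\<close> \<eta> \<kappa>0 by simp
      then have "\<kappa>' \<le> (L x + \<eta>) * t + \<kappa>" using cost_le \<kappa>' by (simp add: ennreal_le_iff)
      then show ?thesis using \<kappa> by (simp add: Lx mult.commute)
    qed
    moreover have \<gamma>t: "?\<gamma> t = \<psi> t" "?\<gamma> 0 = \<psi> 0" using t by (simp_all add: concat_path_def)
    moreover have "dist (\<psi> t) x \<le> \<epsilon>" using \<sigma>(2) r(2) by (simp add: match dist_commute)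
    moreover have "norm (\<psi> t - \<psi> 0 - t *\<^sub>R p) \<le> \<eta> * t"
      using t by (intro has_vector_derivative_deviation[OF _ \<psi>] qR \<psi>R) auto
    ultimately show "\<exists>\<gamma> \<kappa>. path_cost \<gamma> \<kappa> \<and> dist (\<gamma> t) x \<le> \<epsilon> \<and>
      norm (\<gamma> t - \<gamma> 0 - t *\<^sub>R p) \<le> \<eta> * t \<and> \<kappa> \<le> t * (p \<bullet> \<xi> - h x \<xi> + \<eta>) + \<epsilon>"
      by metis
  qed
qed

end

lemma quotient_tendsto:
  fixes y :: "nat \<Rightarrow> 'a::real_normed_vector"
  assumes t: "\<And>n. 0 < t n" and \<eta>: "\<eta> \<longlonglongrightarrow> 0"
    and y: "\<And>n. norm (y n - x - t n *\<^sub>R u) \<le> c * \<eta> n * t n"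
  shows "(\<lambda>n. (y n - x) /\<^sub>R t n) \<longlonglongrightarrow> u"
proof -
  have "(\<lambda>n. c * \<eta> n) \<longlonglongrightarrow> 0" using tendsto_mult_right_zero[OF \<eta>] .
  moreover have "norm ((y n - x) /\<^sub>R t n - u) \<le> c * \<eta> n" for n
  proof -
    have "(y n - x) /\<^sub>R t n - u = (y n - x - t n *\<^sub>R u) /\<^sub>R t n"
      using t[of n] by (simp add: scaleR_diff_right)
    then have "norm ((y n - x) /\<^sub>R t n - u) = norm (y n - x - t n *\<^sub>R u) / t n"
      using t[of n] by (simp add: divide_inverse mult.commute)
    also have "\<dots> \<le> (c * \<eta> n * t n) / t n" using t[of n] y[of n] by (intro divide_right_mono) auto
    finally show ?thesis using t[of n] by simp
  qed
  then have "\<forall>\<^sub>F n in sequentially. norm ((y n - x) /\<^sub>R t n - u) \<le> c * \<eta> n"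
    by (intro always_eventually allI)
  ultimately have "(\<lambda>n. (y n - x) /\<^sub>R t n - u) \<longlonglongrightarrow> 0" by (rule Lim_null_comparison[rotated])
  then show ?thesis by (simp add: LIM_zero_iff)
qed

section \<open>Infinitesimal consequences of stationarity and reversibility\<close>

context stationary_LDP
begin

lemma S_differentiable: "S differentiable at x"
  using S_C1 by simp

text \<open>Divide \<open>S (\<gamma> t) \<le> S (\<gamma> 0) + \<kappa>\<close> by \<open>t\<close>
  along approaching paths, which run from \<open>x - t *\<^sub>R p\<close> to \<open>x\<close> up to
  o(t) at a cost of about \<open>t\<close> times the right-hand side.\<close>

lemma grad_S_le:
  assumes p: "subgradient (h x) \<xi> p"
  shows "grad S x \<bullet> p \<le> p \<bullet> \<xi> - h x \<xi>"
proof -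
  define L where "L = p \<bullet> \<xi> - h x \<xi>"
  define \<eta> where "\<eta> n = 1 / real (Suc n)" for n
  have \<eta>: "0 < \<eta> n" for n by (simp add: \<eta>_def)
  have \<eta>0: "\<eta> \<longlonglongrightarrow> 0" unfolding \<eta>_def by (rule LIMSEQ_Suc[OF lim_1_over_n])
  have "\<exists>t a b. 0 < t \<and> t \<le> \<eta> n \<and> norm (b - x) \<le> \<eta> n * t \<and> norm (b - a - t *\<^sub>R p) \<le> \<eta> n * t \<and>
      S b \<le> S a + t * (L + \<eta> n) + \<eta> n * t" for n
  proof -
    obtain t0 where t0: "0 < t0"
      "\<And>t \<epsilon>. 0 < t \<Longrightarrow> t \<le> t0 \<Longrightarrow> 0 < \<epsilon> \<Longrightarrow> \<exists>\<gamma> \<kappa>. path_cost \<gamma> \<kappa> \<and> dist (\<gamma> t) x \<le> \<epsilon> \<and>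
        norm (\<gamma> t - \<gamma> 0 - t *\<^sub>R p) \<le> \<eta> n * t \<and> \<kappa> \<le> t * (p \<bullet> \<xi> - h x \<xi> + \<eta> n) + \<epsilon>"
      by (rule approaching_path[OF p \<eta>]) blast
    define t where "t = min t0 (\<eta> n)"
    have t: "0 < t" "t \<le> t0" "t \<le> \<eta> n" using t0(1) \<eta>[of n] by (auto simp: t_def)
    \<comment> \<open>The tolerance \<open>\<eta> n * t\<close> stays small after division by
      \<open>t\<close>.\<close>
    obtain \<gamma> \<kappa> where \<gamma>: "path_cost \<gamma> \<kappa>" "dist (\<gamma> t) x \<le> \<eta> n * t"
      "norm (\<gamma> t - \<gamma> 0 - t *\<^sub>R p) \<le> \<eta> n * t" "\<kappa> \<le> t * (p \<bullet> \<xi> - h x \<xi> + \<eta> n) + \<eta> n * t"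
      using t0(2)[OF t(1,2), of "\<eta> n * t"] t(1) \<eta>[of n] by auto
    have "S (\<gamma> t) \<le> S (\<gamma> 0) + t * (L + \<eta> n) + \<eta> n * t"
      using quasipotential_bound[OF \<gamma>(1), of t] t(1) \<gamma>(4) by (simp add: L_def)
    with \<gamma> t show ?thesis by (auto simp: dist_norm)
  qed
  then obtain t a b where t: "\<And>n. 0 < t n" "\<And>n. t n \<le> \<eta> n"
    and b: "\<And>n. norm (b n - x) \<le> \<eta> n * t n" and ab: "\<And>n. norm (b n - a n - t n *\<^sub>R p) \<le> \<eta> n * t n"
    and S: "\<And>n. S (b n) \<le> S (a n) + t n * (L + \<eta> n) + \<eta> n * t n" by metis
  have t0: "t \<longlonglongrightarrow> 0"
    by (rule tendsto_sandwich[OF _ _ tendsto_const \<eta>0]) (auto intro!: always_eventually less_imp_le t)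
  have "(\<lambda>n. (b n - x) /\<^sub>R t n) \<longlonglongrightarrow> 0"
    by (rule quotient_tendsto[where c = 1, OF t(1) \<eta>0]) (use b in simp)
  from difference_quotient_tendsto[OF S_differentiable t(1) t0 this]
  have lb: "(\<lambda>n. (S (b n) - S x) / t n) \<longlonglongrightarrow> 0" by simp
  have "(\<lambda>n. (a n - x) /\<^sub>R t n) \<longlonglongrightarrow> - p"
  proof (rule quotient_tendsto[where c = 2, OF t(1) \<eta>0])
    fix n
    have "a n - x - t n *\<^sub>R (- p) = (b n - x) - (b n - a n - t n *\<^sub>R p)" by simp
    also have "norm \<dots> \<le> norm (b n - x) + norm (b n - a n - t n *\<^sub>R p)" by (rule norm_triangle_ineq4)
    finally show "norm (a n - x - t n *\<^sub>R (- p)) \<le> 2 * \<eta> n * t n" using b[of n] ab[of n] by linarith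
  qed
  from difference_quotient_tendsto[OF S_differentiable t(1) t0 this]
  have la: "(\<lambda>n. (S (a n) - S x) / t n) \<longlonglongrightarrow> - (grad S x \<bullet> p)" by simp
  have "(\<lambda>n. (S (b n) - S x) / t n - (S (a n) - S x) / t n) \<longlonglongrightarrow> 0 - - (grad S x \<bullet> p)"
    by (intro tendsto_diff lb la)
  moreover have "(\<lambda>n. L + 2 * \<eta> n) \<longlonglongrightarrow> L + 2 * 0" by (intro tendsto_intros \<eta>0)
  moreover have "(S (b n) - S x) / t n - (S (a n) - S x) / t n \<le> L + 2 * \<eta> n" for n
  proof -
    have "(S (b n) - S x) / t n - (S (a n) - S x) / t n = (S (b n) - S (a n)) / t n"
      by (simp add: diff_divide_distrib)
    also have "\<dots> \<le> (t n * (L + 2 * \<eta> n)) / t n"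
      using S[of n] t(1)[of n] by (intro divide_right_mono) (auto simp: algebra_simps)
    finally show ?thesis using t(1)[of n] by simp
  qed
  ultimately have "0 - - (grad S x \<bullet> p) \<le> L + 2 * 0" by (intro LIMSEQ_le) auto
  then show ?thesis by (simp add: L_def)
qed

text \<open>The path \<sigma> supplied by reversibility leads from near \<open>x\<close> to near
  \<open>x - t *\<^sub>R p\<close>, so its mean velocity is about \<open>- p\<close>. The dual bound
  with \<zeta> estimates its cost from below; from above it is at most the cost of the approaching
  path plus the drop of \<open>S\<close>. The supremum over \<zeta> of the resulting inequalities is
  the bound on \<open>l x (- p)\<close>.\<close>

lemma reversible_le:
  assumes rev: "\<And>n. reversible_measure (P n) (\<pi> n)" and p: "subgradient (h x) \<xi> p"
  shows "- (p \<bullet> \<zeta>) \<le> h x \<zeta> - grad S x \<bullet> p + (p \<bullet> \<xi> - h x \<xi>)"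
proof (rule field_le_epsilon)
  fix e :: real assume e: "0 < e"
  define L where "L = p \<bullet> \<xi> - h x \<xi>"
  define \<eta> where "\<eta> n = 1 / real (Suc n)" for n
  have \<eta>: "0 < \<eta> n" for n by (simp add: \<eta>_def)
  have \<eta>0: "\<eta> \<longlonglongrightarrow> 0" unfolding \<eta>_def by (rule LIMSEQ_Suc[OF lim_1_over_n])
  have "\<exists>t a b \<sigma> \<kappa>. 0 < t \<and> t \<le> \<eta> n \<and> norm (b - x) \<le> \<eta> n * t \<and> norm (b - a - t *\<^sub>R p) \<le> \<eta> n * t \<and>
      path_cost \<sigma> \<kappa> \<and> norm (\<sigma> 0 - b) \<le> \<eta> n * t \<and> norm (\<sigma> t - a) \<le> \<eta> n * t \<and>
      S (\<sigma> 0) + \<kappa> \<le> S a + t * (L + 3 * \<eta> n)" for n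
  proof -
    obtain t0 where t0: "0 < t0"
      "\<And>t \<epsilon>. 0 < t \<Longrightarrow> t \<le> t0 \<Longrightarrow> 0 < \<epsilon> \<Longrightarrow> \<exists>\<gamma> \<kappa>. path_cost \<gamma> \<kappa> \<and> dist (\<gamma> t) x \<le> \<epsilon> \<and>
        norm (\<gamma> t - \<gamma> 0 - t *\<^sub>R p) \<le> \<eta> n * t \<and> \<kappa> \<le> t * (p \<bullet> \<xi> - h x \<xi> + \<eta> n) + \<epsilon>"
      by (rule approaching_path[OF p \<eta>]) blast
    define t where "t = min t0 (\<eta> n)"
    have t: "0 < t" "t \<le> t0" "t \<le> \<eta> n" using t0(1) \<eta>[of n] by (auto simp: t_def)
    have \<eta>t: "0 < \<eta> n * t" using t(1) \<eta>[of n] by simp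
    obtain \<gamma> \<kappa> where \<gamma>: "path_cost \<gamma> \<kappa>" "dist (\<gamma> t) x \<le> \<eta> n * t"
      "norm (\<gamma> t - \<gamma> 0 - t *\<^sub>R p) \<le> \<eta> n * t" "\<kappa> \<le> t * (p \<bullet> \<xi> - h x \<xi> + \<eta> n) + \<eta> n * t"
      using t0(2)[OF t(1,2) \<eta>t] by blast
    obtain \<sigma> \<kappa>' where \<sigma>: "path_cost \<sigma> \<kappa>'" "\<sigma> 0 \<in> cball (\<gamma> t) (\<eta> n * t)" "\<sigma> t \<in> cball (\<gamma> 0) (\<eta> n * t)"
      "S (\<sigma> 0) + \<kappa>' < S (\<gamma> 0) + \<kappa> + \<eta> n * t"
      using reversed_path[OF rev \<gamma>(1) less_imp_le[OF t(1)] \<eta>t \<eta>t] by blast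
    \<comment> \<open>One \<open>\<eta> n\<close> comes from the running cost of the approaching
      path, one from its tail of almost zero cost, one from the exchange of end points.\<close>
    have "S (\<sigma> 0) + \<kappa>' \<le> S (\<gamma> 0) + t * (L + 3 * \<eta> n)"
      using \<sigma>(4) \<gamma>(4) by (simp add: L_def algebra_simps)
    moreover have "norm (\<sigma> 0 - \<gamma> t) \<le> \<eta> n * t" "norm (\<sigma> t - \<gamma> 0) \<le> \<eta> n * t"
      using \<sigma>(2,3) by (simp_all add: dist_norm norm_minus_commute)
    ultimately show ?thesis using \<gamma>(2,3) t(1,3) \<sigma>(1) unfolding dist_norm by blast
  qed
  then obtain t a b \<sigma> \<kappa> where t: "\<And>n. 0 < t n" "\<And>n. t n \<le> \<eta> n"
    and b: "\<And>n. norm (b n - x) \<le> \<eta> n * t n" and ab: "\<And>n. norm (b n - a n - t n *\<^sub>R p) \<le> \<eta> n * t n"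
    and \<sigma>: "\<And>n. path_cost (\<sigma> n) (\<kappa> n)" and \<sigma>0: "\<And>n. norm (\<sigma> n 0 - b n) \<le> \<eta> n * t n"
    and \<sigma>t: "\<And>n. norm (\<sigma> n (t n) - a n) \<le> \<eta> n * t n"
    and S: "\<And>n. S (\<sigma> n 0) + \<kappa> n \<le> S (a n) + t n * (L + 3 * \<eta> n)" by metis
  have t0: "t \<longlonglongrightarrow> 0"
    by (rule tendsto_sandwich[OF _ _ tendsto_const \<eta>0]) (auto intro!: always_eventually less_imp_le t)
  have a: "norm (a n - x - t n *\<^sub>R (- p)) \<le> 2 * \<eta> n * t n" for n
  proof -
    have "a n - x - t n *\<^sub>R (- p) = (b n - x) - (b n - a n - t n *\<^sub>R p)" by simp
    also have "norm \<dots> \<le> norm (b n - x) + norm (b n - a n - t n *\<^sub>R p)" by (rule norm_triangle_ineq4)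
    finally show ?thesis using b[of n] ab[of n] by linarith
  qed
  have \<sigma>0': "norm (\<sigma> n 0 - x - t n *\<^sub>R 0) \<le> 2 * \<eta> n * t n" for n
    using norm_triangle_ineq[of "\<sigma> n 0 - b n" "b n - x"] \<sigma>0[of n] b[of n] by simp
  have \<sigma>t': "norm (\<sigma> n (t n) - x - t n *\<^sub>R (- p)) \<le> 3 * \<eta> n * t n" for n
  proof -
    have "\<sigma> n (t n) - x - t n *\<^sub>R (- p) = (\<sigma> n (t n) - a n) + (a n - x - t n *\<^sub>R (- p))" by simp
    also have "norm \<dots> \<le> norm (\<sigma> n (t n) - a n) + norm (a n - x - t n *\<^sub>R (- p))"
      by (rule norm_triangle_ineq)
    finally show ?thesis using \<sigma>t[of n] a[of n] by linarith
  qed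
  note lim = quotient_tendsto[OF t(1) \<eta>0]
  note lim_S = difference_quotient_tendsto[OF S_differentiable t(1) t0 lim]
  \<comment> \<open>An upper bound for the cost of \<open>\<sigma> n\<close> per unit of
    time.\<close>
  define U where "U n = (S (a n) - S x) / t n - (S (\<sigma> n 0) - S x) / t n + (L + 3 * \<eta> n)" for n
  have "U \<longlonglongrightarrow> grad S x \<bullet> (- p) - grad S x \<bullet> 0 + (L + 3 * 0)"
    unfolding U_def by (intro tendsto_add tendsto_diff tendsto_mult lim_S[OF a] lim_S[OF \<sigma>0'] \<eta>0 tendsto_const)
  then have U: "U \<longlonglongrightarrow> L - grad S x \<bullet> p" by simp
  have \<kappa>: "\<kappa> n \<le> t n * U n" for n
  proof -
    have "t n * U n = (S (a n) - S x) - (S (\<sigma> n 0) - S x) + t n * (L + 3 * \<eta> n)"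
      using t(1)[of n] 
      by (simp add: U_def distrib_left right_diff_distrib[of "t n" "(S (a n) - S x) / t n"])
    then show ?thesis using S[of n] by simp
  qed
  have "continuous_on UNIV (\<lambda>z. h z \<zeta>)" by (intro continuous_h continuous_intros)
  then obtain R where R: "0 < R" "R \<le> 1" "\<And>z. z \<in> cball x R \<Longrightarrow> dist (h z \<zeta>) (h x \<zeta>) \<le> e"
    using continuous_cball_bound[OF _ e] by metis
  obtain K where K: "0 \<le> K" "\<And>z \<xi>. z \<in> cball x 1 \<Longrightarrow> \<xi> \<in> cball 0 1 \<Longrightarrow> h z \<xi> \<le> K"
    using bounded_h[of x 1] by blast
  \<comment> \<open>The initial distance from \<open>x\<close> plus the largest possible
    displacement: once the sum is below \<open>R\<close>, the path stays where
    \<open>h z \<zeta>\<close> differs from \<open>h x \<zeta>\<close> by at most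
    \<open>e\<close>.\<close>
  have "(\<lambda>n. 2 * \<eta> n * t n + (K * t n + t n * U n)) \<longlonglongrightarrow> 2 * 0 * 0 + (K * 0 + 0 * (L - grad S x \<bullet> p))"
    by (intro tendsto_intros \<eta>0 t0 U)
  then have "(\<lambda>n. 2 * \<eta> n * t n + (K * t n + t n * U n)) \<longlonglongrightarrow> 0" by simp
  then have "\<forall>\<^sub>F n in sequentially. 2 * \<eta> n * t n + (K * t n + t n * U n) < R"
    using R(1) by (rule order_tendstoD(2))
  then have "\<forall>\<^sub>F n in sequentially.
      ((\<sigma> n (t n) - x) /\<^sub>R t n - (\<sigma> n 0 - x) /\<^sub>R t n) \<bullet> \<zeta> \<le> h x \<zeta> + e + U n"
  proof eventually_elim
    case (elim n)
    have "dist (\<sigma> n 0) x + (K * t n + \<kappa> n) < R"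
      using elim \<sigma>0'[of n] \<kappa>[of n] by (simp add: dist_norm)
    then have conf: "\<sigma> n s \<in> cball x R" if "0 \<le> s" "s \<le> t n" for s
      using that R(2) t(1)[of n]
      by (intro path_confined[OF \<sigma> _ K(1) K(2), of "t n"]) auto
    have "(\<sigma> n (t n) - \<sigma> n 0) \<bullet> \<zeta> \<le> (h x \<zeta> + e) * (t n - 0) + \<kappa> n"
    proof (rule path_dual_bound[OF \<sigma>])
      fix s assume "0 \<le> s" "s \<le> t n"
      then have "dist (h (\<sigma> n s) \<zeta>) (h x \<zeta>) \<le> e" by (intro R conf)
      then show "h (\<sigma> n s) \<zeta> \<le> h x \<zeta> + e" unfolding dist_real_def by linarith
    qed (use t(1)[of n] in auto)
    also have "\<dots> \<le> t n * (h x \<zeta> + e + U n)" using \<kappa>[of n] by (simp add: algebra_simps)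
    finally have "((\<sigma> n (t n) - \<sigma> n 0) \<bullet> \<zeta>) / t n \<le> h x \<zeta> + e + U n"
      using t(1)[of n] by (simp add: divide_le_eq mult.commute)
    moreover have "(\<sigma> n (t n) - x) /\<^sub>R t n - (\<sigma> n 0 - x) /\<^sub>R t n = (\<sigma> n (t n) - \<sigma> n 0) /\<^sub>R t n"
      by (simp flip: scaleR_diff_right)
    ultimately show ?case by (simp add: divide_inverse mult.commute)
  qed
  moreover have "(\<lambda>n. ((\<sigma> n (t n) - x) /\<^sub>R t n - (\<sigma> n 0 - x) /\<^sub>R t n) \<bullet> \<zeta>) \<longlonglongrightarrow> (- p - 0) \<bullet> \<zeta>"
    by (intro tendsto_intros lim[OF \<sigma>0'] lim[OF \<sigma>t'])
  moreover have "(\<lambda>n. h x \<zeta> + e + U n) \<longlonglongrightarrow> h x \<zeta> + e + (L - grad S x \<bullet> p)"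
    by (intro tendsto_intros U)
  ultimately have "(- p - 0) \<bullet> \<zeta> \<le> h x \<zeta> + e + (L - grad S x \<bullet> p)"
    by (intro tendsto_le[OF sequentially_bot]) auto
  then show "- (p \<bullet> \<zeta>) \<le> h x \<zeta> - grad S x \<bullet> p + (p \<bullet> \<xi> - h x \<xi>) + e" by (simp add: L_def)
qed

text \<open>For a subgradient p at \<xi>, the choice \<open>\<zeta> = grad S x - \<xi>\<close>
  cancels all terms containing p and leaves one inequality. The reflection is an involution, so it
  also gives the other.\<close>

theorem reversible_symmetric:
  assumes "\<And>n. reversible_measure (P n) (\<pi> n)"
  shows "h x (grad S x - \<xi>) = h x \<xi>"
proof -
  have "h x \<xi> \<le> h x (grad S x - \<xi>)" for \<xi>
  proof -
    have "continuous_on UNIV (h x)"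
      using continuous_h[of UNIV "\<lambda>_. x" "\<lambda>\<xi>. \<xi>"] by simp
    then obtain p where "subgradient (h x) \<xi> p"
      using subgradient_exists[OF _ l_eq h_eq] by metis
    from reversible_le[OF assms this, of "grad S x - \<xi>"] show ?thesis
      by (simp add: inner_diff_right inner_commute)
  qed
  from this[of \<xi>] this[of "grad S x - \<xi>"] show ?thesis by simp
qed

text \<open>Almost optimal paths that end near \<open>x\<close> at a small time \<open>t\<close>
  must follow W, so they start near \<open>x - t *\<^sub>R W x\<close>. Their starting points have
  \<open>S\<close> at most \<open>S x\<close> up to o(t), hence the derivative of \<open>S\<close>
  in the direction \<open>- W x\<close> is not positive.\<close>

lemma grad_S_ge_linear:
  assumes W: "continuous_on UNIV W" and hW: "\<And>z \<xi>. h z \<xi> = W z \<bullet> \<xi>"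
  shows "0 \<le> W x \<bullet> grad S x"
proof -
  \<comment> \<open>Scaling \<open>\<zeta>\<close> in the dual bound removes the cost.\<close>
  have flow: "(\<gamma> b - \<gamma> a) \<bullet> \<zeta> \<le> K * (b - a)"
    if \<gamma>: "path_cost \<gamma> \<kappa>" and ab: "0 \<le> a" "a \<le> b" and K: "\<And>s. a \<le> s \<Longrightarrow> s \<le> b \<Longrightarrow> W (\<gamma> s) \<bullet> \<zeta> \<le> K"
    for \<gamma> \<kappa> a b \<zeta> K
  proof (rule field_le_epsilon)
    fix e :: real assume e: "0 < e"
    have \<kappa>: "0 \<le> \<kappa>" using \<gamma> unfolding path_cost_def by blast
    \<comment> \<open>Chosen so that \<open>m * e\<close> exceeds \<kappa>; the 1 keeps
      \<open>m\<close> positive when \<kappa> is 0.\<close>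
    define m where "m = (\<kappa> + 1) / e"
    have m: "0 < m" using e \<kappa> by (simp add: m_def)
    have "(\<gamma> b - \<gamma> a) \<bullet> (m *\<^sub>R \<zeta>) \<le> (m * K) * (b - a) + \<kappa>"
      by (rule path_dual_bound[OF \<gamma> ab]) (use K m in \<open>auto simp: hW\<close>)
    also have "\<dots> \<le> (m * K) * (b - a) + m * e" using e by (simp add: m_def)
    finally have "m * ((\<gamma> b - \<gamma> a) \<bullet> \<zeta>) \<le> m * (K * (b - a) + e)" by (simp add: algebra_simps)
    then show "(\<gamma> b - \<gamma> a) \<bullet> \<zeta> \<le> K * (b - a) + e" using m by simp
  qed
  define t where "t n = 1 / real (Suc n)" for n
  have t: "0 < t n" for n by (simp add: t_def)
  have t0: "t \<longlonglongrightarrow> 0" unfolding t_def by (rule LIMSEQ_Suc[OF lim_1_over_n])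
  \<comment> \<open>The tolerance \<open>t n * t n\<close> is o(t n), both for the end point and for
    the value of \<open>S\<close>.\<close>
  have "\<exists>\<sigma> \<kappa>. path_cost \<sigma> \<kappa> \<and> \<sigma> (t n) \<in> cball x (t n * t n) \<and> S (\<sigma> 0) + \<kappa> < S x + t n * t n" for n
    using low_cost_end[of "t n" "t n * t n" "t n * t n" x] t[of n] by (metis less_imp_le mult_pos_pos)
  then obtain \<sigma> \<kappa> where \<sigma>: "\<And>n. path_cost (\<sigma> n) (\<kappa> n)"
    and \<sigma>t: "\<And>n. \<sigma> n (t n) \<in> cball x (t n * t n)" and S: "\<And>n. S (\<sigma> n 0) + \<kappa> n < S x + t n * t n" by metis
  obtain M where M: "\<And>z. z \<in> cball x 1 \<Longrightarrow> norm (W z) \<le> M"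
  proof -
    have "compact (W ` cball x 1)"
      by (intro compact_continuous_image continuous_on_subset[OF W]) auto
    then show thesis using that unfolding bounded_iff by (metis bounded_iff compact_imp_bounded imageI)
  qed
  have M0: "0 \<le> M" using M[of x] norm_ge_zero order_trans by (metis centre_in_cball zero_le_one)
  have flow_lim: "(\<lambda>n. (\<sigma> n 0 - x) /\<^sub>R t n) \<longlonglongrightarrow> - W x"
  proof -
    have "(\<lambda>n. (\<sigma> n (t n) - x) /\<^sub>R t n) \<longlonglongrightarrow> 0"
    proof (rule quotient_tendsto[where c = 1, OF t t0])
      fix n show "norm (\<sigma> n (t n) - x - t n *\<^sub>R 0) \<le> 1 * t n * t n"
        using \<sigma>t[of n] by (simp add: dist_norm norm_minus_commute)
    qed
    moreover have "(\<lambda>n. (\<sigma> n (t n) - \<sigma> n 0) /\<^sub>R t n) \<longlonglongrightarrow> W x"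
    proof (rule tendstoI)
      fix e :: real assume e: "0 < e"
      obtain R where R: "0 < R" "R \<le> 1" "\<And>z. z \<in> cball x R \<Longrightarrow> dist (W z) (W x) \<le> e / 2"
        using continuous_cball_bound[OF W, of "e / 2" x] e by (metis half_gt_zero)
      have "(\<lambda>n. t n * t n + M * t n) \<longlonglongrightarrow> 0 * 0 + M * 0" by (intro tendsto_intros t0)
      then have "(\<lambda>n. t n * t n + M * t n) \<longlonglongrightarrow> 0" by simp
      then have "\<forall>\<^sub>F n in sequentially. t n * t n + M * t n < R"
        using R(1) by (rule order_tendstoD(2))
      then show "\<forall>\<^sub>F n in sequentially. dist ((\<sigma> n (t n) - \<sigma> n 0) /\<^sub>R t n) (W x) < e"
      proof eventually_elim
        case (elim n)
        \<comment> \<open>Only the final point is known to be near \<open>x\<close>, so confinement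
          is applied to the time-reversed path.\<close>
        define \<phi> where "\<phi> s = \<sigma> n (t n - s)" for s
        have \<phi>_conf: "\<phi> s \<in> cball x R" if "s \<in> {0..t n}" for s
        proof (rule confinement[where b = "M * t n" and \<phi> = \<phi> and t = "t n"])
          show "continuous_on {0..t n} \<phi>"
            unfolding \<phi>_def
            by (rule continuous_on_compose2[OF path_cost_continuous[OF \<sigma>]]) (auto intro: continuous_intros)
          show "dist (\<phi> 0) x + M * t n < R" using elim \<sigma>t[of n] by (simp add: \<phi>_def dist_commute)
          show "0 \<le> M * t n" using M0 t[of n] by simp
          fix \<tau> assume \<tau>: "\<tau> \<in> {0..t n}" and conf: "\<forall>s\<in>{0..\<tau>}. \<phi> s \<in> cball x R"
          let ?u = "sgn (\<phi> 0 - \<phi> \<tau>)"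
          have "(\<sigma> n (t n) - \<sigma> n (t n - \<tau>)) \<bullet> ?u \<le> M * (t n - (t n - \<tau>))"
          proof (rule flow[OF \<sigma>])
            fix s assume s: "t n - \<tau> \<le> s" "s \<le> t n"
            then have "\<sigma> n s = \<phi> (t n - s)" "t n - s \<in> {0..\<tau>}" by (auto simp: \<phi>_def)
            with conf have "\<sigma> n s \<in> cball x R" by metis
            then have "\<sigma> n s \<in> cball x 1" using R(2) by simp
            from M[OF this] have "norm (W (\<sigma> n s)) * norm ?u \<le> M * 1"
              using M0 by (intro mult_mono) (auto simp: norm_sgn)
            with norm_cauchy_schwarz[of "W (\<sigma> n s)" ?u] show "W (\<sigma> n s) \<bullet> ?u \<le> M" by simp
          qed (use \<tau> in auto)
          also have "\<dots> \<le> M * t n" using \<tau> M0 by (simp add: mult_left_mono)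
          also have "(\<sigma> n (t n) - \<sigma> n (t n - \<tau>)) \<bullet> ?u = dist (\<phi> \<tau>) (\<phi> 0)"
            by (cases "\<phi> 0 = \<phi> \<tau>")
              (simp_all add: \<phi>_def dist_norm sgn_div_norm norm_minus_commute
                power2_norm_eq_inner[symmetric] power2_eq_square)
          finally show "dist (\<phi> \<tau>) (\<phi> 0) \<le> M * t n" .
        qed (use that in auto)
        have conf: "\<sigma> n s \<in> cball x R" if "0 \<le> s" "s \<le> t n" for s
          using \<phi>_conf[of "t n - s"] that by (simp add: \<phi>_def)
        let ?w = "(\<sigma> n (t n) - \<sigma> n 0) - t n *\<^sub>R W x"
        have "(\<sigma> n (t n) - \<sigma> n 0) \<bullet> sgn ?w \<le> (W x \<bullet> sgn ?w + e / 2) * (t n - 0)"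
        proof (rule flow[OF \<sigma>])
          fix s assume "0 \<le> s" "s \<le> t n"
          then have "norm (W (\<sigma> n s) - W x) \<le> e / 2" using R(3)[OF conf] by (simp add: dist_norm)
          then have "norm (W (\<sigma> n s) - W x) * norm (sgn ?w) \<le> e / 2 * 1"
            using e by (intro mult_mono) (auto simp: norm_sgn)
          with norm_cauchy_schwarz[of "W (\<sigma> n s) - W x" "sgn ?w"]
          show "W (\<sigma> n s) \<bullet> sgn ?w \<le> W x \<bullet> sgn ?w + e / 2" by (simp add: inner_diff_left)
        qed (use t[of n] in auto)
        then have "?w \<bullet> sgn ?w \<le> e / 2 * t n" by (simp add: inner_diff_left algebra_simps)
        also have "?w \<bullet> sgn ?w = norm ?w"
          by (cases "?w = 0")
            (simp_all add: sgn_div_norm power2_norm_eq_inner[symmetric] power2_eq_square)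
        finally have "norm ?w / t n \<le> e / 2" using t[of n] by (simp add: divide_le_eq)
        moreover have "(\<sigma> n (t n) - \<sigma> n 0) /\<^sub>R t n - W x = ?w /\<^sub>R t n"
          using t[of n] by (simp add: scaleR_diff_right)
        then have "dist ((\<sigma> n (t n) - \<sigma> n 0) /\<^sub>R t n) (W x) = norm ?w / t n"
          using t[of n] by (simp add: dist_norm divide_inverse mult.commute)
        ultimately show ?case using e by linarith
      qed
    qed
    ultimately have "(\<lambda>n. (\<sigma> n (t n) - x) /\<^sub>R t n - (\<sigma> n (t n) - \<sigma> n 0) /\<^sub>R t n) \<longlonglongrightarrow> 0 - W x"
      by (rule tendsto_diff)
    moreover have "(\<sigma> n (t n) - x) /\<^sub>R t n - (\<sigma> n (t n) - \<sigma> n 0) /\<^sub>R t n = (\<sigma> n 0 - x) /\<^sub>R t n" for n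
      by (simp flip: scaleR_diff_right)
    ultimately show ?thesis by simp
  qed
  from difference_quotient_tendsto[OF S_differentiable t t0 this]
  have "(\<lambda>n. (S (\<sigma> n 0) - S x) / t n) \<longlonglongrightarrow> grad S x \<bullet> (- W x)" .
  moreover have "(S (\<sigma> n 0) - S x) / t n \<le> t n" for n
  proof -
    have "0 \<le> \<kappa> n" using \<sigma>[of n] unfolding path_cost_def by blast
    then show ?thesis using S[of n] t[of n] by (simp add: divide_le_eq)
  qed
  ultimately have "grad S x \<bullet> (- W x) \<le> 0" by (intro LIMSEQ_le[OF _ t0]) auto
  then show ?thesis by (simp add: inner_commute)
qed

end

section \<open>Assembly of the GENERIC structure\<close>

lemma markov_stationary_LDP:
  assumes "continuous_on UNIV (\<lambda>(z, \<xi>). h z \<xi>)" "hamiltonian_lagrangian h l" "Ck 1 S"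
    and "LDP euclidean \<pi> (\<lambda>z. ereal (S z))" "\<And>n. markov_process (P n) (Z n)"
    and "\<And>n. unique_invariant_measure (P n) (\<pi> n)" "\<pi> \<in> V" "lagrangian_LDP V Z l"
  shows "stationary_LDP h l S \<pi> P (\<lambda>n. Z n (\<pi> n))"
proof
  show "continuous_on UNIV (\<lambda>(z, \<xi>). h z \<xi>)" "hamiltonian_lagrangian h l" "Ck 1 S"
    "LDP euclidean \<pi> (\<lambda>z. ereal (S z))" by fact+
  show "convex_on UNIV (h z)" "h z 0 = 0" for z
    using assms(2) unfolding hamiltonian_lagrangian_def by blast+
  show "LDP skorokhod (\<lambda>n. Z n (\<pi> n)) (lagrangian_rate (\<lambda>z. ereal (S z)) l)"
    using assms(4,7,8) unfolding lagrangian_LDP_def by blast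
  show inv: "invariant_measure (P n) (\<pi> n)" for n
    using assms(6) unfolding unique_invariant_measure_def by blast
  then show "markov_law (P n) (\<pi> n) (Z n (\<pi> n))" "transition_semigroup (P n)" for n
    using assms(5) unfolding markov_process_def invariant_measure_def by blast+
qed

lemma legendre_add_linear:
  "legendre (\<lambda>\<xi>. ereal (w \<bullet> \<xi> + f \<xi>)) v = legendre (\<lambda>\<xi>. ereal (f \<xi>)) (v - w)"
  unfolding legendre_def by (simp add: inner_diff_left algebra_simps)

text \<open>Energy conservation is immediate because the second coordinate stays 0. The last
  conjunct is an implication because continuity and convexity of \<open>h2\<close> yield neither
  strict convexity nor differentiability; the construction transfers these properties from
  \<open>h2\<close> and \<open>l2\<close> to the potentials on the extended space.\<close>

theorem corollary4p4:
  fixes PZ PX PY :: "nat \<Rightarrow> real \<Rightarrow> (real^'d) \<Rightarrow> (real^'d) measure"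
    and Z X Y :: "nat \<Rightarrow> (real^'d) measure \<Rightarrow> (real \<Rightarrow> real^'d) measure"
    and B :: "nat \<Rightarrow> ((real^'d) \<Rightarrow> real) set"
    and A A1 A2 :: "nat \<Rightarrow> (((real^'d) \<Rightarrow> real) \<times> ((real^'d) \<Rightarrow> real)) set"
    and \<pi> :: "nat \<Rightarrow> (real^'d) measure"
    and V :: "(nat \<Rightarrow> (real^'d) measure) set"
    and S :: "(real^'d) \<Rightarrow> real"
    and l l1 l2 :: "(real^'d) \<Rightarrow> (real^'d) \<Rightarrow> ereal"
    and H H1 H2 :: "((real^'d) \<Rightarrow> real) \<Rightarrow> (real^'d) \<Rightarrow> real"
    and h h1 h2 :: "(real^'d) \<Rightarrow> (real^'d) \<Rightarrow> real"
    and W F :: "(real^'d) \<Rightarrow> (real^'d)"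
  assumes processes: "\<And>n. markov_process (PZ n) (Z n)" "\<And>n. markov_process (PX n) (X n)"
      "\<And>n. markov_process (PY n) (Y n)"
    and generators: "\<And>n. generates (B n) (A n) (PZ n)" "\<And>n. generates (B n) (A1 n) (PX n)"
      "\<And>n. generates (B n) (A2 n) (PY n)"
    and decomposition: "\<And>n. sum_on_common_core (A n) (A1 n) (A2 n)"
    and invariant: "\<And>n. unique_invariant_measure (PZ n) (\<pi> n)"
      "\<And>n. unique_invariant_measure (PX n) (\<pi> n)" "\<And>n. unique_invariant_measure (PY n) (\<pi> n)"
    and ldp_invariant: "LDP euclidean \<pi> (\<lambda>z. ereal (S z))"
    and S_C1: "Ck 1 S"
    and reversible: "\<And>n. reversible_measure (PY n) (\<pi> n)"
    and initial_laws: "\<pi> \<in> V" "\<And>\<nu> n. \<nu> \<in> V \<Longrightarrow> \<nu> n \<in> space (prob_algebra borel)"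
    and path_ldp: "lagrangian_LDP V Z l" "lagrangian_LDP V X l1" "lagrangian_LDP V Y l2"
    and duality: "hamiltonian_lagrangian h l" "hamiltonian_lagrangian h1 l1"
      "hamiltonian_lagrangian h2 l2"
    and H_sum: "\<And>f z. smooth f \<Longrightarrow> H f z = H1 f z + H2 f z"
    and H_form: "\<And>f z. smooth f \<Longrightarrow> H f z = h z (grad f z)"
      "\<And>f z. smooth f \<Longrightarrow> H1 f z = h1 z (grad f z)"
      "\<And>f z. smooth f \<Longrightarrow> H2 f z = h2 z (grad f z)"
    and W_cont: "continuous_on UNIV W"
    and h1_linear: "\<And>z \<xi>. h1 z \<xi> = W z \<bullet> \<xi>"
    and h2_cont: "continuous_on UNIV (\<lambda>(z, \<xi>). h2 z \<xi>)"
    and h2_convex: "\<And>z. convex_on UNIV (h2 z)"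
    and zero_cost: "\<And>z v. l z v = 0 \<longleftrightarrow> v = F z"
  shows
    "(\<forall>n. \<forall>\<mu>\<in>space (prob_algebra borel). AE \<gamma> in Z n \<mu>. \<forall>t\<ge>0.
        (\<lambda>(z, a). a) (\<gamma> t, 0 :: real) = (\<lambda>(z, a). a) (\<gamma> 0, 0 :: real)) \<and>
     GENERIC (\<lambda>(z, a). (F z, 0)) (\<lambda>(z, a). S z) (\<lambda>(z, a). a) (L_hat W)
       (\<lambda>y. legendre (Psi_hat_star h2 S y)) (Psi_hat_star h2 S) \<and>
     (regular_potentials (\<lambda>_. 0) l2 (\<lambda>z \<xi>. ereal (h2 z \<xi>)) \<longrightarrow>
      regular_potentials (grad (\<lambda>(z, a). a))
        (\<lambda>y. legendre (Psi_hat_star h2 S y)) (Psi_hat_star h2 S))"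
proof (intro conjI allI ballI impI)
  fix n \<mu> 
  show "AE \<gamma> in Z n \<mu>. \<forall>t\<ge>0. (\<lambda>(z, a). a) (\<gamma> t, 0 :: real) = (\<lambda>(z, a). a) (\<gamma> 0, 0 :: real)"
    by simp
next
  have h1_cont: "continuous_on UNIV (\<lambda>(z, \<xi>). h1 z \<xi>)"
    unfolding h1_linear case_prod_unfold
    by (intro continuous_intros continuous_on_compose2[OF W_cont]) auto
  interpret X: stationary_LDP h1 l1 S \<pi> PX "\<lambda>n. X n (\<pi> n)"
    by (rule markov_stationary_LDP[OF h1_cont duality(2) S_C1 ldp_invariant processes(2)
      invariant(2) initial_laws(1) path_ldp(2)])
  interpret Y: stationary_LDP h2 l2 S \<pi> PY "\<lambda>n. Y n (\<pi> n)"
    by (rule markov_stationary_LDP[OF h2_cont duality(3) S_C1 ldp_invariant processes(3)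
      invariant(3) initial_laws(1) path_ldp(3)])
  interpret symmetric_hamiltonian h2 l2 S
    by unfold_locales (rule duality(3), rule S_C1, rule Y.reversible_symmetric[OF reversible])
  have orth: "W z \<bullet> grad S z = 0" for z
  proof -
    \<comment> \<open>As \<open>h1 z\<close> is linear, the velocity \<open>W z\<close> costs
      nothing, so the right-hand side of \<open>grad_S_le\<close> is 0.\<close>
    have "subgradient (h1 z) 0 (W z)" by (simp add: subgradient_def h1_linear)
    from X.grad_S_le[OF this] have "W z \<bullet> grad S z \<le> 0" by (simp add: h1_linear inner_commute)
    moreover have "0 \<le> W z \<bullet> grad S z" by (rule X.grad_S_ge_linear[OF W_cont h1_linear])
    ultimately show ?thesis by simp
  qed
  \<comment> \<open>The operators are tested on linear functions, whose gradients are arbitrary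
    constant covectors.\<close>
  have h_sum: "h z \<xi> = W z \<bullet> \<xi> + h2 z \<xi>" for z \<xi>
    using H_sum[OF smooth_inner_left] H_form[OF smooth_inner_left]
    by (metis grad_inner_left h1_linear)
  \<comment> \<open>A linear term added to a function translates its Legendre transform, so the
    drift W merely shifts velocities.\<close>
  have "l z v = l2 z (v - W z)" for z v
    using duality(1) l_eq unfolding hamiltonian_lagrangian_def h_sum
    by (simp add: legendre_add_linear)
  then have zero: "l2 z (F z - W z) = 0" for z using zero_cost by metis
  show "GENERIC (\<lambda>(z, a). (F z, 0)) (\<lambda>(z, a). S z) (\<lambda>(z, a). a) (L_hat W)
      (\<lambda>y. legendre (Psi_hat_star h2 S y)) (Psi_hat_star h2 S)"
    by (rule GENERIC_hat[OF orth zero])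
  show "regular_potentials (grad (\<lambda>(z, a). a)) (\<lambda>y. legendre (Psi_hat_star h2 S y)) (Psi_hat_star h2 S)"
    if "regular_potentials (\<lambda>_. 0) l2 (\<lambda>z \<xi>. ereal (h2 z \<xi>))"
    using that by (rule regular_potentials_hat)
qed

end
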